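(* Let $0<L,W<\infty$, $\tau=iW/L$, $N\in\mathbb{N}$ (with $N\ge2$ when $R_N=D_N$), $R_N\in\{A_{N-1},B_N,B_N^\vee,C_N,C_N^\vee,BC_N,D_N\}$, $\Lambda=[0,L)\times i[0,W)$. Consider the point process $\Xi^{R_N}$ on $\mathbb{C}$ which is doubly periodic with periods $(L,iW)$ and whose restriction to $\Lambda$ consists of $N$ unlabeled points with law $\mathbf{P}^{R_N}$ having density $\mathbf{p}^{R_N}(\mathbf{z})=Q^{R_N}(\mathbf{z})/Z^{R_N}$ with respect to $\frac{1}{N!}d\mathbf{z}$ on $\Lambda^N$ (here $Z^{R_N}=\frac1{N!}\int_{\Lambda^N}Q^{R_N}(\mathbf{z})d\mathbf{z}$). For $1\le N'\le N$ and $\mathbf{z}_{N'}=(z_1,\dots,z_{N'})\in\mathbb{C}^{N'}$ define the correlation function $\rho^{R_N}(\mathbf{z}_{N'})=\frac{1}{(N-N')!}\int_{\Lambda^{N-N'}}\mathbf{p}^{R_N}(z_1,\dots,z_N)\prod_{j=N'+1}^Ndz_j$. Then this process is determinantal: for all $1\le N'\le N$ and $\mathbf{z}_{N'}\in\mathbb{C}^{N'}$, $$\rho^{R_N}(\mathbf{z}_{N'})=\det_{1\le j,k\le N'}[K^{R_N}(z_j,z_k)],\qquad K^{R_N}(z,z')=e^{-\pi\mathcal{N}(y^2+y'^2)/(LW)}\sum_{n=1}^N\frac{1}{h^{R_N}_n}M^{R_N}_n(z)\overline{M^{R_N}_n(z')},$$ where $y=\Im z$, $y'=\Im z'$; and these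 correlation functions are doubly periodic with periods $(L,iW)$ in each variable.
   Context: Jacobi theta functions ($\Im\tau>0$, $q_0=e^{\pi i\tau}$): $\vartheta_0(v;\tau)=\sum_{n\in\mathbb{Z}}(-1)^nq_0^{n^2}e^{2\pi inv}$, $\vartheta_1(v;\tau)=i\sum_n(-1)^nq_0^{(n-1/2)^2}e^{(2n-1)\pi iv}$, $\vartheta_2(v;\tau)=\sum_nq_0^{(n-1/2)^2}e^{(2n-1)\pi iv}$, $\vartheta_3(v;\tau)=\sum_nq_0^{n^2}e^{2\pi inv}$. $\mathcal{N}=\mathcal{N}^{R_N}$: $N$ for $A_{N-1}$; $2N-1$ for $B_N$; $2N$ for $B_N^\vee,C_N^\vee$; $2(N+1)$ for $C_N$; $2N+1$ for $BC_N$; $2(N-1)$ for $D_N$. $J(j)$: $j-1/2$ for $A_{N-1},C_N^\vee$; $j-1$ for $B_N,B_N^\vee,D_N$; $j$ for $C_N,BC_N$. $s(N)=0$ ($N$ even), $3$ ($N$ odd). Macdonald denominators with $P(\boldsymbol\xi)=\prod_{1\le j<k\le N}\vartheta_1(\xi_k-\xi_j;\tau)\vartheta_1(\xi_k+\xi_j;\tau)$: $W^{A_{N-1}}=\prod_{j<k}\vartheta_1(\xi_k-\xi_j;\tau)$; $W^{B_N}=\prod_\ell\vartheta_1(\xi_\ell;\tau)P$; $W^{B_N^\vee}=\prod_\ell\vartheta_1(2\xi_\ell;2\tau)P$; $W^{C_N}=\prod_\ell\vartheta_1(2\xi_\ell;\tau)P$; $W^{C_N^\vee}=\prod_\ell\vartheta_1(\xi_\ell;\tau/2)P$;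 $W^{BC_N}=\prod_\ell\vartheta_1(\xi_\ell;\tau)\vartheta_0(2\xi_\ell;2\tau)P$; $W^{D_N}=P$. $Q^{A_{N-1}}(\mathbf{z})=\exp(-\frac{2\pi\mathcal{N}}{LW}\sum_jy_j^2)|\vartheta_{s(N)}(\sum_kz_k/L;\tau)|^2|W^{A_{N-1}}(\mathbf{z}/L;\tau)|^2$, and for other types $Q^{R_N}(\mathbf{z})=\exp(-\frac{2\pi\mathcal{N}}{LW}\sum_jy_j^2)|W^{R_N}(\mathbf{z}/L;\tau)|^2$ ($y_j=\Im z_j$). Functions $M_j=M^{R_N}_j$: for $A_{N-1}$, $M_j(z)=e^{2\pi iJ(j)z/L}\vartheta_2(J(j)\tau+\mathcal{N}z/L;\mathcal{N}\tau)$; for $B_N,B_N^\vee$, $M_j(z)=e^{2\pi iJ(j)z/L}\vartheta_1(J(j)\tau+\mathcal{N}z/L;\mathcal{N}\tau)-e^{-2\pi iJ(j)z/L}\vartheta_1(J(j)\tau-\mathcal{N}z/L;\mathcal{N}\tau)$; for $C_N,C_N^\vee,BC_N$ the same with $\vartheta_2$; for $D_N$, $e^{2\pi iJ(j)z/L}\vartheta_2(J(j)\tau+\mathcal{N}z/L;\mathcal{N}\tau)+e^{-2\pi iJ(j)z/L}\vartheta_2(J(j)\tau-\mathcal{N}z/L;\mathcal{N}\tau)$. Constants $h_j=h^{R_N}_j$, with $e_j=e^{-2\tau\pi iJ(j)^2/\mathcal{N}}$, $c=LW/\sqrt{2\mathcal{N}\Im\tau}$: $A_{N-1}$: $h_j=c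 e_j$; $C_N,C_N^\vee,BC_N$: $h_j=2ce_j$; $B_N,B_N^\vee$: $h_1=4ce_1$, $h_j=2ce_j$ ($j\ge2$); $D_N$: $h_j=4ce_j$ for $j\in\{1,N\}$, $2ce_j$ otherwise. *)

theory Defs
  imports "HOL-Analysis.Analysis"
begin

section \<open>Jacobi theta functions (q0 = exp(pi i tau), q0^x read as exp(pi i tau x))\<close>

definition theta0 :: "complex \<Rightarrow> complex \<Rightarrow> complex" where
  "theta0 v t = (\<Sum>\<^sub>\<infinity>n::int. (-1) powi n * exp (pi * \<i> * t * of_int (n^2))
                   * exp (2 * pi * \<i> * of_int n * v))"

definition theta1 :: "complex \<Rightarrow> complex \<Rightarrow> complex" where
  "theta1 v t = \<i> * (\<Sum>\<^sub>\<infinity>n::int. (-1) powi n * exp (pi * \<i> * t * (of_int n - 1/2)^2)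
                   * exp ((2 * of_int n - 1) * pi * \<i> * v))"

definition theta2 :: "complex \<Rightarrow> complex \<Rightarrow> complex" where
  "theta2 v t = (\<Sum>\<^sub>\<infinity>n::int. exp (pi * \<i> * t * (of_int n - 1/2)^2)
                   * exp ((2 * of_int n - 1) * pi * \<i> * v))"

definition theta3 :: "complex \<Rightarrow> complex \<Rightarrow> complex" where
  "theta3 v t = (\<Sum>\<^sub>\<infinity>n::int. exp (pi * \<i> * t * of_int (n^2))
                   * exp (2 * pi * \<i> * of_int n * v))"

section \<open>Root systems: A = A_{N-1}, Bv = B_N^vee, Cv = C_N^vee\<close>

datatype rs = A | B | Bv | C | Cv | BC | D

fun calN :: "rs \<Rightarrow> nat \<Rightarrow> real" where
  "calN A N = real N"
| "calN B N = 2 * real N - 1"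
| "calN Bv N = 2 * real N"
| "calN C N = 2 * (real N + 1)"
| "calN Cv N = 2 * real N"
| "calN BC N = 2 * real N + 1"
| "calN D N = 2 * (real N - 1)"

fun Jidx :: "rs \<Rightarrow> nat \<Rightarrow> real" where
  "Jidx A j = real j - 1/2"
| "Jidx Cv j = real j - 1/2"
| "Jidx B j = real j - 1"
| "Jidx Bv j = real j - 1"
| "Jidx D j = real j - 1"
| "Jidx C j = real j"
| "Jidx BC j = real j"

definition theta_s :: "nat \<Rightarrow> complex \<Rightarrow> complex \<Rightarrow> complex" where
  "theta_s N = (if even N then theta0 else theta3)"

section \<open>Macdonald denominators; points are indexed 1..N\<close>

definition Pden :: "nat \<Rightarrow> (nat \<Rightarrow> complex) \<Rightarrow> complex \<Rightarrow> complex" where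
  "Pden N xi t = (\<Prod>j\<in>{1..N}. \<Prod>k\<in>{j<..N}.
      theta1 (xi k - xi j) t * theta1 (xi k + xi j) t)"

fun Wden :: "rs \<Rightarrow> nat \<Rightarrow> (nat \<Rightarrow> complex) \<Rightarrow> complex \<Rightarrow> complex" where
  "Wden A N xi t = (\<Prod>j\<in>{1..N}. \<Prod>k\<in>{j<..N}. theta1 (xi k - xi j) t)"
| "Wden B N xi t = (\<Prod>l\<in>{1..N}. theta1 (xi l) t) * Pden N xi t"
| "Wden Bv N xi t = (\<Prod>l\<in>{1..N}. theta1 (2 * xi l) (2 * t)) * Pden N xi t"
| "Wden C N xi t = (\<Prod>l\<in>{1..N}. theta1 (2 * xi l) t) * Pden N xi t"
| "Wden Cv N xi t = (\<Prod>l\<in>{1..N}. theta1 (xi l) (t / 2)) * Pden N xi t"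
| "Wden BC N xi t = (\<Prod>l\<in>{1..N}. theta1 (xi l) t * theta0 (2 * xi l) (2 * t)) * Pden N xi t"
| "Wden D N xi t = Pden N xi t"

definition tau :: "real \<Rightarrow> real \<Rightarrow> complex" where
  "tau L W = \<i> * of_real (W / L)"

definition Qfun :: "rs \<Rightarrow> nat \<Rightarrow> real \<Rightarrow> real \<Rightarrow> (nat \<Rightarrow> complex) \<Rightarrow> real" where
  "Qfun R N L W z =
     exp (- (2 * pi * calN R N / (L * W)) * (\<Sum>j\<in>{1..N}. (Im (z j))^2))
     * (if R = A then (cmod (theta_s N ((\<Sum>k\<in>{1..N}. z k) / of_real L) (tau L W)))^2 else 1)
     * (cmod (Wden R N (\<lambda>j. z j / of_real L) (tau L W)))^2"

definition Lam :: "real \<Rightarrow> real \<Rightarrow> complex set" where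
  "Lam L W = {w. 0 \<le> Re w \<and> Re w < L \<and> 0 \<le> Im w \<and> Im w < W}"

definition int_Lam :: "real \<Rightarrow> real \<Rightarrow> nat set \<Rightarrow> ((nat \<Rightarrow> complex) \<Rightarrow> real) \<Rightarrow> real" where
  "int_Lam L W I f = set_lebesgue_integral (PiM I (\<lambda>_. lborel)) (PiE I (\<lambda>_. Lam L W)) f"

definition Zconst :: "rs \<Rightarrow> nat \<Rightarrow> real \<Rightarrow> real \<Rightarrow> real" where
  "Zconst R N L W = (1 / fact N) * int_Lam L W {1..N} (Qfun R N L W)"

definition pdens :: "rs \<Rightarrow> nat \<Rightarrow> real \<Rightarrow> real \<Rightarrow> (nat \<Rightarrow> complex) \<Rightarrow> real" where
  "pdens R N L W z = Qfun R N L W z / Zconst R N L W"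

definition rho :: "rs \<Rightarrow> nat \<Rightarrow> real \<Rightarrow> real \<Rightarrow> nat \<Rightarrow> (nat \<Rightarrow> complex) \<Rightarrow> real" where
  "rho R N L W N' z = (1 / fact (N - N')) *
     int_Lam L W {N'+1..N} (\<lambda>w. pdens R N L W (\<lambda>j. if j \<le> N' then z j else w j))"

definition Mfun :: "rs \<Rightarrow> nat \<Rightarrow> real \<Rightarrow> real \<Rightarrow> nat \<Rightarrow> complex \<Rightarrow> complex" where
  "Mfun R N L W j z =
    (let J = of_real (Jidx R j); NN = of_real (calN R N); t = tau L W; LL = of_real L;
         th = (if R \<in> {B, Bv} then theta1 else theta2) in
     if R = A then exp (2 * pi * \<i> * J * z / LL) * theta2 (J * t + NN * z / LL) (NN * t)
     else if R = D then exp (2 * pi * \<i> * J * z / LL) * theta2 (J * t + NN * z / LL) (NN * t)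
                      + exp (- 2 * pi * \<i> * J * z / LL) * theta2 (J * t - NN * z / LL) (NN * t)
     else exp (2 * pi * \<i> * J * z / LL) * th (J * t + NN * z / LL) (NN * t)
          - exp (- 2 * pi * \<i> * J * z / LL) * th (J * t - NN * z / LL) (NN * t))"

definition hconst :: "rs \<Rightarrow> nat \<Rightarrow> real \<Rightarrow> real \<Rightarrow> nat \<Rightarrow> complex" where
  "hconst R N L W j =
    (let e = exp (- 2 * tau L W * pi * \<i> * of_real ((Jidx R j)^2) / of_real (calN R N));
         c = of_real (L * W / sqrt (2 * calN R N * Im (tau L W)));
         m = (if R = A then 1
              else if R \<in> {B, Bv} then (if j = 1 then 4 else 2)
              else if R = D then (if j = 1 \<or> j = N then 4 else 2)
              else 2) in
     m * c * e)"

definition Kker :: "rs \<Rightarrow> nat \<Rightarrow> real \<Rightarrow> real \<Rightarrow> complex \<Rightarrow> complex \<Rightarrow> complex" where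
  "Kker R N L W z z' =
     of_real (exp (- pi * calN R N * ((Im z)^2 + (Im z')^2) / (L * W)))
     * (\<Sum>n\<in>{1..N}. (1 / hconst R N L W n) * Mfun R N L W n z * cnj (Mfun R N L W n z'))"

definition detn :: "nat \<Rightarrow> (nat \<Rightarrow> nat \<Rightarrow> complex) \<Rightarrow> complex" where
  "detn n M = (\<Sum>p | p permutes {1..n}. of_int (sign p) * (\<Prod>i\<in>{1..n}. M i (p i)))"

end

theory Submission
  imports Defs
    "HOL-Complex_Analysis.Conformal_Mappings"
    "HOL-Probability.Distributions"
    "Jordan_Normal_Form.Determinant"
begin

text \<open>
  Put v = z / L. In terms of v, every M_j is an absolutely convergent Fourier series in exp(pi i m v),
  and for a quasi-periodic function the coefficient at m determines the one at m + 2 calN.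
  Hence the quasi-periodic (odd or even) functions of the right type are exactly the span of the M_j.
  As a function of one variable the Macdonald denominator (for A_{N-1} together with the factor
  theta_{s(N)}) is of this type, and it is alternating in all variables; expanding it in every
  variable shows that it is a constant multiple of det M_j(z_k).
  The constant is not needed, only that it is not 0, which holds because the denominator does not
  vanish at (u, 2 u, ..., N u) for all but countably many u.
  Integrating Fourier series term by term shows that the M_j are orthogonal with norms h_j, since the
  Gaussian integrals over the translates of [0, W) add up to one over the real line.
  The density is therefore the squared modulus of a determinant of orthonormal functions, that is
  det K(z_j, z_k), and the reproducing property of K integrates out one variable at a time.
\<close>

section \<open>Fourier series with frequencies in pi Z\<close>

text \<open>The seven root systems differ only in the degree \<open>calN\<close>, the doubled
  indices 2 J, a sign choosing theta1 or theta2, and the parity under reflection, so the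
  one-variable analysis is done once for abstract data. The number \<open>calN\<close> is the degree
  of the denominator in one variable: each pair contributes 2 (1 in type A), and the remaining
  factors in that variable contribute 1, 2, 4, 2, 3, 0 for B, Bv, C, Cv, BC, D. Frequencies lie in
  pi Z because theta1 and theta2 carry half-integer exponents. The expansion in every variable
  interpolates at N nodes, so it requires points where the determinant of the M_j is nonzero. These
  come from orthogonality: the determinant of the orthonormal functions has squared L2 norm N!,
  hence does not vanish identically. The points z_1, ..., z_{N'} range over the whole plane although
  integration is over the fundamental domain. Under the periods the orthonormal functions change by
  a common phase, which cancels in the determinant of the kernel; this gives the double
  periodicity.\<close>

lemma has_sum_times:
  fixes f :: "'a \<Rightarrow> complex" and g :: "'b \<Rightarrow> complex"
  assumes "(f has_sum s) S" and "(g has_sum t) T"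
  shows "((\<lambda>(x, y). f x * g y) has_sum (s * t)) (S \<times> T)"
proof (rule has_sum_SigmaI)
  show "((\<lambda>y. case (x, y) of (x, y) \<Rightarrow> f x * g y) has_sum f x * t) T" for x
    using assms(2) by (simp add: has_sum_cmult_right)
  show "((\<lambda>x. f x * t) has_sum s * t) S"
    using assms(1) by (rule has_sum_cmult_left)
  have f: "(\<lambda>x. norm (f x)) summable_on S" and g: "(\<lambda>y. norm (g y)) summable_on T"
    using assms by (auto simp: summable_on_iff_abs_summable_on_complex[symmetric] summable_on_def)
  have "(\<lambda>z. norm (case z of (x, y) \<Rightarrow> f x * g y)) summable_on S \<times> T"
    unfolding Infinite_Sum.abs_summable_on_Sigma_iff
    using f g by (auto simp: norm_mult infsum_cmult_right' infsum_nonneg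
        intro!: summable_on_cmult_right summable_on_cmult_left)
  then show "(\<lambda>(x, y). f x * g y) summable_on S \<times> T"
    by (rule Infinite_Sum.abs_summable_summable)
qed

text \<open>Convergence is demanded at every complex \<open>v\<close>, so the coefficients decay
  faster than any exponential. This makes \<open>g\<close> entire and keeps the class closed under
  complex translations.\<close>

definition has_fourier :: "(int \<Rightarrow> complex) \<Rightarrow> (complex \<Rightarrow> complex) \<Rightarrow> bool" where
  "has_fourier a g \<longleftrightarrow>
     (\<forall>v. ((\<lambda>m. a m * exp (pi * \<i> * of_int m * v)) has_sum g v) UNIV)"

lemma has_fourierD: "has_fourier a g \<Longrightarrow> ((\<lambda>m. a m * exp (pi * \<i> * of_int m * v)) has_sum g v) UNIV"
  by (simp add: has_fourier_def)

lemma has_fourier_cong: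
  "has_fourier a g \<Longrightarrow> (\<And>m. a m = b m) \<Longrightarrow> (\<And>v. g v = h v) \<Longrightarrow> has_fourier b h"
  by (simp add: has_fourier_def)

text \<open>Cauchy product: the double family is summable, so it may be regrouped along the total
  frequency. Later only the existence of coefficients is used, hence the existential form.\<close>

lemma has_fourier_mult:
  assumes f: "has_fourier a f" and g: "has_fourier b g"
  shows "\<exists>c. has_fourier c (\<lambda>v. f v * g v)"
proof -
  define c where "c m = (\<Sum>\<^sub>\<infinity>n. a (m - n) * b n)" for m
  have "((\<lambda>m. c m * exp (pi * \<i> * of_int m * v)) has_sum f v * g v) UNIV" for v
  proof -
    let ?e = "\<lambda>m::int. exp (pi * \<i> * of_int m * v)"
    have e: "?e (m - n) * ?e n = ?e m" for m n
      by (simp add: exp_add[symmetric] algebra_simps)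
    have "((\<lambda>(m, n). (a m * ?e m) * (b n * ?e n)) has_sum f v * g v) (UNIV \<times> UNIV)"
      by (rule has_sum_times[OF has_fourierD[OF f] has_fourierD[OF g]])
    also have "?this \<longleftrightarrow> ((\<lambda>(m, n). (a (m - n) * ?e (m - n)) * (b n * ?e n)) has_sum f v * g v) (UNIV \<times> UNIV)"
      by (rule has_sum_reindex_bij_witness[where i = "\<lambda>(m,n). (m - n, n)" and j = "\<lambda>(m,n). (m + n, n)"]) auto
    also have "(\<lambda>(m, n). (a (m - n) * ?e (m - n)) * (b n * ?e n)) = (\<lambda>(m, n). (a (m - n) * b n) * ?e m)"
      using e by (auto simp: fun_eq_iff mult_ac)
    finally have *: "((\<lambda>(m, n). (a (m - n) * b n) * ?e m) has_sum f v * g v) (Sigma UNIV (\<lambda>_. UNIV))" .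
    show ?thesis
    proof (rule has_sum_SigmaD[OF *])
      fix m :: int
      have "(\<lambda>n. (a (m - n) * b n) * ?e m) summable_on UNIV"
        using summable_on_SigmaD1[of "\<lambda>m n. (a (m - n) * b n) * ?e m" UNIV "\<lambda>_. UNIV" m] *
        by (auto simp: summable_on_def)
      then have "(\<lambda>n. a (m - n) * b n) summable_on UNIV"
        using summable_on_cmult_left'[of "?e m" "\<lambda>n. a (m - n) * b n" UNIV] by simp
      then have "((\<lambda>n. a (m - n) * b n) has_sum c m) UNIV"
        unfolding c_def by (rule has_sum_infsum)
      then show "((\<lambda>n. case (m, n) of (m, n) \<Rightarrow> (a (m - n) * b n) * ?e m) has_sum c m * ?e m) UNIV"
        by (simp add: has_sum_cmult_left)
    qed
  qed
  then show ?thesis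
    unfolding has_fourier_def by blast
qed

lemma has_fourier_add:
  "has_fourier a f \<Longrightarrow> has_fourier b g \<Longrightarrow> has_fourier (\<lambda>m. a m + b m) (\<lambda>v. f v + g v)"
  unfolding has_fourier_def by (auto simp: distrib_right intro!: has_sum_add)

lemma has_fourier_cmult:
  "has_fourier a f \<Longrightarrow> has_fourier (\<lambda>m. c * a m) (\<lambda>v. c * f v)"
  unfolding has_fourier_def by (auto simp: mult.assoc intro!: has_sum_cmult_right)

lemma has_fourier_0: "has_fourier (\<lambda>_. 0) (\<lambda>_. 0)"
  unfolding has_fourier_def by auto

lemma has_fourier_sum:
  assumes "\<And>i. i \<in> I \<Longrightarrow> has_fourier (a i) (f i)"
  shows "has_fourier (\<lambda>m. \<Sum>i\<in>I. a i m) (\<lambda>v. \<Sum>i\<in>I. f i v)"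
  using assms
  by (induction I rule: infinite_finite_induct)
    (auto intro: has_fourier_0 has_fourier_add)

lemma has_fourier_const: "has_fourier (\<lambda>m. if m = 0 then c else 0) (\<lambda>_. c)"
  unfolding has_fourier_def
proof
  fix v
  have "((\<lambda>m::int. c) has_sum c) {0}" using has_sum_finite[of "{0::int}" "\<lambda>_. c"] by simp
  then show "((\<lambda>m. (if m = 0 then c else 0) * exp (pi * \<i> * of_int m * v)) has_sum c) UNIV"
    by (rule has_sum_cong_neutral[THEN iffD1, rotated -1]) auto
qed

lemma has_fourier_shift:
  assumes "has_fourier a g"
  shows "has_fourier (\<lambda>m. a m * exp (pi * \<i> * of_int m * t)) (\<lambda>v. g (v + t))"
  unfolding has_fourier_def
proof
  fix v
  have "(\<lambda>m. a m * exp (pi * \<i> * of_int m * (v + t))) = (\<lambda>m. a m * exp (pi * \<i> * of_int m * t) * exp (pi * \<i> * of_int m * v))"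
    by (auto simp: fun_eq_iff distrib_left exp_add)
  then show "((\<lambda>m. a m * exp (pi * \<i> * of_int m * t) * exp (pi * \<i> * of_int m * v)) has_sum g (v + t)) UNIV"
    using has_fourierD[OF assms, of "v + t"] by simp
qed

lemma has_fourier_minus:
  assumes "has_fourier a g"
  shows "has_fourier (\<lambda>m. a (- m)) (\<lambda>v. g (- v))"
  unfolding has_fourier_def
proof
  fix v
  have "((\<lambda>m. a m * exp (pi * \<i> * of_int m * - v)) has_sum g (- v)) UNIV \<longleftrightarrow>
        ((\<lambda>m. a (- m) * exp (pi * \<i> * of_int m * v)) has_sum g (- v)) UNIV"
    by (rule has_sum_reindex_bij_witness[where i = uminus and j = uminus]) auto
  then show "((\<lambda>m. a (- m) * exp (pi * \<i> * of_int m * v)) has_sum g (- v)) UNIV"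
    using has_fourierD[OF assms, of "- v"] by simp
qed

lemma has_fourier_exp_mult:
  assumes "has_fourier a g"
  shows "has_fourier (\<lambda>m. a (m - k)) (\<lambda>v. exp (pi * \<i> * of_int k * v) * g v)"
  unfolding has_fourier_def
proof
  fix v
  have "((\<lambda>m. exp (pi * \<i> * of_int k * v) * (a m * exp (pi * \<i> * of_int m * v)))
          has_sum exp (pi * \<i> * of_int k * v) * g v) UNIV"
    by (rule has_sum_cmult_right[OF has_fourierD[OF assms]])
  also have "?this \<longleftrightarrow> ((\<lambda>m. a (m - k) * exp (pi * \<i> * of_int m * v)) has_sum exp (pi * \<i> * of_int k * v) * g v) UNIV"
    by (rule has_sum_reindex_bij_witness[where i = "\<lambda>m. m - k" and j = "\<lambda>m. m + k"])
      (auto simp: distrib_left distrib_right exp_add)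
  finally show "((\<lambda>m. a (m - k) * exp (pi * \<i> * of_int m * v)) has_sum exp (pi * \<i> * of_int k * v) * g v) UNIV" .
qed

text \<open>A series supported on the progression \<open>p * n + r\<close>, as theta series are, is
  padded with zero coefficients at all other frequencies.\<close>

lemma has_fourier_lacunary:
  fixes p r :: int
  assumes p: "p \<noteq> 0" and g: "\<And>v. ((\<lambda>n. b n * exp (pi * \<i> * of_int (p * n + r) * v)) has_sum g v) UNIV"
  shows "has_fourier (\<lambda>m. if p dvd m - r then b ((m - r) div p) else 0) g"
  unfolding has_fourier_def
proof
  fix v
  let ?a = "\<lambda>m. if p dvd m - r then b ((m - r) div p) else 0"
  let ?F = "\<lambda>m. ?a m * exp (pi * \<i> * of_int m * v)"
  let ?h = "\<lambda>n. p * n + r"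
  have inj: "inj ?h" using p by (simp add: inj_def)
  have "?F (?h n) = b n * exp (pi * \<i> * of_int (?h n) * v)" for n
    using p by simp
  then have "?F \<circ> ?h = (\<lambda>n. b n * exp (pi * \<i> * of_int (?h n) * v))"
    by (simp only: fun_eq_iff o_def) blast
  then have "(?F has_sum g v) (range ?h)"
    by (simp only: has_sum_reindex[OF inj] g)
  then show "(?F has_sum g v) UNIV"
  proof (rule has_sum_cong_neutral[THEN iffD1, rotated -1])
    fix m assume "m \<in> UNIV - range ?h"
    have "\<not> p dvd m - r"
    proof
      assume "p dvd m - r"
      then obtain c where "m - r = p * c" by (auto simp: dvd_def)
      then have "m = ?h c" by simp
      then show False using \<open>m \<in> UNIV - range ?h\<close> by blast
    qed
    then show "?F m = 0" by simp
  qed simp_all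
qed

lemma has_fourier_dilate2:
  assumes "has_fourier a g"
  shows "has_fourier (\<lambda>m. if even m then a (m div 2) else 0) (\<lambda>v. g (2 * v))"
proof -
  have e: "pi * \<i> * of_int n * (2 * v) = pi * \<i> * of_int (2 * n + 0) * v" for n :: int and v
    by simp
  have "((\<lambda>n. a n * exp (pi * \<i> * of_int (2 * n + 0) * v)) has_sum g (2 * v)) UNIV" for v
    using has_fourierD[OF assms, of "2 * v"] unfolding e .
  then have "has_fourier (\<lambda>m. if 2 dvd m - 0 then a ((m - 0) div 2) else 0) (\<lambda>v. g (2 * v))"
    by (intro has_fourier_lacunary) simp_all
  then show ?thesis unfolding diff_0_right .
qed

text \<open>On the strip, |exp(pi i m v)| = exp(- pi m Im v) is at most its value at one of the
  boundary points i r and - i r, depending on the sign of m. Adding the moduli at both points gives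
  a majorant independent of \<open>v\<close>.\<close>

lemma has_fourier_bound:
  assumes "has_fourier a g"
  obtains Bd where "Bd summable_on UNIV"
    and "\<And>m v. \<bar>Im v\<bar> \<le> r \<Longrightarrow> norm (a m * exp (pi * \<i> * of_int m * v)) \<le> Bd m"
proof -
  let ?Bd = "\<lambda>m. norm (a m * exp (pi * \<i> * of_int m * (\<i> * of_real r)))
                + norm (a m * exp (pi * \<i> * of_int m * (- \<i> * of_real r)))"
  have "(\<lambda>m. norm (a m * exp (pi * \<i> * of_int m * v))) summable_on UNIV" for v
    using has_fourierD[OF assms, of v]
    by (auto simp: summable_on_iff_abs_summable_on_complex[symmetric] summable_on_def)
  then have "?Bd summable_on UNIV"
    by (intro summable_on_add) 
  moreover have "norm (a m * exp (pi * \<i> * of_int m * v)) \<le> ?Bd m" if "\<bar>Im v\<bar> \<le> r" for m v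
  proof -
    have "exp (- (pi * of_int m * Im v)) \<le> exp (pi * (of_int m * r)) + exp (- (pi * (of_int m * r)))"
    proof (cases "m \<ge> 0")
      case True
      then have "of_int m * - Im v \<le> of_int m * r" 
        using that by (intro mult_left_mono) auto
      then have "- (pi * of_int m * Im v) \<le> pi * (of_int m * r)" 
        using mult_left_mono[of "of_int m * - Im v" "of_int m * r" pi] by (simp add: mult_ac)
      then have "exp (- (pi * of_int m * Im v)) \<le> exp (pi * (of_int m * r))" by simp
      then show ?thesis by (smt (verit) exp_gt_zero)
    next
      case False
      then have "of_int (- m) * Im v \<le> of_int (- m) * r" 
        using that by (intro mult_left_mono) auto
      then have "- (pi * of_int m * Im v) \<le> - (pi * (of_int m * r))" 
        using mult_left_mono[of "of_int (- m) * Im v" "of_int (- m) * r" pi] by (simp add: mult_ac)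
      then have "exp (- (pi * of_int m * Im v)) \<le> exp (- (pi * (of_int m * r)))" by simp
      then show ?thesis by (smt (verit) exp_gt_zero)
    qed
    from mult_left_mono[OF this, of "norm (a m)"] show ?thesis
      by (simp add: norm_mult norm_exp_eq_Re algebra_simps)
  qed
  ultimately show ?thesis by (rule that)
qed

lemma has_fourier_holomorphic:
  assumes "has_fourier a g"
  shows "g holomorphic_on UNIV"
proof -
  have "g field_differentiable at v" for v
  proof -
    obtain Bd where Bd: "Bd summable_on UNIV"
      "\<And>m v'. \<bar>Im v'\<bar> \<le> \<bar>Im v\<bar> + 1 \<Longrightarrow> norm (a m * exp (pi * \<i> * of_int m * v')) \<le> Bd m"
      by (rule has_fourier_bound[OF assms, of "\<bar>Im v\<bar> + 1"]) blast
    have "\<bar>Im v'\<bar> \<le> \<bar>Im v\<bar> + 1" if "v' \<in> cball v 1" for v'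
      using that abs_Im_le_cmod[of "v - v'"] by (auto simp: dist_norm)
    then have "uniform_limit (cball v 1) (\<lambda>X v. \<Sum>m\<in>X. a m * exp (pi * \<i> * of_int m * v)) g (finite_subsets_at_top UNIV)"
      using Bd(2) by (intro Weierstrass_m_test_general'[OF _ _ Bd(1)] has_fourierD[OF assms]) auto
    then obtain "g holomorphic_on ball v 1"
      by (rule holomorphic_uniform_limit[rotated]) (auto intro!: always_eventually continuous_intros holomorphic_intros)
    then show ?thesis
      using holomorphic_on_imp_differentiable_at by fastforce
  qed
  then show ?thesis by (simp add: holomorphic_on_def)
qed

section \<open>Termwise integration and uniqueness of Fourier coefficients\<close>

text \<open>The majorant makes the partial sums converge uniformly on \<Lambda>, and finite measure
  passes uniform convergence on to the integrals. The limit runs along finite subsets of an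
  arbitrary index type, which covers single and double series alike.\<close>

lemma has_sum_integral_finite_measure:
  fixes f :: "'i \<Rightarrow> 'a \<Rightarrow> complex"
  assumes fin: "emeasure M \<Lambda> < \<infinity>" and \<Lambda>: "\<Lambda> \<in> sets M"
    and f: "\<And>i. f i \<in> borel_measurable M" and g: "g \<in> borel_measurable M"
    and Bd: "Bd summable_on UNIV" "\<And>i x. x \<in> \<Lambda> \<Longrightarrow> norm (f i x) \<le> Bd i"
    and s: "\<And>x. x \<in> \<Lambda> \<Longrightarrow> ((\<lambda>i. f i x) has_sum g x) UNIV"
  shows "((\<lambda>i. set_lebesgue_integral M \<Lambda> (f i)) has_sum set_lebesgue_integral M \<Lambda> g) UNIV"
proof -
  have bd: "set_integrable M \<Lambda> h" if "h \<in> borel_measurable M" "\<And>x. x \<in> \<Lambda> \<Longrightarrow> norm (h x) \<le> Cc" for h :: "'a \<Rightarrow> complex" and Cc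
    unfolding set_integrable_def
    by (rule integrableI_bounded_set_indicator[OF \<Lambda> that(1) fin]) (use that(2) in auto)
  have fi: "set_integrable M \<Lambda> (f i)" for i
    by (rule bd[OF f Bd(2)])
  have gs: "norm (g x) \<le> infsum Bd UNIV" if "x \<in> \<Lambda>" for x
  proof -
    have n: "(\<lambda>i. norm (f i x)) summable_on UNIV"
      using s[OF that] by (auto simp: summable_on_iff_abs_summable_on_complex[symmetric] summable_on_def)
    have "norm (g x) \<le> (\<Sum>\<^sub>\<infinity>i. norm (f i x))"
      using norm_infsum_bound[OF n] infsumI[OF s[OF that]] by simp
    also have "\<dots> \<le> infsum Bd UNIV"
      using n Bd that by (intro infsum_mono) auto
    finally show ?thesis .
  qed
  have gi: "set_integrable M \<Lambda> g"
    by (rule bd[OF g gs])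
  have unif: "uniform_limit \<Lambda> (\<lambda>X x. \<Sum>i\<in>X. f i x) g (finite_subsets_at_top UNIV)"
    using Bd s by (intro Weierstrass_m_test_general'[OF _ _ Bd(1)]) auto
  show ?thesis
    unfolding has_sum_def
  proof (rule tendstoI)
    fix e :: real assume "e > 0"
    \<comment> \<open>The added 1 keeps e / m meaningful on a null set and makes the final
      inequality strict.\<close>
    define m where "m = measure M \<Lambda> + 1"
    have m: "m > 0" by (simp add: m_def add_nonneg_pos)
    have "\<forall>\<^sub>F X in finite_subsets_at_top UNIV. \<forall>x\<in>\<Lambda>. dist (\<Sum>i\<in>X. f i x) (g x) < e / m"
      using uniform_limitD[OF unif, of "e / m"] \<open>e > 0\<close> m by simp
    then show "\<forall>\<^sub>F X in finite_subsets_at_top UNIV.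
        dist (\<Sum>i\<in>X. set_lebesgue_integral M \<Lambda> (f i)) (set_lebesgue_integral M \<Lambda> g) < e"
    proof eventually_elim
      case (elim X)
      have si: "set_integrable M \<Lambda> (\<lambda>x. \<Sum>i\<in>X. f i x)"
        using fi unfolding set_integrable_def scaleR_sum_right
        by (intro Bochner_Integration.integrable_sum) auto
      have sumeq: "(\<Sum>i\<in>X. set_lebesgue_integral M \<Lambda> (f i)) = set_lebesgue_integral M \<Lambda> (\<lambda>x. \<Sum>i\<in>X. f i x)"
        using fi unfolding set_lebesgue_integral_def set_integrable_def scaleR_sum_right
        by (subst Bochner_Integration.integral_sum) auto
      have "norm (set_lebesgue_integral M \<Lambda> (\<lambda>x. (\<Sum>i\<in>X. f i x) - g x)) \<le> (LINT x:\<Lambda>|M. norm ((\<Sum>i\<in>X. f i x) - g x))"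
        by (rule set_integral_norm_bound[OF set_integral_diff(1)[OF si gi]])
      also have "\<dots> \<le> (LINT x:\<Lambda>|M. e / m)"
      proof (rule set_integral_mono)
        show "set_integrable M \<Lambda> (\<lambda>x. norm ((\<Sum>i\<in>X. f i x) - g x))"
          by (rule set_integrable_norm[OF set_integral_diff(1)[OF si gi]])
        show "set_integrable M \<Lambda> (\<lambda>x. e / m)"
          using fin \<Lambda> by (simp add: set_integrable_def)
      qed (use elim in \<open>auto simp: dist_norm intro: less_imp_le\<close>)
      also have "\<dots> = measure M \<Lambda> * (e / m)"
        using \<Lambda> fin by (simp add: set_lebesgue_integral_def)
      also have "\<dots> < e"
        using m \<open>e > 0\<close> by (simp add: m_def field_simps)
      finally show ?case
        by (simp add: dist_norm sumeq set_integral_diff(2)[OF si gi])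
    qed
  qed
qed

lemma integral_exp_period:
  fixes L :: real and n :: int
  assumes "L > 0"
  shows "(LINT x:{0..<L}|lborel. exp (\<i> * of_real (2 * pi * of_int n / L * x))) = (if n = 0 then of_real L else 0)"
proof (cases "n = 0")
  case True
  then show ?thesis using assms by (simp add: set_lebesgue_integral_def scaleR_conv_of_real)
next
  case False
  define c where "c = \<i> * of_real (2 * pi * of_int n / L)"
  let ?F = "\<lambda>x::real. exp (c * of_real x) / c"
  have c: "c \<noteq> 0" using False assms by (simp add: c_def)
  have "(LBINT x=ereal 0..ereal L. exp (c * of_real x)) = ?F L - ?F 0"
  proof (rule interval_integral_FTC_finite)
    show "continuous_on {min 0 L..max 0 L} (\<lambda>x. exp (c * of_real x))"
      by (intro continuous_intros)
    show "(?F has_vector_derivative exp (c * complex_of_real x)) (at x within {min 0 L..max 0 L})" for x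
    proof -
      have "((\<lambda>z. exp (c * z) / c) has_field_derivative exp (c * complex_of_real x)) (at (complex_of_real x))"
        using c by (auto intro!: derivative_eq_intros)
      then show ?thesis
        using has_vector_derivative_real_field has_vector_derivative_at_within by fast
    qed
  qed
  also have "?F L = ?F 0"
  proof -
    have "c * of_real L = 2 * of_int n * of_real pi * \<i>"
      using assms by (simp add: c_def field_simps)
    moreover have "exp (2 * of_int n * of_real pi * \<i>) = 1"
      by (auto simp: exp_eq_1 intro: exI[of _ n])
    ultimately show ?thesis by simp
  qed
  also have "(LBINT x=ereal 0..ereal L. exp (c * of_real x)) = (LINT x:{0..<L}|lborel. exp (c * of_real x))"
    using assms by (simp add: interval_integral_Ico)
  finally have "(LINT x:{0..<L}|lborel. exp (c * of_real x)) = 0" by simp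
  moreover have "exp (\<i> * of_real (2 * pi * of_int n / L * x)) = exp (c * of_real x)" for x
    by (simp add: c_def mult_ac)
  ultimately show ?thesis using False by simp
qed

text \<open>Frequencies in pi Z have the common period 2; this is the length of the interval and the
  factor in front of \<open>a k\<close>.\<close>

lemma has_fourier_coeff:
  assumes "has_fourier a g"
  shows "(LINT x:{0..<2}|lborel. g (of_real x) * exp (- (pi * \<i> * of_int k * of_real x))) = 2 * a k"
proof -
  let ?e = "\<lambda>x::real. exp (- (pi * \<i> * of_int k * of_real x))"
  let ?f = "\<lambda>m x. a m * exp (pi * \<i> * of_int m * of_real x) * ?e x"
  obtain Bd where Bd: "Bd summable_on UNIV"
      "\<And>m v. \<bar>Im v\<bar> \<le> 0 \<Longrightarrow> norm (a m * exp (pi * \<i> * of_int m * v)) \<le> Bd m"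
    by (rule has_fourier_bound[OF assms, of 0]) blast
  have cont: "continuous_on UNIV g"
    by (rule holomorphic_on_imp_continuous_on[OF has_fourier_holomorphic[OF assms]])
  have sums: "((\<lambda>m. LINT x:{0..<2}|lborel. ?f m x) has_sum (LINT x:{0..<2}|lborel. g (of_real x) * ?e x)) UNIV"
  proof (rule has_sum_integral_finite_measure[OF _ _ _ _ Bd(1)])
    show "(\<lambda>x. g (of_real x) * ?e x) \<in> borel_measurable lborel"
      by (simp, intro borel_measurable_continuous_onI continuous_intros continuous_on_compose2[OF cont]) auto
    show "norm (?f m x) \<le> Bd m" for m x
      using Bd(2)[of "of_real x" m] by (simp add: norm_mult norm_exp_eq_Re)
    show "((\<lambda>m. ?f m x) has_sum g (of_real x) * ?e x) UNIV" for x
      by (intro has_sum_cmult_left has_fourierD[OF assms])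
  qed (auto intro!: borel_measurable_continuous_onI continuous_intros)
  have terms: "(\<lambda>m. LINT x:{0..<2}|lborel. ?f m x) = (\<lambda>m. if m = k then 2 * a k else 0)"
  proof
    fix m
    have "pi * \<i> * of_int m * of_real x + - (pi * \<i> * of_int k * of_real x)
          = \<i> * of_real (2 * pi * of_int (m - k) / 2 * x)" for x
      by (simp add: algebra_simps)
    then have "?f m x = a m * exp (\<i> * of_real (2 * pi * of_int (m - k) / 2 * x))" for x
      by (simp only: exp_add[symmetric] mult.assoc)
    then have "(LINT x:{0..<2}|lborel. ?f m x) = a m * (LINT x:{0..<2}|lborel. exp (\<i> * of_real (2 * pi * of_int (m - k) / 2 * x)))"
      by (simp only: set_integral_mult_right)
    also have "\<dots> = (if m = k then 2 * a k else 0)"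
      by (subst integral_exp_period) auto
    finally show "(LINT x:{0..<2}|lborel. ?f m x) = (if m = k then 2 * a k else 0)" .
  qed
  have one: "((\<lambda>m. if m = k then 2 * a k else 0) has_sum 2 * a k) UNIV"
  proof -
    have "((\<lambda>m. 2 * a k) has_sum 2 * a k) {k}" using has_sum_finite[of "{k}" "\<lambda>_. 2 * a k"] by simp
    then show ?thesis by (rule has_sum_cong_neutral[THEN iffD1, rotated -1]) auto
  qed
  show ?thesis
    by (rule has_sum_unique[OF sums[unfolded terms] one])
qed

lemma has_fourier_unique:
  assumes "has_fourier a g" and "has_fourier b g"
  shows "a = b"
proof
  fix k
  have "2 * a k = 2 * b k"
    using has_fourier_coeff[OF assms(1), of k] has_fourier_coeff[OF assms(2), of k] by (rule trans[OF sym])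
  then show "a k = b k" by simp
qed

text \<open>By uniqueness a nonzero coefficient excludes \<open>g\<close> = 0, and a nonconstant
  entire function has only countably many zeros.\<close>

lemma has_fourier_countable_zeros:
  assumes g: "has_fourier a g" and "a k \<noteq> 0"
  shows "countable {v. g v = 0}"
proof (cases "g constant_on UNIV")
  case True
  then obtain c where c: "g = (\<lambda>_. c)" by (auto simp: constant_on_def)
  have "c \<noteq> 0"
  proof
    assume "c = 0"
    then have "has_fourier (\<lambda>_. 0) g" using has_fourier_0 c by simp
    from has_fourier_unique[OF g this] assms(2) show False by simp
  qed
  then show ?thesis by (simp add: c)
next
  case False
  have "countable {v\<in>UNIV. g v = 0}"
    by (rule holomorphic_countable_zeros[OF has_fourier_holomorphic[OF g]]) (use False in auto)
  then show ?thesis by simp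
qed

section \<open>Theta functions and quasi-periodicity\<close>

lemma summable_on_exp_neg_abs_int: "(\<lambda>n::int. exp (- \<bar>real_of_int n\<bar>)) summable_on UNIV"
proof -
  let ?f = "\<lambda>n::int. exp (- \<bar>real_of_int n\<bar>)"
  have "summable (\<lambda>n. exp (- 1) ^ n :: real)"
    by (rule summable_geometric) simp
  then have n: "(\<lambda>n::nat. exp (- real n)) summable_on UNIV"
    by (intro norm_summable_imp_summable_on) (simp add: exp_of_nat_mult[symmetric])
  have "?f summable_on (range int)"
    by (subst summable_on_reindex) (use n in \<open>auto simp: o_def\<close>)
  moreover have "?f summable_on (range (\<lambda>n. - int n))"
    by (subst summable_on_reindex) (use n in \<open>auto simp: o_def inj_def\<close>)
  ultimately have "?f summable_on (range int \<union> range (\<lambda>n. - int n))"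
    by (rule summable_on_union)
  also have "range int \<union> range (\<lambda>n. - int n) = UNIV"
    by (auto intro: int_cases2)
  finally show ?thesis .
qed

lemma summable_on_exp_quadratic_real:
  fixes \<alpha> \<beta> :: real
  assumes "\<alpha> > 0"
  shows "(\<lambda>n::int. exp (- \<alpha> * of_int n ^ 2 + \<beta> * of_int n)) summable_on UNIV"
proof -
  \<comment> \<open>The surplus 1 in the linear coefficient pays for the factor exp(-|n|) of the
    comparison series; completing the square bounds the rest.\<close>
  define b where "b = \<bar>\<beta>\<bar> + 1"
  have le: "exp (- \<alpha> * of_int n ^ 2 + \<beta> * of_int n) \<le> exp (b\<^sup>2 / (4 * \<alpha>)) * exp (- \<bar>real_of_int n\<bar>)" for n
  proof -
    define x where "x = \<bar>real_of_int n\<bar>"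
    have "0 \<le> \<alpha> * (x - b / (2 * \<alpha>))\<^sup>2" using assms by simp
    also have "\<alpha> * (x - b / (2 * \<alpha>))\<^sup>2 = \<alpha> * x\<^sup>2 - b * x + b\<^sup>2 / (4 * \<alpha>)"
      using assms by (simp add: power2_eq_square field_simps)
    finally have "- \<alpha> * x\<^sup>2 + b * x \<le> b\<^sup>2 / (4 * \<alpha>)" by simp
    moreover have "\<beta> * of_int n \<le> \<bar>\<beta>\<bar> * x"
      unfolding x_def abs_mult[symmetric] by simp
    moreover have "b * x = \<bar>\<beta>\<bar> * x + x" by (simp add: b_def distrib_right)
    moreover have "real_of_int n ^ 2 = x\<^sup>2" by (simp add: x_def)
    ultimately have "- \<alpha> * of_int n ^ 2 + \<beta> * of_int n \<le> b\<^sup>2 / (4 * \<alpha>) - x" by simp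
    then show ?thesis by (simp add: exp_add[symmetric] x_def)
  qed
  show ?thesis
    by (rule summable_on_comparison_test[OF summable_on_cmult_right[OF summable_on_exp_neg_abs_int]])
      (use le in auto)
qed

lemma summable_on_exp_quadratic:
  fixes a b c :: complex
  assumes "Re a < 0"
  shows "(\<lambda>n::int. exp (a * of_int n ^ 2 + b * of_int n + c)) summable_on UNIV"
proof -
  have n2: "complex_of_int n ^ 2 = of_int (n ^ 2)" for n by simp
  have eq: "norm (exp (a * of_int n ^ 2 + b * of_int n + c))
        = exp (Re c) * exp (- (- Re a) * of_int n ^ 2 + Re b * of_int n)" for n :: int
    by (simp add: norm_exp_eq_Re n2 exp_add[symmetric] del: of_int_power)
  have "(\<lambda>n. norm (exp (a * of_int n ^ 2 + b * of_int n + c))) summable_on UNIV"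
    unfolding eq using assms by (intro summable_on_cmult_right summable_on_exp_quadratic_real) simp
  then show ?thesis
    by (simp add: summable_on_iff_abs_summable_on_complex)
qed

text \<open>All four theta functions in one family: \<open>s\<close> is the base of the alternating
  sign, \<open>e\<close> = 1 the half-integer shift. Writing the frequency as
  \<open>2 * n - e\<close> keeps it an integer.\<close>

definition gtheta :: "complex \<Rightarrow> int \<Rightarrow> complex \<Rightarrow> complex \<Rightarrow> complex" where
  "gtheta s e v t = (\<Sum>\<^sub>\<infinity>n::int. s powi n * exp (pi * \<i> * t * (of_int n - of_int e / 2)^2 + pi * \<i> * of_int (2 * n - e) * v))"

lemma theta_eq_gtheta:
  "theta0 v t = gtheta (- 1) 0 v t"
  "theta1 v t = \<i> * gtheta (- 1) 1 v t"
  "theta2 v t = gtheta 1 1 v t"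
  "theta3 v t = gtheta 1 0 v t"
  unfolding theta0_def theta1_def theta2_def theta3_def gtheta_def
  by (simp_all add: exp_add mult_ac)

lemma gtheta_has_sum:
  assumes "Im t > 0" and "s = 1 \<or> s = - 1"
  shows "((\<lambda>n. s powi n * exp (pi * \<i> * t * (of_int n - of_int e / 2)^2 + pi * \<i> * of_int (2 * n - e) * v))
           has_sum gtheta s e v t) UNIV"
proof -
  define a b c where "a = pi * \<i> * t" and "b = - (pi * \<i> * t * of_int e) + 2 * pi * \<i> * v"
    and "c = pi * \<i> * t * (of_int e)\<^sup>2 / 4 - pi * \<i> * of_int e * v"
  have e: "pi * \<i> * t * (of_int n - of_int e / 2)^2 + pi * \<i> * of_int (2 * n - e) * v
        = a * of_int n ^ 2 + b * of_int n + c" for n :: int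
    by (simp add: a_def b_def c_def power2_eq_square field_simps)
  have "(\<lambda>n::int. norm (exp (a * of_int n ^ 2 + b * of_int n + c))) summable_on UNIV"
    using summable_on_exp_quadratic[of a b c] assms(1)
    by (simp add: summable_on_iff_abs_summable_on_complex a_def)
  moreover have "norm (s powi n * exp (a * of_int n ^ 2 + b * of_int n + c)) = norm (exp (a * of_int n ^ 2 + b * of_int n + c))" for n :: int
    using assms(2) by (auto simp: norm_mult norm_power_int)
  ultimately have "(\<lambda>n::int. s powi n * exp (a * of_int n ^ 2 + b * of_int n + c)) summable_on UNIV"
    by (simp add: summable_on_iff_abs_summable_on_complex)
  then show ?thesis
    unfolding gtheta_def e by (rule has_sum_infsum)
qed

lemma exp_pi_i_int: "exp (pi * \<i> * of_int m) = (if even m then 1 else - 1)"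
proof (cases "even m")
  case True
  then obtain k where "m = 2 * k" by (elim evenE)
  then show ?thesis by (auto simp: exp_eq_1 intro: exI[of _ k])
next
  case False
  then obtain k where "m = 2 * k + 1" by (elim oddE)
  then have "exp (pi * \<i> * of_int m) = exp (pi * \<i> * of_int (2 * k)) * exp (pi * \<i>)"
    by (simp add: exp_add distrib_left)
  also have "exp (pi * \<i> * of_int (2 * k)) = 1"
    by (auto simp: exp_eq_1 intro: exI[of _ k])
  finally show ?thesis using False by simp
qed

lemma gtheta_add_1: "gtheta s e (v + 1) t = (if even e then 1 else - 1) * gtheta s e v t"
proof -
  have "exp (pi * \<i> * of_int (2 * n - e)) = (if even e then 1 else - 1)" for n
    by (subst exp_pi_i_int) auto
  then have "s powi n * exp (pi * \<i> * t * (of_int n - of_int e / 2)^2 + pi * \<i> * of_int (2 * n - e) * (v + 1))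
      = (if even e then 1 else - 1) * (s powi n * exp (pi * \<i> * t * (of_int n - of_int e / 2)^2 + pi * \<i> * of_int (2 * n - e) * v))" for n
    by (simp only: distrib_left exp_add mult_1_right) (simp add: mult_ac)
  then show ?thesis
    unfolding gtheta_def by (simp only: infsum_cmult_right')
qed

text \<open>Translating \<open>v\<close> by \<open>t\<close> amounts to the index shift n -> n + 1
  in the Gaussian exponent. The sign comes out as \<open>s\<close> because s^2 = 1.\<close>

lemma gtheta_add_period:
  assumes "s = 1 \<or> s = - 1"
  shows "gtheta s e (v + t) t = s * exp (- (pi * \<i> * (t + 2 * v))) * gtheta s e v t"
proof -
  let ?f = "\<lambda>n::int. s powi n * exp (pi * \<i> * t * (of_int n - of_int e / 2)^2 + pi * \<i> * of_int (2 * n - e) * v)"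
  have ss: "s * s = 1" and s0: "s \<noteq> 0" using assms by auto
  have "s powi n * exp (pi * \<i> * t * (of_int n - of_int e / 2)^2 + pi * \<i> * of_int (2 * n - e) * (v + t))
      = s * exp (- (pi * \<i> * (t + 2 * v))) * ?f (n + 1)" for n
  proof -
    have "pi * \<i> * t * (of_int n - of_int e / 2)^2 + pi * \<i> * of_int (2 * n - e) * (v + t)
        = - (pi * \<i> * (t + 2 * v)) + (pi * \<i> * t * (of_int (n + 1) - of_int e / 2)^2 + pi * \<i> * of_int (2 * (n + 1) - e) * v)"
      by (simp add: power2_eq_square algebra_simps)
    moreover have "s powi n = s * s powi (n + 1)"
      using s0 ss by (simp add: power_int_add mult.assoc)
    ultimately show ?thesis by (simp only: exp_add mult_ac)
  qed
  then have "gtheta s e (v + t) t = s * exp (- (pi * \<i> * (t + 2 * v))) * (\<Sum>\<^sub>\<infinity>n. ?f (n + 1))"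
    unfolding gtheta_def by (simp only: infsum_cmult_right')
  also have "(\<Sum>\<^sub>\<infinity>n. ?f (n + 1)) = infsum ?f UNIV"
    by (rule infsum_reindex_bij_witness[of _ "\<lambda>n. n - 1" "\<lambda>n. n + 1"]) auto
  finally show ?thesis by (simp only: gtheta_def)
qed

text \<open>Reflection n -> e - n of the summation index.\<close>

lemma gtheta_minus:
  assumes "s = 1 \<or> s = - 1"
  shows "gtheta s e (- v) t = s powi e * gtheta s e v t"
proof -
  let ?f = "\<lambda>n::int. s powi n * exp (pi * \<i> * t * (of_int n - of_int e / 2)^2 + pi * \<i> * of_int (2 * n - e) * v)"
  have "s powi n * exp (pi * \<i> * t * (of_int n - of_int e / 2)^2 + pi * \<i> * of_int (2 * n - e) * (- v))
      = s powi e * ?f (e - n)" for n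
  proof -
    have "pi * \<i> * t * (of_int n - of_int e / 2)^2 + pi * \<i> * of_int (2 * n - e) * (- v)
        = pi * \<i> * t * (of_int (e - n) - of_int e / 2)^2 + pi * \<i> * of_int (2 * (e - n) - e) * v"
      by (simp add: power2_eq_square algebra_simps)
    moreover have "s powi n = s powi e * s powi (e - n)"
    proof -
      have "s powi e * s powi (e - n) = s powi (2 * (e - n) + n)"
        using assms by (subst power_int_add[symmetric]) (auto simp: algebra_simps)
      also have "\<dots> = s powi n"
        using assms by (subst power_int_add) (auto simp: power_int_mult)
      finally show ?thesis by simp
    qed
    ultimately show ?thesis by (simp only: mult_ac)
  qed
  then have "gtheta s e (- v) t = s powi e * (\<Sum>\<^sub>\<infinity>n. ?f (e - n))"
    unfolding gtheta_def by (simp only: infsum_cmult_right')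
  also have "(\<Sum>\<^sub>\<infinity>n. ?f (e - n)) = infsum ?f UNIV"
    by (rule infsum_reindex_bij_witness[of _ "\<lambda>n. e - n" "\<lambda>n. e - n"]) auto
  finally show ?thesis by (simp only: gtheta_def)
qed

text \<open>The coefficient singled out at \<open>- e\<close> is that of the term n = 0; its being
  nonzero feeds the count of zeros.\<close>

lemma has_fourier_gtheta:
  assumes "Im t > 0" and "s = 1 \<or> s = - 1"
  obtains a where "has_fourier a (\<lambda>v. gtheta s e v t)" and "a (- e) \<noteq> 0"
proof -
  let ?b = "\<lambda>n::int. s powi n * exp (pi * \<i> * t * (of_int n - of_int e / 2)^2)"
  let ?a = "\<lambda>m. if 2 dvd m - - e then ?b ((m - - e) div 2) else 0"
  have "has_fourier ?a (\<lambda>v. gtheta s e v t)"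
  proof (rule has_fourier_lacunary)
    show "((\<lambda>n. ?b n * exp (pi * \<i> * of_int (2 * n + - e) * v)) has_sum gtheta s e v t) UNIV" for v
      using gtheta_has_sum[OF assms, of e v] by (simp add: exp_add mult.assoc)
  qed simp
  moreover have "?a (- e) \<noteq> 0" by simp
  ultimately show ?thesis by (rule that)
qed

lemma gtheta_countable_zeros:
  assumes "Im t > 0" and "s = 1 \<or> s = - 1"
  shows "countable {v. gtheta s e v t = 0}"
proof -
  obtain a where "has_fourier a (\<lambda>v. gtheta s e v t)" "a (- e) \<noteq> 0"
    by (rule has_fourier_gtheta[OF assms])
  then show ?thesis by (rule has_fourier_countable_zeros)
qed

section \<open>Quasi-periodic functions and the recursion for their coefficients\<close>

text \<open>\<open>\<iota>\<close> and \<open>\<eta>\<close> are the multipliers for the periods 1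
  and \<open>t\<close>, \<open>p\<close> is the degree, and \<open>\<beta>\<close> records
  translations of the argument. The exponent is normalised so that a product of functions multiplies
  the multipliers and adds \<open>p\<close> and \<open>\<beta>\<close>.\<close>

definition quasi :: "complex \<Rightarrow> complex \<Rightarrow> complex \<Rightarrow> int \<Rightarrow> complex \<Rightarrow> (complex \<Rightarrow> complex) \<Rightarrow> bool" where
  "quasi t \<iota> \<eta> p \<beta> g \<longleftrightarrow> (\<exists>a. has_fourier a g) \<and> (\<forall>v. g (v + 1) = \<iota> * g v) \<and>
     (\<forall>v. g (v + t) = \<eta> * exp (- (pi * \<i> * (of_int p * t + 2 * of_int p * v + 2 * \<beta>))) * g v)"

lemma quasiD1: "quasi t \<iota> \<eta> p \<beta> g \<Longrightarrow> g (v + 1) = \<iota> * g v"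
  and quasiD2: "quasi t \<iota> \<eta> p \<beta> g \<Longrightarrow>
    g (v + t) = \<eta> * exp (- (pi * \<i> * (of_int p * t + 2 * of_int p * v + 2 * \<beta>))) * g v"
  by (simp_all add: quasi_def)

lemma quasi_const: "quasi t 1 1 0 0 (\<lambda>_. c)"
  using has_fourier_const[of c] by (auto simp: quasi_def)

lemma quasi_mult:
  assumes "quasi t \<iota> \<eta> p \<beta> f" and "quasi t \<iota>' \<eta>' p' \<beta>' g"
  shows "quasi t (\<iota> * \<iota>') (\<eta> * \<eta>') (p + p') (\<beta> + \<beta>') (\<lambda>v. f v * g v)"
proof -
  have e: "exp (- (pi * \<i> * (of_int (p + p') * t + 2 * of_int (p + p') * v + 2 * (\<beta> + \<beta>'))))
     = exp (- (pi * \<i> * (of_int p * t + 2 * of_int p * v + 2 * \<beta>))) * exp (- (pi * \<i> * (of_int p' * t + 2 * of_int p' * v + 2 * \<beta>')))" for v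
    by (simp add: exp_add[symmetric] algebra_simps)
  show ?thesis
    using assms unfolding quasi_def e by (auto intro: has_fourier_mult)
qed

lemma quasi_cmult:
  assumes "quasi t \<iota> \<eta> p \<beta> f"
  shows "quasi t \<iota> \<eta> p \<beta> (\<lambda>v. c * f v)"
  using quasi_mult[OF quasi_const[of t c] assms] by simp

lemma quasi_add:
  assumes "quasi t \<iota> \<eta> p \<beta> f" and "quasi t \<iota> \<eta> p \<beta> g"
  shows "quasi t \<iota> \<eta> p \<beta> (\<lambda>v. f v + g v)"
  using assms unfolding quasi_def by (auto intro: has_fourier_add simp: distrib_left)

lemma quasi_prod:
  assumes "\<And>i. i \<in> I \<Longrightarrow> quasi t (\<iota> i) (\<eta> i) (p i) (\<beta> i) (f i)"
  shows "quasi t (\<Prod>i\<in>I. \<iota> i) (\<Prod>i\<in>I. \<eta> i) (\<Sum>i\<in>I. p i) (\<Sum>i\<in>I. \<beta> i) (\<lambda>v. \<Prod>i\<in>I. f i v)"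
  using assms
  by (induction I rule: infinite_finite_induct) (auto intro: quasi_const quasi_mult)

lemma quasi_shift:
  assumes "quasi t \<iota> \<eta> p \<beta> g"
  shows "quasi t \<iota> \<eta> p (\<beta> + of_int p * a) (\<lambda>v. g (v + a))"
proof -
  have "g (v + 1 + a) = \<iota> * g (v + a)" for v
    using quasiD1[OF assms, of "v + a"] by (simp only: add.assoc add.commute[of 1 a])
  moreover have "g (v + t + a) = \<eta> * exp (- (pi * \<i> * (of_int p * t + 2 * of_int p * v + 2 * (\<beta> + of_int p * a)))) * g (v + a)" for v
  proof -
    have "g (v + t + a) = g ((v + a) + t)" by (simp add: add_ac)
    also have "\<dots> = \<eta> * exp (- (pi * \<i> * (of_int p * t + 2 * of_int p * (v + a) + 2 * \<beta>))) * g (v + a)"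
      by (rule quasiD2[OF assms])
    finally show ?thesis by (simp add: algebra_simps)
  qed
  moreover have "\<exists>b. has_fourier b (\<lambda>v. g (v + a))"
  proof -
    obtain b where "has_fourier b g" using assms by (auto simp: quasi_def)
    from has_fourier_shift[OF this, of a] show ?thesis by (intro exI)
  qed
  ultimately show ?thesis unfolding quasi_def by simp
qed

lemma quasi_gtheta:
  assumes "Im t > 0" and "s = 1 \<or> s = - 1"
  shows "quasi t (if even e then 1 else - 1) s 1 0 (\<lambda>v. gtheta s e v t)"
proof -
  obtain a where "has_fourier a (\<lambda>v. gtheta s e v t)"
    by (rule has_fourier_gtheta[OF assms])
  then show ?thesis
    unfolding quasi_def using gtheta_add_1 gtheta_add_period[OF assms(2)] by auto
qed

text \<open>Under v -> 2 v a step by 1 becomes two steps, while a step by \<open>t\<close> becomes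
  the single period 2 t: so \<open>\<iota>\<close> is squared, \<open>\<eta>\<close> is kept and the
  degree doubles.\<close>

lemma quasi_dilate_both:
  assumes "quasi (2 * t) \<iota> \<eta> p 0 g"
  shows "quasi t (\<iota>\<^sup>2) \<eta> (2 * p) 0 (\<lambda>v. g (2 * v))"
proof -
  have "g (2 * (v + 1)) = \<iota>\<^sup>2 * g (2 * v)" for v
  proof -
    have "g (2 * (v + 1)) = g ((2 * v + 1) + 1)" by (simp add: algebra_simps)
    also have "\<dots> = \<iota> * (\<iota> * g (2 * v))"
      by (simp only: quasiD1[OF assms])
    finally show ?thesis by (simp add: power2_eq_square)
  qed
  moreover have "g (2 * (v + t)) = \<eta> * exp (- (pi * \<i> * (of_int (2 * p) * t + 2 * of_int (2 * p) * v + 2 * 0))) * g (2 * v)" for v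
  proof -
    have "g (2 * (v + t)) = \<eta> * exp (- (pi * \<i> * (of_int p * (2 * t) + 2 * of_int p * (2 * v) + 2 * 0))) * g (2 * v)"
      unfolding distrib_left[of 2 v t] by (rule quasiD2[OF assms])
    then show ?thesis by (simp add: mult_ac)
  qed
  moreover have "\<exists>b. has_fourier b (\<lambda>v. g (2 * v))"
  proof -
    obtain b where "has_fourier b g" using assms by (auto simp: quasi_def)
    from has_fourier_dilate2[OF this] show ?thesis by (intro exI)
  qed
  ultimately show ?thesis unfolding quasi_def by simp
qed

text \<open>A step by \<open>t\<close> is two steps by t / 2, whose factors multiply.\<close>

lemma quasi_half_period:
  assumes "quasi (t / 2) \<iota> \<eta> p 0 g"
  shows "quasi t \<iota> (\<eta>\<^sup>2) (2 * p) 0 g"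
proof -
  have "g (v + t) = \<eta>\<^sup>2 * exp (- (pi * \<i> * (of_int (2 * p) * t + 2 * of_int (2 * p) * v + 2 * 0))) * g v" for v
  proof -
    let ?e = "\<lambda>v. exp (- (pi * \<i> * (of_int p * (t / 2) + 2 * of_int p * v + 2 * 0)))"
    have "g (v + t) = g ((v + t / 2) + t / 2)" by (simp add: add.assoc)
    also have "\<dots> = \<eta> * ?e (v + t / 2) * (\<eta> * ?e v * g v)" by (simp only: quasiD2[OF assms])
    also have "\<dots> = \<eta>\<^sup>2 * (?e (v + t / 2) * ?e v) * g v" by (simp add: power2_eq_square)
    also have "?e (v + t / 2) * ?e v = exp (- (pi * \<i> * (of_int (2 * p) * t + 2 * of_int (2 * p) * v + 2 * 0)))"
      unfolding exp_add[symmetric] by (rule arg_cong[of _ _ exp]) (simp add: field_simps)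
    finally show ?thesis .
  qed
  moreover have "\<exists>a. has_fourier a g" and "\<forall>v. g (v + 1) = \<iota> * g v"
    using assms by (simp_all add: quasi_def)
  ultimately show ?thesis unfolding quasi_def by simp
qed

text \<open>The modulus stays \<open>t\<close> here, so both doublings of the degree occur:
  \<open>g\<close> is first read with period 2 t, then dilated. This serves theta1(2 v; t) in type
  C.\<close>

lemma quasi_dilate:
  assumes "quasi t \<iota> \<eta> p 0 g"
  shows "quasi t (\<iota>\<^sup>2) (\<eta>\<^sup>2) (4 * p) 0 (\<lambda>v. g (2 * v))"
proof -
  have "quasi (2 * t / 2) \<iota> \<eta> p 0 g" using assms by simp
  from quasi_dilate_both[OF quasi_half_period[OF this]] show ?thesis by simp
qed

text \<open>Uniqueness of coefficients turns the two periods into conditions on \<open>a\<close>: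
  period 1 fixes the parity of the frequencies, period \<open>t\<close> couples m with m + 2
  p.\<close>

lemma quasi_coeff:
  assumes "quasi t \<iota> \<eta> p 0 g" and a: "has_fourier a g"
  shows "a m * (if even m then 1 else - 1) = \<iota> * a m"
    and "a m * exp (pi * \<i> * of_int m * t) = \<eta> * exp (- (pi * \<i> * of_int p * t)) * a (m + 2 * p)"
proof -
  have "has_fourier (\<lambda>m. \<iota> * a m) (\<lambda>v. g (v + 1))"
    by (rule has_fourier_cong[OF has_fourier_cmult[OF a, of \<iota>]]) (use assms(1) in \<open>auto simp: quasi_def\<close>)
  from has_fourier_unique[OF this has_fourier_shift[OF a]]
  have "\<iota> * a m = a m * exp (pi * \<i> * of_int m * 1)" by (rule fun_cong)
  then show "a m * (if even m then 1 else - 1) = \<iota> * a m"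
    by (simp only: mult_1_right exp_pi_i_int)
  let ?c = "\<eta> * exp (- (pi * \<i> * of_int p * t))"
  have "?c * (exp (pi * \<i> * of_int (- 2 * p) * v) * g v) = g (v + t)" for v
  proof -
    have "exp (- (pi * \<i> * (of_int p * t + 2 * of_int p * v + 2 * 0))) = exp (- (pi * \<i> * of_int p * t)) * exp (pi * \<i> * of_int (- 2 * p) * v)"
      unfolding exp_add[symmetric] by (rule arg_cong[of _ _ exp]) (simp add: algebra_simps)
    then show ?thesis using assms(1) by (simp add: quasi_def)
  qed
  then have "has_fourier (\<lambda>m. ?c * a (m + 2 * p)) (\<lambda>v. g (v + t))"
    by (intro has_fourier_cong[OF has_fourier_cmult[OF has_fourier_exp_mult[OF a, of "- 2 * p"], of ?c]]) auto
  from has_fourier_unique[OF has_fourier_shift[OF a] this]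
  show "a m * exp (pi * \<i> * of_int m * t) = ?c * a (m + 2 * p)" by (rule fun_cong)
qed

text \<open>The recursion factors are nonzero, so vanishing spreads in both directions through a
  residue class modulo 2 p.\<close>

lemma quasi_coeff_zero:
  assumes g: "quasi t \<iota> \<eta> p 0 g" "has_fourier a g" and "\<eta> \<noteq> 0" and dvd: "2 * p dvd m - n"
  shows "a m = 0 \<longleftrightarrow> a n = 0"
proof -
  have step: "a m = 0 \<longleftrightarrow> a (m + 2 * p) = 0" for m
  proof -
    have "a m * exp (pi * \<i> * of_int m * t) = 0 \<longleftrightarrow> \<eta> * exp (- (pi * \<i> * of_int p * t)) * a (m + 2 * p) = 0"
      using quasi_coeff(2)[OF g, of m] by simp
    then show ?thesis using \<open>\<eta> \<noteq> 0\<close> by simp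
  qed
  have nat: "a m = 0 \<longleftrightarrow> a (m + 2 * p * int k) = 0" for m k
  proof (induction k)
    case (Suc k)
    have "m + 2 * p * int (Suc k) = m + 2 * p * int k + 2 * p" by (simp add: algebra_simps)
    then show ?case using Suc step[of "m + 2 * p * int k"] by (simp only:)
  qed simp
  obtain c where c: "m - n = 2 * p * c" using dvd by (elim dvdE)
  show ?thesis
  proof (cases "c \<ge> 0")
    case True
    then show ?thesis using nat[of n "nat c"] c by (simp add: algebra_simps)
  next
    case False
    then have "m + 2 * p * int (nat (- c)) = n" using c by simp
    then show ?thesis using nat[of m "nat (- c)"] by simp
  qed
qed

section \<open>The functions M_j span a space of quasi-periodic functions\<close>

lemma quasi_zero: "quasi t \<iota> \<eta> p \<beta> (\<lambda>_. 0)"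
  using has_fourier_0 by (auto simp: quasi_def)

lemma quasi_sum:
  assumes "\<And>i. i \<in> I \<Longrightarrow> quasi t \<iota> \<eta> p \<beta> (f i)"
  shows "quasi t \<iota> \<eta> p \<beta> (\<lambda>v. \<Sum>i\<in>I. f i v)"
  using assms
  by (induction I rule: infinite_finite_induct) (auto intro: quasi_zero quasi_add)

lemma gtheta_add_of_nat:
  "gtheta s e (v + of_nat n) t = (if even e then 1 else (- 1) ^ n) * gtheta s e v t"
proof (induction n)
  case (Suc n)
  have "gtheta s e (v + of_nat (Suc n)) t = gtheta s e ((v + of_nat n) + 1) t"
    by (simp add: add_ac)
  then show ?case using Suc by (simp only: gtheta_add_1) auto
qed simp

text \<open>One of the two summands of M_j, in the variable v = z / L, with k = 2 J(j) and p = calN.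
  Doubling J makes every index an integer.\<close>

definition tbasis :: "complex \<Rightarrow> int \<Rightarrow> complex \<Rightarrow> int \<Rightarrow> complex \<Rightarrow> complex" where
  "tbasis s p t k v = exp (pi * \<i> * of_int k * v) *
     (if s = 1 then theta2 else theta1) (of_int k / 2 * t + of_int p * v) (of_int p * t)"

text \<open>Its Fourier coefficients: a Gaussian in m on the class of k - p modulo 2 p. The factor
  with \<open>k\<close> squared, constant in m, is the origin of the exponential e_j in h_j.\<close>

definition tcoeff :: "complex \<Rightarrow> int \<Rightarrow> complex \<Rightarrow> int \<Rightarrow> int \<Rightarrow> complex" where
  "tcoeff s p t k m = (if 2 * p dvd m - (k - p) then
     (if s = 1 then 1 else \<i>) * s powi ((m - (k - p)) div (2 * p)) *
       exp (pi * \<i> * t * (of_int m ^ 2 - of_int k ^ 2) / (4 * of_int p)) else 0)"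

lemma tbasis_eq_gtheta:
  assumes "s = 1 \<or> s = - 1"
  shows "tbasis s p t k v = (if s = 1 then 1 else \<i>) *
    (exp (pi * \<i> * of_int k * v) * gtheta s 1 (of_int k / 2 * t + of_int p * v) (of_int p * t))"
  using assms by (auto simp: tbasis_def theta_eq_gtheta)

lemma has_fourier_tbasis:
  assumes t: "Im t > 0" and p: "p > 0" and s: "s = 1 \<or> s = - 1"
  shows "has_fourier (tcoeff s p t k) (tbasis s p t k)"
proof -
  let ?u = "if s = 1 then 1 else \<i>"
  define b where "b n = ?u * s powi n * exp (pi * \<i> * t * (of_int (2 * p * n + (k - p)) ^ 2 - of_int k ^ 2) / (4 * of_int p))" for n
  have "((\<lambda>n. b n * exp (pi * \<i> * of_int (2 * p * n + (k - p)) * v)) has_sum tbasis s p t k v) UNIV" for v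
  proof -
    let ?x = "of_int k / 2 * t + of_int p * v" and ?T = "of_int p * t"
    let ?e = "\<lambda>n. pi * \<i> * ?T * (of_int n - of_int 1 / 2)^2 + pi * \<i> * of_int (2 * n - 1) * ?x"
    have "Im ?T > 0" using t p by simp
    from has_sum_cmult_right[OF has_sum_cmult_right[OF gtheta_has_sum[OF this s, of 1 ?x], of "exp (pi * \<i> * of_int k * v)"], of ?u]
    have "((\<lambda>n. ?u * (exp (pi * \<i> * of_int k * v) * (s powi n * exp (?e n)))) has_sum tbasis s p t k v) UNIV"
      by (simp only: tbasis_eq_gtheta[OF s])
    moreover have "?u * (exp (pi * \<i> * of_int k * v) * (s powi n * exp (?e n))) = b n * exp (pi * \<i> * of_int (2 * p * n + (k - p)) * v)" for n
    proof -
      \<comment> \<open>With m = 2 p n + (k - p), completing the square gives p (n - 1/2)^2 + (2 n -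
        1) k / 2 = (m^2 - k^2) / (4 p), the coefficient of pi i t.\<close>
      have "pi * \<i> * of_int k * v + ?e n = pi * \<i> * t * (of_int (2 * p * n + (k - p)) ^ 2 - of_int k ^ 2) / (4 * of_int p)
             + pi * \<i> * of_int (2 * p * n + (k - p)) * v"
        using p by (simp add: field_simps power2_eq_square)
      then have "exp (pi * \<i> * of_int k * v) * exp (?e n) = exp (pi * \<i> * t * (of_int (2 * p * n + (k - p)) ^ 2 - of_int k ^ 2) / (4 * of_int p))
             * exp (pi * \<i> * of_int (2 * p * n + (k - p)) * v)"
        by (simp only: exp_add[symmetric])
      then show ?thesis unfolding b_def by (simp only: mult_ac)
    qed
    ultimately show ?thesis by (simp only:)
  qed
  then have "has_fourier (\<lambda>m. if 2 * p dvd m - (k - p) then b ((m - (k - p)) div (2 * p)) else 0) (tbasis s p t k)"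
    using p by (intro has_fourier_lacunary) auto
  moreover have "(if 2 * p dvd m - (k - p) then b ((m - (k - p)) div (2 * p)) else 0) = tcoeff s p t k m" for m
  proof (cases "2 * p dvd m - (k - p)")
    case True
    then have "2 * p * ((m - (k - p)) div (2 * p)) + (k - p) = m" by simp
    then show ?thesis using True unfolding b_def tcoeff_def by (simp only: if_True)
  qed (simp add: tcoeff_def)
  ultimately show ?thesis by (simp only:) 
qed

text \<open>A step by 1 in \<open>v\<close> moves the theta argument by p unit periods, a step by
  \<open>t\<close> by exactly one period p t. In the second case the exponentials involving
  \<open>k\<close> cancel, so only the parity of \<open>k\<close> enters the multipliers.\<close>

lemma quasi_tbasis:
  assumes t: "Im t > 0" and p: "p > 0" and s: "s = 1 \<or> s = - 1"
  shows "quasi t (if even (p + k) then 1 else - 1) s p 0 (tbasis s p t k)"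
proof -
  have 1: "tbasis s p t k (v + 1) = (if even (p + k) then 1 else - 1) * tbasis s p t k v" for v
  proof -
    obtain n where n: "p = int n" using p zero_le_imp_eq_int[of p] by auto
    have "of_int k / 2 * t + of_int p * (v + 1) = (of_int k / 2 * t + of_int p * v) + of_nat n"
      by (simp add: n distrib_left add.assoc)
    then have "gtheta s 1 (of_int k / 2 * t + of_int p * (v + 1)) (of_int p * t)
        = (if even p then 1 else - 1) * gtheta s 1 (of_int k / 2 * t + of_int p * v) (of_int p * t)"
      by (simp only: gtheta_add_of_nat) (simp add: n)
    moreover have "exp (pi * \<i> * of_int k * (v + 1)) = (if even k then 1 else - 1) * exp (pi * \<i> * of_int k * v)"
      by (simp only: distrib_left exp_add mult_1_right exp_pi_i_int) simp
    ultimately show ?thesis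
      by (simp add: tbasis_eq_gtheta[OF s])
  qed
  have 2: "tbasis s p t k (v + t) = s * exp (- (pi * \<i> * (of_int p * t + 2 * of_int p * v + 2 * 0))) * tbasis s p t k v" for v
  proof -
    let ?x = "of_int k / 2 * t + of_int p * v" and ?T = "of_int p * t"
    have "of_int k / 2 * t + of_int p * (v + t) = ?x + ?T"
      by (simp add: distrib_left)
    then have "gtheta s 1 (of_int k / 2 * t + of_int p * (v + t)) ?T = s * exp (- (pi * \<i> * (?T + 2 * ?x))) * gtheta s 1 ?x ?T"
      using gtheta_add_period[OF s] by (simp only:)
    moreover have "exp (pi * \<i> * of_int k * (v + t)) * exp (- (pi * \<i> * (?T + 2 * ?x)))
       = exp (- (pi * \<i> * (of_int p * t + 2 * of_int p * v + 2 * 0))) * exp (pi * \<i> * of_int k * v)"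
      unfolding exp_add[symmetric] by (rule arg_cong[of _ _ exp]) (simp add: field_simps)
    ultimately show ?thesis
      unfolding tbasis_eq_gtheta[OF s] by (simp only: mult_ac) (simp add: mult.assoc[symmetric])
  qed
  show ?thesis
    unfolding quasi_def using 1 2 by (intro conjI allI exI) (rule has_fourier_tbasis[OF assms])
qed

lemma tbasis_minus:
  assumes "s = 1 \<or> s = - 1"
  shows "tbasis s p t k (- v) = s * tbasis s p t (- k) v"
proof -
  have "of_int k / 2 * t + of_int p * (- v) = - (of_int (- k) / 2 * t + of_int p * v)"
    by simp
  then have "gtheta s 1 (of_int k / 2 * t + of_int p * (- v)) (of_int p * t)
     = s * gtheta s 1 (of_int (- k) / 2 * t + of_int p * v) (of_int p * t)"
    by (simp only: gtheta_minus[OF assms]) simp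
  then show ?thesis
    unfolding tbasis_eq_gtheta[OF assms] by simp
qed

text \<open>The theta arguments for k = p and k = - p differ by one period \<open>p * t\<close>. At
  the boundary index k = p the two summands of a basis function are therefore proportional.\<close>

lemma tbasis_minus_p:
  assumes s: "s = 1 \<or> s = - 1"
  shows "tbasis s p t (- p) v = s * tbasis s p t p v"
proof -
  let ?x = "of_int (- p) / 2 * t + of_int p * v" and ?T = "of_int p * t"
  have "of_int p / 2 * t + of_int p * v = ?x + ?T" by (simp add: field_simps)
  then have "gtheta s 1 (of_int p / 2 * t + of_int p * v) ?T = s * exp (- (pi * \<i> * (?T + 2 * ?x))) * gtheta s 1 ?x ?T"
    by (simp only: gtheta_add_period[OF s])
  moreover have "exp (pi * \<i> * of_int p * v) * exp (- (pi * \<i> * (?T + 2 * ?x))) = exp (pi * \<i> * of_int (- p) * v)"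
    unfolding exp_add[symmetric] by (rule arg_cong[of _ _ exp]) (simp add: field_simps)
  ultimately have "exp (pi * \<i> * of_int p * v) * gtheta s 1 (of_int p / 2 * t + of_int p * v) ?T
      = s * (exp (pi * \<i> * of_int (- p) * v) * gtheta s 1 ?x ?T)"
    by (simp only: mult_ac) (simp add: mult.assoc[symmetric])
  then show ?thesis
    using s unfolding tbasis_eq_gtheta[OF s] by (auto simp: mult_ac)
qed

text \<open>
  In the application k i = 2 J(i), p = calN and M_i = basis i: the parameter s selects theta2 (s = 1) or theta1
  (s = - 1), and the reflected summand, weighted by \<zeta>, makes M_i odd or even (\<zeta> = 0 for A_{N-1}).
  Assumption complete says that every Fourier index of the right parity is tied by the recursion
  or the reflection to the index k i - p of some M_i, or carries a coefficient that vanishes by symmetry.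
\<close>

locale theta_frame =
  fixes t :: complex and p :: int and s \<zeta> :: complex and N :: nat and k :: "nat \<Rightarrow> int"
  assumes t: "Im t > 0" and p: "p > 0" and s: "s = 1 \<or> s = - 1"
    and \<zeta>: "\<zeta> = 0 \<or> \<zeta> = 1 \<or> \<zeta> = - 1" and N: "N \<ge> 1"
    and parity: "\<And>i j. i \<in> {1..N} \<Longrightarrow> j \<in> {1..N} \<Longrightarrow> even (k i - k j)"
    and distinct: "\<And>i j. i \<in> {1..N} \<Longrightarrow> j \<in> {1..N} \<Longrightarrow> 2 * p dvd k i - k j \<Longrightarrow> i = j"
    and reflected: "\<And>i j. \<zeta> \<noteq> 0 \<Longrightarrow> i \<in> {1..N} \<Longrightarrow> j \<in> {1..N} \<Longrightarrow> 2 * p dvd k i + k j \<Longrightarrow>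
       i = j \<and> (k i = 0 \<and> \<zeta> = 1 \<or> k i = p \<and> \<zeta> = s)"
    and complete: "\<And>m. even (m + p + k 1) \<Longrightarrow>
       (\<exists>i\<in>{1..N}. 2 * p dvd m - (k i - p)) \<or>
       \<zeta> \<noteq> 0 \<and> ((\<exists>i\<in>{1..N}. 2 * p dvd - m - (k i - p)) \<or>
                (\<zeta> * s = - 1 \<and> 2 * p dvd m) \<or> (\<zeta> = - 1 \<and> s = 1 \<and> 2 * p dvd m + p))"
begin

definition \<iota> :: complex where "\<iota> = (if even (p + k 1) then 1 else - 1)"

definition basis :: "nat \<Rightarrow> complex \<Rightarrow> complex" where
  "basis i v = tbasis s p t (k i) v + \<zeta> * tbasis s p t (- k i) v"

definition bcoeff :: "nat \<Rightarrow> int \<Rightarrow> complex" where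
  "bcoeff i m = tcoeff s p t (k i) m + \<zeta> * tcoeff s p t (- k i) m"

lemma has_fourier_basis: "has_fourier (bcoeff i) (basis i)"
  unfolding basis_def[abs_def] bcoeff_def[abs_def]
  by (intro has_fourier_add has_fourier_cmult has_fourier_tbasis t p s)

lemma quasi_basis:
  assumes "i \<in> {1..N}"
  shows "quasi t \<iota> s p 0 (basis i)"
proof -
  have "even (k i - k 1)" using parity[OF assms, of 1] N by simp
  then have "even (p + k i) \<longleftrightarrow> even (p + k 1)" "even (p + - k i) \<longleftrightarrow> even (p + k 1)" by auto
  then have "quasi t \<iota> s p 0 (tbasis s p t (k i))" "quasi t \<iota> s p 0 (tbasis s p t (- k i))"
    using quasi_tbasis[OF t p s, of "k i"] quasi_tbasis[OF t p s, of "- k i"] by (simp_all only: \<iota>_def)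
  then show ?thesis
    unfolding basis_def[abs_def] by (intro quasi_add quasi_cmult)
qed

lemma basis_minus:
  assumes "\<zeta> \<noteq> 0"
  shows "basis i (- v) = \<zeta> * s * basis i v"
proof -
  have "\<zeta> * \<zeta> = 1" using \<zeta> assms by auto
  then show ?thesis
    by (simp add: basis_def tbasis_minus[OF s] distrib_left mult.assoc[symmetric])
qed

text \<open>When k and - k agree modulo 2 p the two summands are proportional and might cancel; the
  signs required by \<open>reflected\<close> make them add up.\<close>

lemma basis_special:
  assumes "i \<in> {1..N}" "\<zeta> \<noteq> 0" "2 * p dvd k i + k i"
  shows "basis i v = 2 * tbasis s p t (k i) v"
proof -
  have "k i = 0 \<and> \<zeta> = 1 \<or> k i = p \<and> \<zeta> = s" using reflected[OF assms(2,1,1,3)] by simp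
  then show ?thesis
  proof
    assume *: "k i = p \<and> \<zeta> = s"
    have "s * (s * x) = x" for x using s by auto
    then show ?thesis unfolding basis_def by (simp add: * tbasis_minus_p[OF s, of p t v])
  next
    assume *: "k i = 0 \<and> \<zeta> = 1"
    show ?thesis unfolding basis_def by (simp add: *)
  qed
qed

text \<open>The frequencies k_i - p serve as probes: for distinct indices the supports lie in
  different classes modulo 2 p, so probe i sees only function i. If both summands meet the probe,
  \<open>basis_special\<close> excludes cancellation.\<close>

lemma bcoeff_at:
  assumes i: "i \<in> {1..N}" and j: "j \<in> {1..N}"
  shows "bcoeff j (k i - p) = 0 \<longleftrightarrow> i \<noteq> j"
proof (cases "i = j")
  case False
  then have "\<not> 2 * p dvd k i - k j" using distinct[OF i j] by blast
  moreover have "\<zeta> = 0 \<or> \<not> 2 * p dvd k i + k j" using reflected[OF _ i j] False by blast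
  ultimately show ?thesis using False by (auto simp: bcoeff_def tcoeff_def)
next
  case True
  have nz: "tcoeff s p t (k j) (k j - p) \<noteq> 0"
    using s by (auto simp: tcoeff_def)
  show ?thesis
  proof (cases "\<zeta> \<noteq> 0 \<and> 2 * p dvd k j + k j")
    case True
    then have "basis j = (\<lambda>v. 2 * tbasis s p t (k j) v)"
      by (intro ext basis_special j) simp_all
    then have "has_fourier (bcoeff j) (\<lambda>v. 2 * tbasis s p t (k j) v)"
      using has_fourier_basis[of j] by simp
    from has_fourier_unique[OF this has_fourier_cmult[OF has_fourier_tbasis[OF t p s]]]
    show ?thesis using nz \<open>i = j\<close> by simp
  next
    case False
    then have "\<zeta> = 0 \<or> tcoeff s p t (- k j) (k j - p) = 0"
      by (auto simp: tcoeff_def)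
    then show ?thesis using nz \<open>i = j\<close> by (auto simp: bcoeff_def)
  qed
qed

text \<open>The probe coefficients determine a function of the given type: period 1 excludes
  frequencies of the wrong parity, and for the others each alternative of \<open>complete\<close>
  forces the coefficient to vanish.\<close>

lemma quasi_zeroI:
  assumes g: "quasi t \<iota> s p 0 g" and a: "has_fourier a g"
    and sym: "\<And>v. \<zeta> \<noteq> 0 \<Longrightarrow> g (- v) = \<zeta> * s * g v"
    and zero: "\<And>i. i \<in> {1..N} \<Longrightarrow> a (k i - p) = 0"
  shows "a m = 0"
proof -
  have s0: "s \<noteq> 0" using s by auto
  note shift = quasi_coeff_zero[OF g a s0]
  have am: "a (- n) = \<zeta> * s * a n" if "\<zeta> \<noteq> 0" for n
  proof -
    have "has_fourier (\<lambda>m. \<zeta> * s * a m) (\<lambda>v. g (- v))"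
      by (rule has_fourier_cong[OF has_fourier_cmult[OF a, of "\<zeta> * s"]]) (use sym that in auto)
    from has_fourier_unique[OF has_fourier_minus[OF a] this] show ?thesis by (rule fun_cong)
  qed
  show ?thesis
  proof (cases "even (m + p + k 1)")
    case False
    then have "(if even m then 1 else - 1) = - \<iota>" by (auto simp: \<iota>_def)
    with quasi_coeff(1)[OF g a, of m] have "a m * - \<iota> = \<iota> * a m" by simp
    then show ?thesis by (auto simp: \<iota>_def split: if_splits)
  next
    case True
    consider (direct) i where "i \<in> {1..N}" "2 * p dvd m - (k i - p)"
      | (reflect) i where "\<zeta> \<noteq> 0" "i \<in> {1..N}" "2 * p dvd - m - (k i - p)"
      | (zero) "\<zeta> \<noteq> 0" "\<zeta> * s = - 1" "2 * p dvd m"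
      | (half) "\<zeta> = - 1" "s = 1" "2 * p dvd m + p"
      using complete[OF True] by blast
    then show ?thesis
    proof cases
      case direct
      then show ?thesis using shift[OF direct(2)] zero[OF direct(1)] by simp
    next
      case reflect
      then have "a (- m) = 0" using shift[OF reflect(3)] zero[OF reflect(2)] by simp
      then show ?thesis using am[OF reflect(1), of m] reflect(1) s0 by simp
    next
      case zero
      \<comment> \<open>Here \<open>g\<close> is odd, so its constant coefficient is 0.\<close>
      then have "a 0 = 0" using am[of 0] by simp
      moreover have "2 * p dvd m - 0" using zero by simp
      ultimately show ?thesis using shift[of m 0] by simp
    next
      case half
      \<comment> \<open>The recursion from - p to p has the same exponential on both sides and gives
        a(-p) = a(p), whereas oddness gives a(-p) = - a(p).\<close>
      have "a (- p) * exp (pi * \<i> * of_int (- p) * t) = exp (- (pi * \<i> * of_int p * t)) * a p"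
        using quasi_coeff(2)[OF g a, of "- p"] half by simp
      then have "a (- p) = a p" by simp
      moreover have "a (- p) = - a p" using am[of p] half by simp
      ultimately have "a (- p) = 0" by simp
      moreover have "2 * p dvd m - (- p)" using half by simp
      ultimately show ?thesis using shift[of m "- p"] by simp
    qed
  qed
qed

text \<open>The matrix of probe coefficients of the basis is diagonal and invertible, so the right
  coefficients are quotients; the difference has vanishing probe coefficients and is 0 by
  \<open>quasi_zeroI\<close>.\<close>

lemma quasi_span:
  assumes g: "quasi t \<iota> s p 0 g" and sym: "\<And>v. \<zeta> \<noteq> 0 \<Longrightarrow> g (- v) = \<zeta> * s * g v"
  obtains c where "\<And>v. g v = (\<Sum>i\<in>{1..N}. c i * basis i v)"
proof -
  obtain a where a: "has_fourier a g" using g by (auto simp: quasi_def)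
  define c where "c i = a (k i - p) / bcoeff i (k i - p)" for i
  define h where "h v = g v + (- 1) * (\<Sum>i\<in>{1..N}. c i * basis i v)" for v
  define b where "b m = a m + (- 1) * (\<Sum>i\<in>{1..N}. c i * bcoeff i m)" for m
  have b: "has_fourier b h"
    unfolding h_def[abs_def] b_def[abs_def]
    by (intro has_fourier_add has_fourier_cmult has_fourier_sum a has_fourier_basis)
  have h: "quasi t \<iota> s p 0 h"
    unfolding h_def[abs_def]
    by (intro quasi_add quasi_cmult quasi_sum g quasi_basis)
  have "b m = 0" for m
  proof (rule quasi_zeroI[OF h b])
    show "h (- v) = \<zeta> * s * h v" if "\<zeta> \<noteq> 0" for v
      using sym[OF that] by (simp add: h_def basis_minus[OF that] algebra_simps sum_distrib_left)
    show "b (k i - p) = 0" if i: "i \<in> {1..N}" for i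
    proof -
      have "(\<Sum>j\<in>{1..N}. c j * bcoeff j (k i - p)) = (\<Sum>j\<in>{1..N}. if j = i then a (k i - p) else 0)"
      proof (rule sum.cong)
        fix j assume j: "j \<in> {1..N}"
        show "c j * bcoeff j (k i - p) = (if j = i then a (k i - p) else 0)"
        proof (cases "j = i")
          case True
          then show ?thesis using bcoeff_at[OF i i] by (simp add: c_def)
        next
          case False
          then show ?thesis using bcoeff_at[OF i j] by simp
        qed
      qed simp
      also have "\<dots> = a (k i - p)" using i by (subst sum.delta) auto
      finally show ?thesis by (simp add: b_def)
    qed
  qed
  then have "h v = 0" for v
    using has_sum_unique[OF has_fourierD[OF b, of v], of 0] by simp
  then have "g v = (\<Sum>i\<in>{1..N}. c i * basis i v)" for v
    by (simp add: h_def)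
  then show ?thesis by (rule that)
qed

end

section \<open>Orthogonality on the fundamental domain\<close>

text \<open>The intervals tile the line, so countable additivity yields the total mass of a
  probability measure; \<open>int_decode\<close> enumerates the integers for this purpose.\<close>

lemma has_sum_normal_density_intervals:
  fixes W \<mu> \<sigma> :: real
  assumes "W > 0" and "\<sigma> > 0"
  shows "((\<lambda>n::int. LINT x:{of_int n * W..<(of_int n + 1) * W}|lborel. normal_density \<mu> \<sigma> x) has_sum 1) UNIV"
proof -
  let ?f = "normal_density \<mu> \<sigma>"
  let ?A = "\<lambda>n::int. {of_int n * W..<(of_int n + 1) * W}"
  let ?M = "density lborel ?f"
  interpret prob_space ?M by (rule prob_space_normal_density[OF assms(2)])
  have A: "x \<in> ?A n \<longleftrightarrow> \<lfloor>x / W\<rfloor> = n" for x n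
    using assms(1) by (auto simp: floor_eq_iff field_simps)
  have disj: "?A m \<inter> ?A n = {}" if "m \<noteq> n" for m n
  proof -
    have "\<not> (x \<in> ?A m \<and> x \<in> ?A n)" for x unfolding A using that by blast
    then show ?thesis by blast
  qed
  have un: "(\<Union>i. ?A (int_decode i)) = UNIV"
  proof -
    have "x \<in> ?A (int_decode (int_encode \<lfloor>x / W\<rfloor>))" for x unfolding A by simp
    then show ?thesis by blast
  qed
  have "(\<lambda>i. measure ?M (?A (int_decode i))) sums measure ?M (\<Union>i. ?A (int_decode i))"
  proof (rule finite_measure_UNION)
    show "disjoint_family (\<lambda>i. ?A (int_decode i))"
      unfolding disjoint_family_on_def by (intro ballI impI disj) (simp add: int_decode_eq)
  qed auto
  also have "measure ?M (\<Union>i. ?A (int_decode i)) = 1"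
    using prob_space by (simp add: un)
  finally have "((\<lambda>i. measure ?M (?A (int_decode i))) has_sum 1) UNIV"
    by (intro sums_nonneg_imp_has_sum) auto
  also have "?this \<longleftrightarrow> ((\<lambda>n. measure ?M (?A n)) has_sum 1) UNIV"
    by (rule has_sum_reindex_bij_betw) (rule bij_int_decode)
  also have "(\<lambda>n. measure ?M (?A n)) = (\<lambda>n. LINT x:?A n|lborel. ?f x)"
  proof
    fix n
    have "(LINT x:?A n|lborel. ?f x) = enn2real (\<integral>\<^sup>+x. ennreal (indicator (?A n) x *\<^sub>R ?f x) \<partial>lborel)"
      unfolding set_lebesgue_integral_def by (rule integral_eq_nn_integral) auto
    also have "(\<integral>\<^sup>+x. ennreal (indicator (?A n) x *\<^sub>R ?f x) \<partial>lborel) = (\<integral>\<^sup>+x. ennreal (?f x) * indicator (?A n) x \<partial>lborel)"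
      by (intro nn_integral_cong) (auto split: split_indicator)
    finally show "measure ?M (?A n) = (LINT x:?A n|lborel. ?f x)"
      by (simp add: measure_def emeasure_density)
  qed
  finally show ?thesis .
qed

text \<open>Translating the n-th integral by n W turns the integrals over [0, W) into integrals over
  a tiling of the line, with sum the full Gaussian integral. The deviation \<open>\<sigma>\<close>
  is fixed by 2 \<sigma>^2 = 1 / \<alpha>.\<close>

lemma has_sum_gaussian_periods:
  fixes \<alpha> W c :: real
  assumes \<alpha>: "\<alpha> > 0" and W: "W > 0"
  shows "((\<lambda>n::int. LINT y:{0..<W}|lborel. exp (- \<alpha> * (y + of_int n * W + c)\<^sup>2)) has_sum sqrt (pi / \<alpha>)) UNIV"
proof -
  define \<sigma> where "\<sigma> = 1 / sqrt (2 * \<alpha>)"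
  have \<sigma>: "\<sigma> > 0" "2 * \<sigma>\<^sup>2 = 1 / \<alpha>" using \<alpha> by (simp_all add: \<sigma>_def power_divide)
  have g: "exp (- \<alpha> * (x + c)\<^sup>2) = sqrt (pi / \<alpha>) * normal_density (- c) \<sigma> x" for x
  proof -
    have "2 * pi * \<sigma>\<^sup>2 = pi / \<alpha>" using \<sigma>(2) by (simp add: field_simps)
    moreover have "- (x - - c)\<^sup>2 / (2 * \<sigma>\<^sup>2) = - \<alpha> * (x + c)\<^sup>2"
      using \<alpha> unfolding \<sigma>(2) by simp
    ultimately show ?thesis using \<alpha> by (simp add: normal_density_def)
  qed
  have "(LINT y:{0..<W}|lborel. exp (- \<alpha> * (y + of_int n * W + c)\<^sup>2))
      = sqrt (pi / \<alpha>) * (LINT x:{of_int n * W..<(of_int n + 1) * W}|lborel. normal_density (- c) \<sigma> x)" for n :: int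
  proof -
    have "(LINT x:{of_int n * W..<(of_int n + 1) * W}|lborel. exp (- \<alpha> * (x + c)\<^sup>2))
        = (\<integral>y. indicator {of_int n * W..<(of_int n + 1) * W} (of_int n * W + 1 * y) *\<^sub>R exp (- \<alpha> * ((of_int n * W + 1 * y) + c)\<^sup>2) \<partial>lborel)"
      unfolding set_lebesgue_integral_def
      using lborel_integral_real_affine[of 1 "\<lambda>x. indicator {of_int n * W..<(of_int n + 1) * W} x *\<^sub>R exp (- \<alpha> * (x + c)\<^sup>2)" "of_int n * W"] by simp
    also have "\<dots> = (LINT y:{0..<W}|lborel. exp (- \<alpha> * (y + of_int n * W + c)\<^sup>2))"
      unfolding set_lebesgue_integral_def
      by (intro Bochner_Integration.integral_cong refl) (auto simp: indicator_def algebra_simps)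
    finally show ?thesis by (simp only: g set_integral_mult_right)
  qed
  then show ?thesis
    using has_sum_cmult_right[OF has_sum_normal_density_intervals[OF W \<sigma>(1), of "- c"], of "sqrt (pi / \<alpha>)"]
    by simp
qed

lemma sets_Lam [measurable]: "Lam L W \<in> sets borel"
  unfolding Lam_def by measurable

lemma emeasure_Lam: "emeasure lborel (Lam L W) < \<infinity>"
proof (rule emeasure_bounded_finite)
  have "norm w \<le> L + W" if "w \<in> Lam L W" for w
    using cmod_le[of w] that by (auto simp: Lam_def)
  then show "bounded (Lam L W)" by (rule boundedI)
qed

text \<open>Lebesgue measure on the plane is the image of the product measure over the real basis
  {1, \<i>}, where the integral of a product of one-variable functions factors.\<close>

lemma integral_Lam_product:
  fixes F G :: "real \<Rightarrow> complex"
  assumes F: "set_integrable lborel {0..<L} F" and G: "set_integrable lborel {0..<W} G"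
  shows "(LINT z:Lam L W|lborel. F (Re z) * G (Im z)) = (LINT x:{0..<L}|lborel. F x) * (LINT y:{0..<W}|lborel. G y)"
proof -
  interpret product_sigma_finite "\<lambda>_::complex. lborel :: real measure" ..
  define f where "f b x = (if b = (1::complex) then indicator {0..<L} x *\<^sub>R F x else indicator {0..<W} x *\<^sub>R G x)" for b x
  have f: "integrable lborel (f b)" for b
    using F G by (cases "b = 1") (simp_all add: f_def[abs_def] set_integrable_def)
  have ne: "\<i> \<noteq> 1" by (simp add: complex_eq_iff)
  let ?T = "\<lambda>x::complex \<Rightarrow> real. \<Sum>b\<in>Basis. x b *\<^sub>R b"
  let ?P = "PiM (Basis :: complex set) (\<lambda>_. lborel :: real measure)"
  have T: "?T x = Complex (x 1) (x \<i>)" for x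
    using ne by (simp add: Basis_complex_def complex_eq_iff)
  let ?h = "\<lambda>z. indicator (Lam L W) z *\<^sub>R (F (Re z) * G (Im z))"
  have h: "?h (?T x) = (\<Prod>b\<in>Basis. f b (x b))" for x
    using ne by (auto simp: T Basis_complex_def f_def Lam_def indicator_def)
  have "integrable ?P (\<lambda>x. \<Prod>b\<in>Basis. f b (x b))"
    by (rule product_integrable_prod) (simp_all add: f)
  have hm: "?h \<in> borel_measurable borel"
  proof -
    have "(\<lambda>z. f 1 (Re z) * f \<i> (Im z)) \<in> borel_measurable borel"
    proof (intro borel_measurable_times)
      have fm: "f b \<in> borel_measurable borel" for b
        using borel_measurable_integrable[OF f] by simp
      show "(\<lambda>z. f 1 (Re z)) \<in> borel_measurable borel"
        by (rule measurable_compose[OF _ fm]) (intro borel_measurable_continuous_onI continuous_intros)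
      show "(\<lambda>z. f \<i> (Im z)) \<in> borel_measurable borel"
        by (rule measurable_compose[OF _ fm]) (intro borel_measurable_continuous_onI continuous_intros)
    qed
    moreover have "f 1 (Re z) * f \<i> (Im z) = ?h z" for z
      using ne by (auto simp: f_def Lam_def indicator_def)
    ultimately show ?thesis by simp
  qed
  have "(LINT z:Lam L W|lborel. F (Re z) * G (Im z)) = integral\<^sup>L (distr ?P borel ?T) ?h"
    unfolding set_lebesgue_integral_def by (subst lborel_eq) simp
  also have "\<dots> = (\<integral>x. ?h (?T x) \<partial>?P)"
    by (rule integral_distr[OF _ hm]) measurable
  also have "\<dots> = (\<Prod>b\<in>Basis. integral\<^sup>L lborel (f b))"
    unfolding h by (rule product_integral_prod) (simp_all add: f)
  also have "\<dots> = (LINT x:{0..<L}|lborel. F x) * (LINT y:{0..<W}|lborel. G y)"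
    using ne by (simp add: Basis_complex_def f_def[abs_def] set_lebesgue_integral_def)
  finally show ?thesis .
qed

text \<open>Expanding both functions gives a double series. Integration over Re z leaves only m = n
  because m - n is even: exp(pi i (m - n) x / L) has period L in x only then. What remains of each
  diagonal term is an integral over Im z.\<close>

lemma has_sum_theta_inner:
  fixes L W p :: real
  assumes L: "L > 0" and W: "W > 0" and p: "p > 0"
    and f: "has_fourier a f" and g: "has_fourier b g"
    and par: "\<And>m n. a m \<noteq> 0 \<Longrightarrow> b n \<noteq> 0 \<Longrightarrow> even (m - n)"
  shows "((\<lambda>m. a m * cnj (b m) * of_real (L * (LINT y:{0..<W}|lborel. exp (- (2 * pi * p * y\<^sup>2 / (L * W)) - 2 * pi * of_int m * y / L))))
     has_sum (LINT z:Lam L W|lborel. of_real (exp (- (2 * pi * p * (Im z)\<^sup>2 / (L * W)))) * (f (z / L) * cnj (g (z / L))))) UNIV"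
proof -
  let ?w = "\<lambda>y::real. exp (- (2 * pi * p * y\<^sup>2 / (L * W)))"
  let ?e = "\<lambda>m z. exp (pi * \<i> * of_int m * (z / of_real L))"
  let ?F = "\<lambda>i z. of_real (?w (Im z)) * ((a (fst i) * ?e (fst i) z) * cnj (b (snd i) * ?e (snd i) z))"
  define J where "J m = (LINT y:{0..<W}|lborel. exp (- (2 * pi * p * y\<^sup>2 / (L * W)) - 2 * pi * of_int m * y / L))" for m :: int
  define I where "I = (LINT z:Lam L W|lborel. of_real (?w (Im z)) * (f (z / L) * cnj (g (z / L))))"
  obtain b1 where b1: "b1 summable_on UNIV" "\<And>m v. \<bar>Im v\<bar> \<le> W / L \<Longrightarrow> norm (a m * exp (pi * \<i> * of_int m * v)) \<le> b1 m"
    by (rule has_fourier_bound[OF f, of "W / L"]) blast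
  obtain b2 where b2: "b2 summable_on UNIV" "\<And>m v. \<bar>Im v\<bar> \<le> W / L \<Longrightarrow> norm (b m * exp (pi * \<i> * of_int m * v)) \<le> b2 m"
    by (rule has_fourier_bound[OF g, of "W / L"]) blast
  have W0: "0 \<le> W / L" using L W by simp
  have nn: "0 \<le> b1 m" "0 \<le> b2 m" for m
    using order_trans[OF norm_ge_zero b1(2)[of 0 m]] order_trans[OF norm_ge_zero b2(2)[of 0 m]] W0 by simp_all
  have bs: "(\<lambda>i. b1 (fst i) * b2 (snd i)) summable_on UNIV"
  proof -
    have "((\<lambda>m. complex_of_real (b1 m)) has_sum of_real (infsum b1 UNIV)) UNIV"
      "((\<lambda>m. complex_of_real (b2 m)) has_sum of_real (infsum b2 UNIV)) UNIV"
      using b1(1) b2(1) by (simp_all add: has_sum_of_real_iff)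
    from has_sum_times[OF this]
    have "(\<lambda>(m, n). complex_of_real (b1 m) * of_real (b2 n)) summable_on (UNIV \<times> UNIV)"
      by (rule has_sum_imp_summable)
    then have "(\<lambda>i. norm (case i of (m, n) \<Rightarrow> complex_of_real (b1 m) * of_real (b2 n))) summable_on UNIV"
      by (simp add: summable_on_iff_abs_summable_on_complex)
    then show ?thesis using nn by (simp add: case_prod_unfold norm_mult)
  qed
  have cf: "continuous_on UNIV f" and cg: "continuous_on UNIV g"
    by (rule holomorphic_on_imp_continuous_on[OF has_fourier_holomorphic], rule f g)+
  have sums: "((\<lambda>i. LINT z:Lam L W|lborel. ?F i z) has_sum I) UNIV"
    unfolding I_def
  proof (rule has_sum_integral_finite_measure[OF emeasure_Lam _ _ _ bs])
    show "(\<lambda>z. of_real (?w (Im z)) * (f (z / L) * cnj (g (z / L)))) \<in> borel_measurable lborel"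
      using L W by (simp, intro borel_measurable_continuous_onI continuous_intros
          continuous_on_compose2[OF cf] continuous_on_compose2[OF cg]) auto
    show "?F i \<in> borel_measurable lborel" for i
      using L W by (simp, intro borel_measurable_continuous_onI continuous_intros) auto
  next
    fix i :: "int \<times> int" and z assume z: "z \<in> Lam L W"
    have im: "\<bar>Im (z / of_real L)\<bar> \<le> W / L"
      using z L by (auto simp: Lam_def divide_right_mono)
    have "norm (?F i z) = ?w (Im z) * (norm (a (fst i) * ?e (fst i) z) * norm (b (snd i) * ?e (snd i) z))"
      by (simp only: norm_mult complex_mod_cnj norm_of_real) simp
    also have "\<dots> \<le> 1 * (b1 (fst i) * b2 (snd i))"
      using p L W by (intro mult_mono b1(2)[OF im] b2(2)[OF im] mult_nonneg_nonneg) (auto simp: nn)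
    finally show "norm (?F i z) \<le> b1 (fst i) * b2 (snd i)" by simp
  next
    fix z
    have "((\<lambda>m. cnj (b m * ?e m z)) has_sum cnj (g (z / L))) UNIV"
      using has_fourierD[OF g] by (simp only: has_sum_cnj_iff)
    from has_sum_cmult_right[OF has_sum_times[OF has_fourierD[OF f] this]]
    show "((\<lambda>i. ?F i z) has_sum of_real (?w (Im z)) * (f (z / L) * cnj (g (z / L)))) UNIV"
      by (simp only: case_prod_unfold UNIV_Times_UNIV)
  qed simp
  have trm: "(LINT z:Lam L W|lborel. ?F (m, n) z) = (if m = n then a m * cnj (b m) * of_real (L * J m) else 0)" for m n :: int
  proof (cases "a m = 0 \<or> b n = 0")
    case False
    then have "even (m - n)" using par by blast
    then obtain k where k: "m - n = 2 * k" by (elim evenE)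
    let ?X = "\<lambda>x::real. exp (\<i> * of_real (2 * pi * of_int k / L * x))"
    let ?Y = "\<lambda>y::real. exp (- (2 * pi * p * y\<^sup>2 / (L * W)) - pi * of_int (m + n) * y / L)"
    have FXY: "?F (m, n) z = (a m * cnj (b n)) * (?X (Re z) * of_real (?Y (Im z)))" for z
    proof -
      have mk: "complex_of_int m = of_int n + 2 * of_int k"
        using k by (metis add.commute diff_eq_eq of_int_add of_int_mult of_int_numeral)
      have "complex_of_real (- (2 * pi * p * (Im z)\<^sup>2 / (L * W))) + (complex_of_real pi * \<i> * of_int m * (z / of_real L) + cnj (complex_of_real pi * \<i> * of_int n * (z / of_real L)))
          = \<i> * of_real (2 * pi * of_int k / L * Re z) + of_real (- (2 * pi * p * (Im z)\<^sup>2 / (L * W)) - pi * of_int (m + n) * Im z / L)"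
        unfolding mk using L by (simp add: complex_eq_iff mk field_simps)
      then have "of_real (?w (Im z)) * (?e m z * cnj (?e n z)) = ?X (Re z) * of_real (?Y (Im z))"
        by (simp only: exp_of_real[symmetric] exp_cnj exp_add[symmetric])
      then show ?thesis by (simp only: fst_conv snd_conv complex_cnj_mult mult_ac)
    qed
    have "set_integrable lborel {0..<L} ?X"
      using L by (intro set_integrable_subset[OF borel_integrable_atLeastAtMost'[of 0 L]]) (auto intro!: continuous_intros)
    moreover have "set_integrable lborel {0..<W} (\<lambda>y. complex_of_real (?Y y))"
      using L W by (intro set_integrable_subset[OF borel_integrable_atLeastAtMost'[of 0 W]]) (auto intro!: continuous_intros)
    ultimately have "(LINT z:Lam L W|lborel. ?F (m, n) z) = (a m * cnj (b n)) * ((LINT x:{0..<L}|lborel. ?X x) * (LINT y:{0..<W}|lborel. complex_of_real (?Y y)))"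
      unfolding FXY by (simp only: set_integral_mult_right integral_Lam_product[of L ?X W "\<lambda>y. complex_of_real (?Y y)"])
    also have "(LINT x:{0..<L}|lborel. ?X x) = (if k = 0 then of_real L else 0)"
      by (rule integral_exp_period[OF L])
    also have "(LINT y:{0..<W}|lborel. complex_of_real (?Y y)) = of_real (LINT y:{0..<W}|lborel. ?Y y)"
      by (rule set_integral_complex_of_real)
    finally have "(LINT z:Lam L W|lborel. ?F (m, n) z) = a m * cnj (b n) * ((if k = 0 then of_real L else 0) * of_real (LINT y:{0..<W}|lborel. ?Y y))" .
    moreover have "(LINT y:{0..<W}|lborel. ?Y y) = J m" if "m = n"
    proof -
      have "?Y y = exp (- (2 * pi * p * y\<^sup>2 / (L * W)) - 2 * pi * of_int m * y / L)" for y
        using that by (simp add: mult_ac)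
      then show ?thesis by (simp only: J_def)
    qed
    moreover have "k = 0 \<longleftrightarrow> m = n" using k by auto
    ultimately show ?thesis by (cases "m = n") simp_all
  qed (auto simp: set_lebesgue_integral_def)
  define Tm where "Tm m = a m * cnj (b m) * of_real (L * J m)" for m
  have sums2: "((\<lambda>i. if fst i = snd i then Tm (fst i) else 0) has_sum I) UNIV"
  proof -
    have "(LINT z:Lam L W|lborel. ?F i z) = (if fst i = snd i then Tm (fst i) else 0)" for i
      unfolding Tm_def using trm[of "fst i" "snd i"] by (simp only: prod.collapse)
    then show ?thesis using sums by (simp only:)
  qed
  have inj: "inj (\<lambda>m::int. (m, m))" by (simp add: inj_def)
  have "((\<lambda>i. if fst i = snd i then Tm (fst i) else 0) has_sum I) (range (\<lambda>m::int. (m, m)))"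
    by (rule has_sum_cong_neutral[THEN iffD1, OF _ _ _ sums2]) auto
  then have "((\<lambda>m. Tm m) has_sum I) UNIV"
    by (simp only: has_sum_reindex[OF inj] o_def fst_conv snd_conv if_True refl)
  then show ?thesis unfolding Tm_def J_def I_def .
qed

text \<open>The Fourier supports lie in different classes modulo 2 p, so every diagonal product of
  coefficients is 0.\<close>

lemma integral_tbasis_orthogonal:
  fixes L W :: real and p :: int
  assumes L: "L > 0" and W: "W > 0" and p: "p > 0" and s: "s = 1 \<or> s = - 1"
    and par: "even (k - k')" and dvd: "\<not> 2 * p dvd k - k'"
  shows "(LINT z:Lam L W|lborel. of_real (exp (- (2 * pi * of_int p * (Im z)\<^sup>2 / (L * W)))) *
     (tbasis s p (tau L W) k (z / L) * cnj (tbasis s p (tau L W) k' (z / L)))) = 0"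
proof -
  have t: "Im (tau L W) > 0" using L W by (simp add: tau_def)
  have disj: "tcoeff s p (tau L W) k m = 0 \<or> tcoeff s p (tau L W) k' m = 0" for m
  proof (rule ccontr)
    assume "\<not> ?thesis"
    then have d: "2 * p dvd m - (k - p)" "2 * p dvd m - (k' - p)"
      by (auto simp: tcoeff_def split: if_splits)
    show False using dvd_diff[OF d(2,1)] dvd by simp
  qed
  have ev: "even (m - n)" if "tcoeff s p (tau L W) k m \<noteq> 0" "tcoeff s p (tau L W) k' n \<noteq> 0" for m n
  proof -
    have "2 * p dvd m - (k - p)" "2 * p dvd n - (k' - p)"
      using that by (auto simp: tcoeff_def split: if_splits)
    then have "even (m - (k - p))" "even (n - (k' - p))" using dvd_mult_left by blast+
    then show ?thesis using par by presburger
  qed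
  have p': "real_of_int p > 0" using p by simp
  have zero: "tcoeff s p (tau L W) k m * cnj (tcoeff s p (tau L W) k' m) = 0" for m
    using disj[of m] by auto
  show ?thesis
  proof (rule has_sum_unique)
    show "((\<lambda>m::int. 0) has_sum (LINT z:Lam L W|lborel. of_real (exp (- (2 * pi * of_int p * (Im z)\<^sup>2 / (L * W)))) *
       (tbasis s p (tau L W) k (z / L) * cnj (tbasis s p (tau L W) k' (z / L))))) UNIV"
      using has_sum_theta_inner[OF L W p' has_fourier_tbasis[OF t p s, of k] has_fourier_tbasis[OF t p s, of k'] ev]
      unfolding zero mult_zero_left by simp
  qed (rule has_sum_0, simp)
qed

text \<open>On the support, consecutive frequencies differ by 2 p, which translates the Gaussian in
  Im z by exactly W. The terms thus add up to a Gaussian integral over the whole line, the source of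
  the square root.\<close>

lemma integral_tbasis_norm:
  fixes L W :: real and p :: int
  assumes L: "L > 0" and W: "W > 0" and p: "p > 0" and s: "s = 1 \<or> s = - 1"
  shows "(LINT z:Lam L W|lborel. of_real (exp (- (2 * pi * of_int p * (Im z)\<^sup>2 / (L * W)))) *
     (tbasis s p (tau L W) k (z / L) * cnj (tbasis s p (tau L W) k (z / L))))
   = of_real (L * exp (pi * W * (of_int k)\<^sup>2 / (2 * of_int p * L)) * sqrt (L * W / (2 * of_int p)))"
    (is "?I = of_real ?c")
proof -
  have t: "Im (tau L W) > 0" using L W by (simp add: tau_def)
  let ?a = "tcoeff s p (tau L W) k"
  let ?J = "\<lambda>m. LINT y:{0..<W}|lborel. exp (- (2 * pi * of_int p * y\<^sup>2 / (L * W)) - 2 * pi * of_int m * y / L)"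
  define \<alpha> where "\<alpha> = 2 * pi * of_int p / (L * W)"
  \<comment> \<open>Completing the square in y centres the Gaussian at - m W / (2 p), which is - (n
    W + c) for m = 2 p n + (k - p).\<close>
  define c where "c = of_int (k - p) * W / (2 * of_int p)"
  define E where "E = exp (pi * W * (of_int k)\<^sup>2 / (2 * of_int p * L))"
  have p': "real_of_int p > 0" using p by simp
  have \<alpha>: "\<alpha> > 0" using L W p' by (simp add: \<alpha>_def)
  have ev: "even (m - n)" if "?a m \<noteq> 0" "?a n \<noteq> 0" for m n
  proof -
    have "2 * p dvd m - (k - p)" "2 * p dvd n - (k - p)"
      using that by (auto simp: tcoeff_def split: if_splits)
    then have "even (m - (k - p))" "even (n - (k - p))" using dvd_mult_left by blast+
    then show ?thesis by presburger
  qed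
  have all: "((\<lambda>m. ?a m * cnj (?a m) * of_real (L * ?J m)) has_sum ?I) UNIV"
    using has_sum_theta_inner[OF L W p' has_fourier_tbasis[OF t p s] has_fourier_tbasis[OF t p s] ev] .
  let ?h = "\<lambda>n. 2 * p * n + (k - p)"
  have inj: "inj ?h" using p by (simp add: inj_def)
  have "((\<lambda>m. ?a m * cnj (?a m) * of_real (L * ?J m)) has_sum ?I) (range ?h)"
  proof (rule has_sum_cong_neutral[THEN iffD1, OF _ _ _ all])
    fix m assume m: "m \<in> UNIV - range ?h"
    have "\<not> 2 * p dvd m - (k - p)"
    proof
      assume "2 * p dvd m - (k - p)"
      then obtain d where "m - (k - p) = 2 * p * d" by (elim dvdE)
      then have "m = ?h d" by simp
      then show False using m by blast
    qed
    then show "?a m * cnj (?a m) * of_real (L * ?J m) = 0" by (simp add: tcoeff_def)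
  qed simp_all
  then have h: "((\<lambda>n. ?a (?h n) * cnj (?a (?h n)) * of_real (L * ?J (?h n))) has_sum ?I) UNIV"
    by (simp only: has_sum_reindex[OF inj] o_def)
  have trm: "?a (?h n) * cnj (?a (?h n)) * of_real (L * ?J (?h n))
      = of_real (L * E * (LINT y:{0..<W}|lborel. exp (- \<alpha> * (y + of_int n * W + c)\<^sup>2)))" for n
  proof -
    let ?m = "?h n"
    have "norm (?a ?m) = exp (- (pi * W * ((of_int ?m)\<^sup>2 - (of_int k)\<^sup>2) / (4 * of_int p * L)))"
    proof -
      have "pi * \<i> * tau L W * (of_int ?m ^ 2 - of_int k ^ 2) / (4 * of_int p)
          = of_real (- (pi * W * ((of_int ?m)\<^sup>2 - (of_int k)\<^sup>2) / (4 * of_int p * L)))"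
        using L p' by (simp add: tau_def field_simps)
      then have "norm (exp (pi * \<i> * tau L W * (of_int ?m ^ 2 - of_int k ^ 2) / (4 * of_int p)))
          = exp (- (pi * W * ((of_int ?m)\<^sup>2 - (of_int k)\<^sup>2) / (4 * of_int p * L)))"
        by (simp only: norm_exp_eq_Re Re_complex_of_real)
      moreover have "norm (s powi j) = 1" for j using s by (auto simp: norm_power_int)
      moreover have "norm (if s = 1 then 1 else \<i>) = 1" by simp
      moreover have "2 * p dvd ?m - (k - p)" by simp
      ultimately show ?thesis unfolding tcoeff_def by (simp only: if_True norm_mult mult_1_left)
    qed
    then have aa: "?a ?m * cnj (?a ?m) = of_real (exp (- (pi * W * ((of_int ?m)\<^sup>2 - (of_int k)\<^sup>2) / (2 * of_int p * L))))"
      by (simp only: complex_norm_square[symmetric] power2_eq_square exp_add[symmetric])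
        (simp add: field_simps)
    \<comment> \<open>The squared modulus of the coefficient cancels the m^2 left over from
      completing the square; only the part with k^2 survives, namely \<open>E\<close>.\<close>
    have "exp (- (pi * W * ((of_int ?m)\<^sup>2 - (of_int k)\<^sup>2) / (2 * of_int p * L))) * exp (- (2 * pi * of_int p * y\<^sup>2 / (L * W)) - 2 * pi * of_int ?m * y / L)
        = E * exp (- \<alpha> * (y + of_int n * W + c)\<^sup>2)" for y
    proof -
      have yc: "y + of_int n * W + c = y + of_int ?m * W / (2 * of_int p)"
        using p' by (simp add: c_def field_simps)
      show ?thesis
        unfolding E_def exp_add[symmetric] yc \<alpha>_def using L W p'
        by (intro arg_cong[of _ _ exp]) (simp add: power2_eq_square field_simps)
    qed
    then have "exp (- (pi * W * ((of_int ?m)\<^sup>2 - (of_int k)\<^sup>2) / (2 * of_int p * L))) * ?J ?m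
        = E * (LINT y:{0..<W}|lborel. exp (- \<alpha> * (y + of_int n * W + c)\<^sup>2))"
      by (simp only: set_integral_mult_right[symmetric])
    then show ?thesis unfolding aa of_real_mult[symmetric] by (simp only: mult_ac)
  qed
  have "((\<lambda>n. of_real (L * E * (LINT y:{0..<W}|lborel. exp (- \<alpha> * (y + of_int n * W + c)\<^sup>2)))) has_sum (of_real (L * E * sqrt (pi / \<alpha>)) :: complex)) UNIV"
    by (simp only: has_sum_of_real_iff) (rule has_sum_cmult_right[OF has_sum_gaussian_periods[OF \<alpha> W]])
  from has_sum_unique[OF h[unfolded trm] this]
  have "?I = of_real (L * E * sqrt (pi / \<alpha>))" .
  moreover have "pi / \<alpha> = L * W / (2 * of_int p)" using L W p' by (simp add: \<alpha>_def field_simps)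
  ultimately show ?thesis by (simp only: E_def)
qed

section \<open>Determinants and alternating functions\<close>

declare One_nat_def [simp del]

lemma bij_betw_map_permutation:
  assumes "bij_betw f S T"
  shows "bij_betw (map_permutation S f) {p. p permutes S} {p. p permutes T}"
proof -
  have "f ` S = T" using assms by (simp add: bij_betw_def)
  then have "map_permutation S f = (\<lambda>\<pi> x. if x \<in> T then f (\<pi> (inv_into S f x)) else x)"
    by (auto simp: fun_eq_iff map_permutation_def restrict_id_def)
  then show ?thesis using bij_betw_permutations[OF assms] by simp
qed

text \<open>Moving the indices from {1..n} to {0..<n} makes products, transposes and inverses of
  matrices available for \<open>detn\<close>.\<close>

lemma detn_eq_det: "detn n M = det (mat n n (\<lambda>(i, j). M (Suc i) (Suc j)))"
proof -
  let ?U = "{0..<n}"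
  have im: "Suc ` ?U = {1..n}" by auto
  then have bij: "bij_betw Suc ?U {1..n}" by (simp add: bij_betw_def)
  have "detn n M = (\<Sum>p | p permutes ?U. of_int (sign (map_permutation ?U Suc p)) * (\<Prod>i\<in>{1..n}. M i (map_permutation ?U Suc p i)))"
    unfolding detn_def by (rule sum.reindex_bij_betw[OF bij_betw_map_permutation[OF bij], symmetric])
  also have "\<dots> = (\<Sum>p | p permutes ?U. of_int (sign p) * (\<Prod>i\<in>?U. M (Suc i) (Suc (p i))))"
  proof (rule sum.cong, simp)
    fix p assume "p \<in> {p. p permutes ?U}"
    then have p: "p permutes ?U" by simp
    have "(\<Prod>i\<in>{1..n}. M i (map_permutation ?U Suc p i)) = (\<Prod>i\<in>?U. M (Suc i) (map_permutation ?U Suc p (Suc i)))"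
      by (subst im[symmetric], subst prod.reindex) simp_all
    also have "\<dots> = (\<Prod>i\<in>?U. M (Suc i) (Suc (p i)))"
      by (rule prod.cong, simp, subst map_permutation_apply) simp_all
    finally show "of_int (sign (map_permutation ?U Suc p)) * (\<Prod>i\<in>{1..n}. M i (map_permutation ?U Suc p i)) = of_int (sign p) * (\<Prod>i\<in>?U. M (Suc i) (Suc (p i)))"
      using sign_map_permutation[OF _ p, of Suc] by simp
  qed
  also have "\<dots> = det (mat n n (\<lambda>(i, j). M (Suc i) (Suc j)))"
  proof (subst det_def', rule mat_carrier, rule sum.cong, simp)
    fix p assume "p \<in> {p. p permutes ?U}"
    then have p: "p permutes ?U" by simp
    have "M (Suc i) (Suc (p i)) = mat n n (\<lambda>(i, j). M (Suc i) (Suc j)) $$ (i, p i)" if "i \<in> ?U" for i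
      using that permutes_in_image[OF p, of i] by simp
    then have "(\<Prod>i\<in>?U. M (Suc i) (Suc (p i))) = (\<Prod>i\<in>?U. mat n n (\<lambda>(i, j). M (Suc i) (Suc j)) $$ (i, p i))"
      by (rule prod.cong[OF refl])
    then show "of_int (sign p) * (\<Prod>i\<in>?U. M (Suc i) (Suc (p i))) = of_int (sign p) * (\<Prod>i = 0..<n. mat n n (\<lambda>(i, j). M (Suc i) (Suc j)) $$ (i, p i))"
      by (simp only:)
  qed
  finally show ?thesis .
qed

lemma detn_cong:
  assumes "\<And>i j. i \<in> {1..n} \<Longrightarrow> j \<in> {1..n} \<Longrightarrow> M i j = P i j"
  shows "detn n M = detn n P"
  unfolding detn_eq_det using assms by (intro arg_cong[of _ _ det] eq_matI) auto

lemma sum_Suc_atLeast: "(\<Sum>k\<in>{1..n}. f k) = (\<Sum>k = 0..<n. f (Suc k))"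
  by (subst sum.atLeast_Suc_lessThan_Suc_shift[unfolded o_def, symmetric]) (simp add: atLeastLessThanSuc_atLeastAtMost One_nat_def)

lemma detn_mult: "detn n (\<lambda>i j. \<Sum>k\<in>{1..n}. M i k * P k j) = detn n M * detn n P"
proof -
  have "mat n n (\<lambda>(i, j). \<Sum>k\<in>{1..n}. M (Suc i) k * P k (Suc j))
      = mat n n (\<lambda>(i, j). M (Suc i) (Suc j)) * mat n n (\<lambda>(i, j). P (Suc i) (Suc j))"
    by (rule eq_matI) (auto simp: sum_Suc_atLeast scalar_prod_def)
  then show ?thesis
    unfolding detn_eq_det by (simp add: det_mult[of _ n])
qed

lemma detn_transpose: "detn n (\<lambda>i j. M j i) = detn n M"
proof -
  have "mat n n (\<lambda>(i, j). M (Suc j) (Suc i)) = transpose_mat (mat n n (\<lambda>(i, j). M (Suc i) (Suc j)))"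
    by (rule eq_matI) auto
  then show ?thesis unfolding detn_eq_det by (simp add: det_transpose[of _ n])
qed

lemma detn_cnj: "detn n (\<lambda>i j. cnj (M i j)) = cnj (detn n M)"
  by (simp add: detn_def)

lemma detn_scale: "detn n (\<lambda>i j. u i * M i j * v j) = (\<Prod>i\<in>{1..n}. u i * v i) * detn n M"
  unfolding detn_def sum_distrib_left
proof (rule sum.cong, simp)
  fix p assume "p \<in> {p. p permutes {1..n}}"
  then have "(\<Prod>i\<in>{1..n}. v (p i)) = (\<Prod>i\<in>{1..n}. v i)"
    using prod.permute[of p "{1..n}" v] by (simp add: o_def)
  then show "of_int (sign p) * (\<Prod>i\<in>{1..n}. u i * M i (p i) * v (p i)) = (\<Prod>i\<in>{1..n}. u i * v i) * (of_int (sign p) * (\<Prod>i\<in>{1..n}. M i (p i)))"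
    by (simp add: prod.distrib)
qed

lemma detn_left_inverse:
  assumes "detn n M \<noteq> 0"
  obtains P where "\<And>i j. i \<in> {1..n} \<Longrightarrow> j \<in> {1..n} \<Longrightarrow> (\<Sum>k\<in>{1..n}. P i k * M k j) = (if i = j then 1 else 0)"
proof -
  let ?M = "mat n n (\<lambda>(i, j). M (Suc i) (Suc j))"
  have "?M \<in> Units (ring_mat TYPE(complex) n ())"
    by (rule det_non_zero_imp_unit) (use assms in \<open>simp_all add: detn_eq_det\<close>)
  then obtain P where P: "P \<in> carrier_mat n n" "P * ?M = 1\<^sub>m n"
    unfolding Units_def ring_mat_def by auto
  have "(\<Sum>k\<in>{1..n}. P $$ (i - 1, k - 1) * M k j) = (if i = j then 1 else 0)" if "i \<in> {1..n}" "j \<in> {1..n}" for i j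
  proof -
    have "i - 1 < n" "j - 1 < n" "Suc (j - 1) = j" using that by auto
    then have "(P * ?M) $$ (i - 1, j - 1) = (\<Sum>k\<in>{1..n}. P $$ (i - 1, k - 1) * M k j)"
      using P(1) by (simp add: sum_Suc_atLeast scalar_prod_def)
    moreover have "(1\<^sub>m n :: complex mat) $$ (i - 1, j - 1) = (if i = j then 1 else 0)"
      using that by (auto simp: one_mat_def)
    ultimately show ?thesis using P(2) by simp
  qed
  then show ?thesis by (rule that)
qed

section \<open>Alternating functions as multiples of a determinant\<close>

text \<open>For a non-injective map, swapping two equal entries both fixes and negates the value of
  \<open>F\<close>, so the term is 0. The injective maps are the permutations, and they give the
  Leibniz formula. \<open>loc\<close> absorbs the value \<open>undefined\<close> of extensional maps
  outside the index set.\<close>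

lemma alternating_sum:
  fixes F :: "(nat \<Rightarrow> 'a) \<Rightarrow> complex"
  assumes loc: "\<And>f g. (\<And>i. i \<in> {1..n} \<Longrightarrow> f i = g i) \<Longrightarrow> F f = F g"
    and alt: "\<And>f p. p permutes {1..n} \<Longrightarrow> F (f \<circ> p) = of_int (sign p) * F f"
  shows "(\<Sum>\<alpha>\<in>{1..n} \<rightarrow>\<^sub>E {1..n}. F (x \<circ> \<alpha>) * (\<Prod>k\<in>{1..n}. l (\<alpha> k) k))
        = F x * detn n (\<lambda>k i. l i k)"
proof -
  let ?U = "{1..n}"
  let ?I = "{\<alpha> \<in> ?U \<rightarrow>\<^sub>E ?U. inj_on \<alpha> ?U}"
  have zero: "F (x \<circ> \<alpha>) = 0" if "\<alpha> \<in> ?U \<rightarrow>\<^sub>E ?U" "\<not> inj_on \<alpha> ?U" for \<alpha>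
  proof -
    obtain i j where ij: "i \<in> ?U" "j \<in> ?U" "i \<noteq> j" "\<alpha> i = \<alpha> j"
      using \<open>\<not> inj_on \<alpha> ?U\<close> unfolding inj_on_def by blast
    have "x \<circ> \<alpha> \<circ> Transposition.transpose i j = x \<circ> \<alpha>"
      using ij(4) by (auto simp: fun_eq_iff Transposition.transpose_def)
    moreover have "F (x \<circ> \<alpha> \<circ> Transposition.transpose i j) = - F (x \<circ> \<alpha>)"
      using alt[OF permutes_swap_id[OF ij(1,2)], of "x \<circ> \<alpha>"] ij(3) by (simp add: sign_swap_id)
    ultimately show ?thesis by simp
  qed
  have inj: "inj_on (\<lambda>p. restrict p ?U) {p. p permutes ?U}"
  proof (rule inj_onI)
    fix p q assume pq: "p \<in> {p. p permutes ?U}" "q \<in> {p. p permutes ?U}" "restrict p ?U = restrict q ?U"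
    show "p = q"
    proof
      fix i show "p i = q i"
      proof (cases "i \<in> ?U")
        case True then show ?thesis using fun_cong[OF pq(3), of i] by simp
      next
        case False then show ?thesis using pq(1,2) by (simp add: permutes_not_in)
      qed
    qed
  qed
  have im: "(\<lambda>p. restrict p ?U) ` {p. p permutes ?U} = ?I"
  proof (intro equalityI subsetI)
    fix \<alpha> assume "\<alpha> \<in> (\<lambda>p. restrict p ?U) ` {p. p permutes ?U}"
    then obtain p where p: "p permutes ?U" "\<alpha> = restrict p ?U" by auto
    have "inj_on (restrict p ?U) ?U"
      using permutes_inj_on[OF p(1), of ?U] by (simp only: inj_on_restrict_eq)
    moreover have "restrict p ?U \<in> ?U \<rightarrow>\<^sub>E ?U"
      by (rule restrict_PiE[THEN iffD2]) (simp only: Pi_def mem_Collect_eq permutes_in_image[OF p(1)], blast)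
    ultimately show "\<alpha> \<in> ?I" using p(2) by blast
  next
    fix \<alpha> assume \<alpha>: "\<alpha> \<in> ?I"
    define p where "p = (\<lambda>i. if i \<in> ?U then \<alpha> i else i)"
    have "inj_on \<alpha> ?U" and "\<alpha> ` ?U \<subseteq> ?U" using \<alpha> by blast+
    then have "\<alpha> ` ?U = ?U" by (intro endo_inj_surj) simp_all
    then have "bij_betw \<alpha> ?U ?U" using \<alpha> by (auto simp: bij_betw_def)
    moreover have "bij_betw p ?U ?U \<longleftrightarrow> bij_betw \<alpha> ?U ?U" by (rule bij_betw_cong) (simp add: p_def)
    ultimately have "bij_betw p ?U ?U" by simp
    then have "p permutes ?U" by (rule bij_imp_permutes) (auto simp: p_def)
    moreover have "\<alpha> = restrict p ?U"
    proof
      fix i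
      have "\<alpha> i = undefined" if "i \<notin> ?U" using \<alpha> that PiE_arb[of \<alpha> ?U "\<lambda>_. ?U" i] by blast
      then show "\<alpha> i = restrict p ?U i" by (simp add: p_def restrict_def)
    qed
    ultimately show "\<alpha> \<in> (\<lambda>p. restrict p ?U) ` {p. p permutes ?U}" by blast
  qed
  have "(\<Sum>\<alpha>\<in>?U \<rightarrow>\<^sub>E ?U. F (x \<circ> \<alpha>) * (\<Prod>k\<in>?U. l (\<alpha> k) k)) = (\<Sum>\<alpha>\<in>?I. F (x \<circ> \<alpha>) * (\<Prod>k\<in>?U. l (\<alpha> k) k))"
  proof (rule sum.mono_neutral_right)
    show "\<forall>\<alpha>\<in>(?U \<rightarrow>\<^sub>E ?U) - ?I. F (x \<circ> \<alpha>) * (\<Prod>k\<in>?U. l (\<alpha> k) k) = 0"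
    proof
      fix \<alpha> assume "\<alpha> \<in> (?U \<rightarrow>\<^sub>E ?U) - ?I"
      then have "F (x \<circ> \<alpha>) = 0" by (intro zero) blast+
      then show "F (x \<circ> \<alpha>) * (\<Prod>k\<in>?U. l (\<alpha> k) k) = 0" by simp
    qed
  qed (auto intro: finite_PiE)
  also have "\<dots> = (\<Sum>p | p permutes ?U. F (x \<circ> restrict p ?U) * (\<Prod>k\<in>?U. l (restrict p ?U k) k))"
    by (subst im[symmetric], subst sum.reindex[OF inj]) (simp add: o_def)
  also have "\<dots> = (\<Sum>p | p permutes ?U. F x * (of_int (sign p) * (\<Prod>k\<in>?U. l (p k) k)))"
  proof (rule sum.cong, simp)
    fix p assume "p \<in> {p. p permutes ?U}"
    then have p: "p permutes ?U" by simp
    have "F (x \<circ> restrict p ?U) = F (x \<circ> p)" by (rule loc) simp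
    then show "F (x \<circ> restrict p ?U) * (\<Prod>k\<in>?U. l (restrict p ?U k) k) = F x * (of_int (sign p) * (\<Prod>k\<in>?U. l (p k) k))"
      using alt[OF p, of x] by simp
  qed
  finally show ?thesis by (simp add: detn_def sum_distrib_left)
qed

text \<open>Interpolation at the nodes \<open>x i\<close> with functions \<open>l i\<close>, applied
  to one variable after another; the sum runs over all choices of a node for each variable in
  \<open>S\<close>.\<close>

lemma multi_expansion:
  fixes F :: "(nat \<Rightarrow> 'a) \<Rightarrow> complex"
  assumes ex: "\<And>k z. k \<in> S \<Longrightarrow> F z = (\<Sum>i\<in>U. F (z(k := x i)) * l i (z k))"
    and S: "finite S" and U: "finite U"
  shows "F z = (\<Sum>\<alpha>\<in>S \<rightarrow>\<^sub>E U. F (\<lambda>k. if k \<in> S then x (\<alpha> k) else z k) * (\<Prod>k\<in>S. l (\<alpha> k) (z k)))"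
  using S ex
proof (induction S)
  case (insert k S)
  have "F z = (\<Sum>\<alpha>\<in>S \<rightarrow>\<^sub>E U. F (\<lambda>j. if j \<in> S then x (\<alpha> j) else z j) * (\<Prod>j\<in>S. l (\<alpha> j) (z j)))"
    using insert by blast
  also have "\<dots> = (\<Sum>\<alpha>\<in>S \<rightarrow>\<^sub>E U. \<Sum>i\<in>U. F (\<lambda>j. if j \<in> insert k S then x ((\<alpha>(k := i)) j) else z j) * (\<Prod>j\<in>insert k S. l ((\<alpha>(k := i)) j) (z j)))"
  proof (rule sum.cong, simp)
    fix \<alpha>
    let ?z = "\<lambda>j. if j \<in> S then x (\<alpha> j) else z j"
    have "?z(k := x i) = (\<lambda>j. if j \<in> insert k S then x ((\<alpha>(k := i)) j) else z j)" for i
      using insert.hyps by (auto simp: fun_eq_iff)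
    moreover have "(\<Prod>j\<in>S. l ((\<alpha>(k := i)) j) (z j)) = (\<Prod>j\<in>S. l (\<alpha> j) (z j))" for i
      using insert.hyps by (intro prod.cong) auto
    moreover have "?z k = z k" using insert.hyps by simp
    moreover have "F ?z = (\<Sum>i\<in>U. F (?z(k := x i)) * l i (?z k))"
      using insert.prems by blast
    ultimately show "F ?z * (\<Prod>j\<in>S. l (\<alpha> j) (z j)) = (\<Sum>i\<in>U. F (\<lambda>j. if j \<in> insert k S then x ((\<alpha>(k := i)) j) else z j) * (\<Prod>j\<in>insert k S. l ((\<alpha>(k := i)) j) (z j)))"
      using insert.hyps by (simp add: sum_distrib_right mult.assoc)
  qed
  also have "\<dots> = (\<Sum>(i, \<alpha>)\<in>U \<times> (S \<rightarrow>\<^sub>E U). F (\<lambda>j. if j \<in> insert k S then x ((\<alpha>(k := i)) j) else z j) * (\<Prod>j\<in>insert k S. l ((\<alpha>(k := i)) j) (z j)))"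
    unfolding sum.cartesian_product[symmetric] by (rule sum.swap)
  also have "\<dots> = (\<Sum>\<beta>\<in>insert k S \<rightarrow>\<^sub>E U. F (\<lambda>j. if j \<in> insert k S then x (\<beta> j) else z j) * (\<Prod>j\<in>insert k S. l (\<beta> j) (z j)))"
    unfolding PiE_insert_eq using insert.hyps
    by (subst sum.reindex[OF inj_combinator]) (auto simp: o_def case_prod_unfold)
  finally show ?case .
qed simp

text \<open>After interpolation in every variable only values of \<open>F\<close> at nodes remain,
  and alternation reduces all of them to multiples of the single value \<open>F x\<close>.\<close>

lemma alternating_proportional_detn:
  fixes F :: "(nat \<Rightarrow> 'a) \<Rightarrow> complex" and \<phi> :: "nat \<Rightarrow> 'a \<Rightarrow> complex"
  assumes loc: "\<And>f g. (\<And>i. i \<in> {1..n} \<Longrightarrow> f i = g i) \<Longrightarrow> F f = F g"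
    and alt: "\<And>f p. p permutes {1..n} \<Longrightarrow> F (f \<circ> p) = of_int (sign p) * F f"
    and span: "\<And>k z. k \<in> {1..n} \<Longrightarrow> \<exists>c. \<forall>w. F (z(k := w)) = (\<Sum>i\<in>{1..n}. c i * \<phi> i w)"
    and x: "detn n (\<lambda>k i. \<phi> i (x k)) \<noteq> 0"
  obtains \<kappa> where "\<And>z. F z = \<kappa> * detn n (\<lambda>k i. \<phi> i (z k))"
proof -
  obtain P where P: "\<And>i j. i \<in> {1..n} \<Longrightarrow> j \<in> {1..n} \<Longrightarrow> (\<Sum>k\<in>{1..n}. P i k * \<phi> j (x k)) = (if i = j then 1 else 0)"
    by (rule detn_left_inverse[OF x]) blast
  \<comment> \<open>Lagrange-type functions: inverting the matrix of node values makes the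
    interpolation exact on every \<open>\<phi> j\<close>, hence on their span.\<close>
  define l where "l i w = (\<Sum>j\<in>{1..n}. \<phi> j w * P j i)" for i w
  have rep: "(\<Sum>i\<in>{1..n}. \<phi> j (x i) * l i w) = \<phi> j w" if "j \<in> {1..n}" for j w
  proof -
    have "(\<Sum>i\<in>{1..n}. \<phi> j (x i) * l i w) = (\<Sum>m\<in>{1..n}. (\<Sum>i\<in>{1..n}. P m i * \<phi> j (x i)) * \<phi> m w)"
      unfolding l_def sum_distrib_left sum_distrib_right by (subst sum.swap) (simp add: mult_ac)
    also have "\<dots> = (\<Sum>m\<in>{1..n}. if m = j then \<phi> m w else 0)"
      by (rule sum.cong[OF refl]) (simp only: P that if_distrib[of "\<lambda>x. x * _"] mult_1_left mult_zero_left)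
    finally show ?thesis using that by simp
  qed
  have ex: "F z = (\<Sum>i\<in>{1..n}. F (z(k := x i)) * l i (z k))" if k: "k \<in> {1..n}" for k z
  proof -
    obtain c where c: "\<And>w. F (z(k := w)) = (\<Sum>i\<in>{1..n}. c i * \<phi> i w)"
      using span[OF k, of z] by blast
    have "(\<Sum>i\<in>{1..n}. F (z(k := x i)) * l i (z k)) = (\<Sum>j\<in>{1..n}. c j * (\<Sum>i\<in>{1..n}. \<phi> j (x i) * l i (z k)))"
      unfolding c sum_distrib_left sum_distrib_right by (subst sum.swap) (simp add: mult_ac)
    also have "\<dots> = (\<Sum>j\<in>{1..n}. c j * \<phi> j (z k))"
      by (rule sum.cong[OF refl]) (simp only: rep)
    also have "\<dots> = F z" using c[of "z k"] by simp
    finally show ?thesis by simp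
  qed
  have "F z = (F x * detn n P) * detn n (\<lambda>k i. \<phi> i (z k))" for z
  proof -
    have "F z = (\<Sum>\<alpha>\<in>{1..n} \<rightarrow>\<^sub>E {1..n}. F (\<lambda>k. if k \<in> {1..n} then x (\<alpha> k) else z k) * (\<Prod>k\<in>{1..n}. l (\<alpha> k) (z k)))"
      by (rule multi_expansion[OF ex]) auto
    also have "\<dots> = (\<Sum>\<alpha>\<in>{1..n} \<rightarrow>\<^sub>E {1..n}. F (x \<circ> \<alpha>) * (\<Prod>k\<in>{1..n}. l (\<alpha> k) (z k)))"
      by (intro sum.cong refl arg_cong2[of _ _ _ _ "(*)"] loc) simp
    also have "\<dots> = F x * detn n (\<lambda>k i. l i (z k))"
      by (rule alternating_sum[OF loc alt])
    also have "detn n (\<lambda>k i. l i (z k)) = detn n (\<lambda>k i. \<phi> i (z k)) * detn n P"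
      unfolding l_def by (rule detn_mult)
    finally show ?thesis by (simp add: mult_ac)
  qed
  then show ?thesis by (rule that)
qed

section \<open>Determinantal densities\<close>

text \<open>Boundedness on a set of finite measure, rather than integrability, is the assumption
  because products of many of these functions are integrated.\<close>

locale orthonormal_system =
  fixes M :: "'a measure" and \<Lambda> :: "'a set" and \<phi> :: "nat \<Rightarrow> 'a \<Rightarrow> complex" and N :: nat
  assumes sigma_finite: "sigma_finite_measure M"
    and \<Lambda>: "\<Lambda> \<in> sets M" "emeasure M \<Lambda> < \<infinity>"
    and meas: "\<And>i. \<phi> i \<in> borel_measurable M"
    and bounded: "\<And>i. \<exists>c. \<forall>u\<in>\<Lambda>. norm (\<phi> i u) \<le> c"
    and orthonormal: "\<And>i j. i \<in> {1..N} \<Longrightarrow> j \<in> {1..N} \<Longrightarrow>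
      (LINT y:\<Lambda>|M. \<phi> i y * cnj (\<phi> j y)) = (if i = j then 1 else 0)"
begin

definition K :: "'a \<Rightarrow> 'a \<Rightarrow> complex" where
  "K u w = (\<Sum>i\<in>{1..N}. \<phi> i u * cnj (\<phi> i w))"

abbreviation has_int :: "('a \<Rightarrow> complex) \<Rightarrow> complex \<Rightarrow> bool" where
  "has_int f v \<equiv> has_bochner_integral M (\<lambda>y. indicator \<Lambda> y *\<^sub>R f y) v"

lemma has_int_cmult: "has_int f v \<Longrightarrow> has_int (\<lambda>y. c * f y) (c * v)"
  using has_bochner_integral_mult_right[of c M "\<lambda>y. indicator \<Lambda> y *\<^sub>R f y" v] by simp

lemma has_int_sum: "(\<And>i. i \<in> I \<Longrightarrow> has_int (f i) (v i)) \<Longrightarrow> has_int (\<lambda>y. \<Sum>i\<in>I. f i y) (\<Sum>i\<in>I. v i)"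
  using has_bochner_integral_sum[of I M "\<lambda>i y. indicator \<Lambda> y *\<^sub>R f i y" v]
  by (simp add: scaleR_sum_right)

lemma meas_cnj: "(\<lambda>y. cnj (\<phi> i y)) \<in> borel_measurable M"
  by (rule measurable_compose[OF meas]) (intro borel_measurable_continuous_onI continuous_intros)

lemma has_int_orthonormal:
  assumes "i \<in> {1..N}" "j \<in> {1..N}"
  shows "has_int (\<lambda>y. \<phi> i y * cnj (\<phi> j y)) (if i = j then 1 else 0)"
proof -
  obtain b c where b: "\<And>u. u \<in> \<Lambda> \<Longrightarrow> norm (\<phi> i u) \<le> b" and c: "\<And>u. u \<in> \<Lambda> \<Longrightarrow> norm (\<phi> j u) \<le> c"
    using bounded[of i] bounded[of j] by blast
  have "norm (\<phi> i u * cnj (\<phi> j u)) \<le> b * c" if "u \<in> \<Lambda>" for u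
    using b[OF that] c[OF that] by (simp add: norm_mult mult_mono' norm_ge_zero)
  then have "integrable M (\<lambda>y. indicator \<Lambda> y *\<^sub>R (\<phi> i y * cnj (\<phi> j y)))"
    using \<Lambda> by (intro integrableI_bounded_set_indicator[where B = "b * c"])
      (auto intro!: borel_measurable_times meas meas_cnj)
  then show ?thesis
    using orthonormal[OF assms] by (simp add: has_bochner_integral_iff set_lebesgue_integral_def)
qed

lemma has_int_diagonal: "has_int (\<lambda>y. K y y) (of_nat N)"
proof -
  have "has_int (\<lambda>y. \<Sum>i\<in>{1..N}. \<phi> i y * cnj (\<phi> i y)) (\<Sum>i\<in>{1..N}. if i = i then 1 else 0)"
    by (intro has_int_sum has_int_orthonormal)
  then show ?thesis by (simp add: K_def)
qed

text \<open>\<open>K\<close> is the kernel of the orthogonal projection onto the span of the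
  functions, and a projection is idempotent.\<close>

lemma has_int_reproducing: "has_int (\<lambda>y. K u y * K y w) (K u w)"
proof -
  have "has_int (\<lambda>y. \<Sum>i\<in>{1..N}. \<Sum>j\<in>{1..N}. (\<phi> i u * cnj (\<phi> j w)) * (\<phi> j y * cnj (\<phi> i y)))
          (\<Sum>i\<in>{1..N}. \<Sum>j\<in>{1..N}. (\<phi> i u * cnj (\<phi> j w)) * (if j = i then 1 else 0))"
    by (intro has_int_sum has_int_cmult has_int_orthonormal)
  also have "(\<Sum>i\<in>{1..N}. \<Sum>j\<in>{1..N}. (\<phi> i u * cnj (\<phi> j w)) * (if j = i then 1 else 0)) = K u w"
  proof -
    have "(\<Sum>j\<in>{1..N}. (\<phi> i u * cnj (\<phi> j w)) * (if j = i then 1 else 0)) = \<phi> i u * cnj (\<phi> i w)" if "i \<in> {1..N}" for i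
    proof -
      have "(\<Sum>j\<in>{1..N}. (\<phi> i u * cnj (\<phi> j w)) * (if j = i then 1 else 0)) = (\<Sum>j\<in>{1..N}. if j = i then \<phi> i u * cnj (\<phi> i w) else 0)"
        by (rule sum.cong) auto
      then show ?thesis using that by simp
    qed
    then show ?thesis by (simp add: K_def)
  qed
  also have "(\<lambda>y. \<Sum>i\<in>{1..N}. \<Sum>j\<in>{1..N}. (\<phi> i u * cnj (\<phi> j w)) * (\<phi> j y * cnj (\<phi> i y))) = (\<lambda>y. K u y * K y w)"
    unfolding K_def sum_product by (simp add: mult_ac)
  finally show ?thesis .
qed

text \<open>Every permutation of m + 1 points arises from a permutation q of the first m by
  inserting the new point y. As a fixed point it contributes the trace N; spliced into a cycle in
  front of b it reproduces the term of q with the opposite sign, once for each of the m choices of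
  b. Hence the factor N - m.\<close>

lemma has_int_detn:
  "has_int (\<lambda>y. detn (Suc m) (\<lambda>j k. K ((x(Suc m := y)) j) ((x(Suc m := y)) k)))
     ((of_nat N - of_nat m) * detn m (\<lambda>j k. K (x j) (x k)))"
proof -
  let ?S = "{1..m}" and ?a = "Suc m"
  let ?X = "\<lambda>y. x(?a := y)"
  have ins: "{1..Suc m} = insert ?a ?S" and a: "?a \<notin> ?S" by auto
  define G where "G b q y = of_int (sign (Transposition.transpose ?a b \<circ> q)) *
    (\<Prod>i\<in>insert ?a ?S. K (?X y i) (?X y ((Transposition.transpose ?a b \<circ> q) i)))" for b q y
  define P where "P q = of_int (sign q) * (\<Prod>i\<in>?S. K (x i) (x (q i)))" for q
  have expand: "detn (Suc m) (\<lambda>j k. K (?X y j) (?X y k)) = (\<Sum>b\<in>insert ?a ?S. \<Sum>q | q permutes ?S. G b q y)" for y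
    unfolding detn_def ins G_def by (rule sum_over_permutations_insert[OF _ a]) simp
  have diag: "has_int (G ?a q) (of_nat N * P q)" if q: "q permutes ?S" for q
  proof -
    have qa: "q ?a = ?a" using q a by (simp add: permutes_not_in)
    have "K (?X y i) (?X y (q i)) = K (x i) (x (q i))" if "i \<in> ?S" for i y
      using that permutes_in_image[OF q, of i] a by auto
    then have "G ?a q y = P q * K y y" for y
      using a qa by (simp add: G_def P_def)
    then have "G ?a q = (\<lambda>y. P q * K y y)" by (rule ext)
    then show ?thesis using has_int_cmult[OF has_int_diagonal, of "P q"] by (simp add: mult.commute)
  qed
  have off: "has_int (G b q) (- P q)" if q: "q permutes ?S" and b: "b \<in> ?S" for b q
  proof -
    \<comment> \<open>The composed permutation sends c to the new point and the new point to b, so y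
      occurs exactly in the factors K(x c, y) and K(y, x b).\<close>
    obtain c where qc: "q c = b" using surjD[OF permutes_surj[OF q], of b] by auto
    have c: "c \<in> ?S" using permutes_in_image[OF q, of c] qc b by simp
    have qa: "q ?a = ?a" using q a by (simp add: permutes_not_in)
    have ab: "?a \<noteq> b" using a b by auto
    have sgn: "sign (Transposition.transpose ?a b \<circ> q) = - sign q"
    proof -
      have "permutation q" using q permutation_permutes finite_atLeastAtMost by blast
      then show ?thesis using ab by (simp add: sign_compose permutation_swap_id sign_swap_id)
    qed
    have oth: "K (?X y i) (?X y ((Transposition.transpose ?a b \<circ> q) i)) = K (x i) (x (q i))" if i: "i \<in> ?S - {c}" for i y
    proof -
      have "q i \<noteq> b" using i qc permutes_inj[OF q] by (auto simp: inj_def)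
      moreover have "q i \<in> ?S" using i permutes_in_image[OF q, of i] by simp
      ultimately show ?thesis using a i by (auto simp: Transposition.transpose_def)
    qed
    have "(\<Prod>i\<in>insert ?a ?S. K (?X y i) (?X y ((Transposition.transpose ?a b \<circ> q) i)))
        = (K (x c) y * K y (x b)) * (\<Prod>i\<in>?S - {c}. K (x i) (x (q i)))" for y
    proof -
      have "(\<Prod>i\<in>?S. K (?X y i) (?X y ((Transposition.transpose ?a b \<circ> q) i)))
          = K (?X y c) (?X y ((Transposition.transpose ?a b \<circ> q) c)) * (\<Prod>i\<in>?S - {c}. K (?X y i) (?X y ((Transposition.transpose ?a b \<circ> q) i)))"
        by (rule prod.remove[OF _ c]) simp
      also have "(\<Prod>i\<in>?S - {c}. K (?X y i) (?X y ((Transposition.transpose ?a b \<circ> q) i))) = (\<Prod>i\<in>?S - {c}. K (x i) (x (q i)))"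
        by (rule prod.cong[OF refl oth])
      also have "K (?X y c) (?X y ((Transposition.transpose ?a b \<circ> q) c)) = K (x c) y"
        using c a qc by auto
      finally have "(\<Prod>i\<in>?S. K (?X y i) (?X y ((Transposition.transpose ?a b \<circ> q) i)))
          = K (x c) y * (\<Prod>i\<in>?S - {c}. K (x i) (x (q i)))" .
      then show ?thesis using a qa ab by (simp add: mult_ac)
    qed
    then have "G b q = (\<lambda>y. (- of_int (sign q) * (\<Prod>i\<in>?S - {c}. K (x i) (x (q i)))) * (K (x c) y * K y (x b)))"
      unfolding G_def sgn by (simp add: fun_eq_iff)
    moreover have "- P q = (- of_int (sign q) * (\<Prod>i\<in>?S - {c}. K (x i) (x (q i)))) * K (x c) (x b)"
      using c qc unfolding P_def by (subst prod.remove[OF _ c]) auto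
    ultimately show ?thesis by (simp only: has_int_cmult[OF has_int_reproducing])
  qed
  have "has_int (\<lambda>y. \<Sum>b\<in>insert ?a ?S. \<Sum>q | q permutes ?S. G b q y)
      (\<Sum>b\<in>insert ?a ?S. \<Sum>q | q permutes ?S. (if b = ?a then of_nat N * P q else - P q))"
    by (intro has_int_sum) (use diag off in auto)
  also have "(\<Sum>b\<in>insert ?a ?S. \<Sum>q | q permutes ?S. (if b = ?a then of_nat N * P q else - P q))
      = of_nat N * (\<Sum>q | q permutes ?S. P q) + (\<Sum>b\<in>?S. \<Sum>q | q permutes ?S. - P q)"
    using a by (subst sum.insert) (auto simp: sum_distrib_left intro!: sum.cong)
  also have "\<dots> = (of_nat N - of_nat m) * detn m (\<lambda>j k. K (x j) (x k))"
    by (simp add: detn_def P_def sum_negf algebra_simps)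
  finally show ?thesis unfolding expand .
qed

end

lemma norm_detn_le:
  assumes "\<And>i j. i \<in> {1..n} \<Longrightarrow> j \<in> {1..n} \<Longrightarrow> norm (M i j) \<le> b"
  shows "norm (detn n M) \<le> of_nat (card {p. p permutes {1..n}}) * b ^ n"
  unfolding detn_def
proof (rule order_trans[OF norm_sum sum_bounded_above])
  fix p assume "p \<in> {p. p permutes {1..n}}"
  then have p: "p permutes {1..n}" by simp
  have "norm (\<Prod>i\<in>{1..n}. M i (p i)) \<le> (\<Prod>i\<in>{1..n}. b)"
    unfolding prod_norm[symmetric]
  proof (rule prod_mono)
    fix i assume "i \<in> {1..n}"
    then show "0 \<le> norm (M i (p i)) \<and> norm (M i (p i)) \<le> b"
      using assms[of i "p i"] permutes_in_image[OF p, of i] by simp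
  qed
  moreover have "norm (of_int (sign p) :: complex) = 1"
    by (simp add: sign_def)
  ultimately show "norm (of_int (sign p) * (\<Prod>i\<in>{1..n}. M i (p i))) \<le> b ^ n"
    by (simp add: norm_mult)
qed

context orthonormal_system
begin

lemma detn_K:
  "detn N (\<lambda>j k. K (x j) (x k)) = of_real ((cmod (detn N (\<lambda>k i. \<phi> i (x k))))\<^sup>2)"
proof -
  have "detn N (\<lambda>j k. K (x j) (x k)) = detn N (\<lambda>k i. \<phi> i (x k)) * detn N (\<lambda>i k. cnj (\<phi> i (x k)))"
    unfolding K_def by (rule detn_mult)
  also have "detn N (\<lambda>i k. cnj (\<phi> i (x k))) = cnj (detn N (\<lambda>k i. \<phi> i (x k)))"
    by (simp only: detn_cnj detn_transpose[of N "\<lambda>i k. \<phi> i (x k)"])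
  finally show ?thesis by (simp only: complex_norm_square)
qed

definition patch :: "nat \<Rightarrow> (nat \<Rightarrow> 'a) \<Rightarrow> (nat \<Rightarrow> 'a) \<Rightarrow> nat \<Rightarrow> 'a" where
  "patch n z w j = (if j \<le> n then z j else w j)"

lemma integrable_detn_patch:
  assumes "n \<le> m"
  shows "integrable (PiM {n+1..m} (\<lambda>_. M)) (\<lambda>w. indicator (PiE {n+1..m} (\<lambda>_. \<Lambda>)) w *\<^sub>R
           detn m (\<lambda>j k. K (patch n z w j) (patch n z w k)))"
proof -
  interpret product_sigma_finite "\<lambda>_::nat. M"
    by (simp add: product_sigma_finite_def sigma_finite)
  let ?I = "{n+1..m}"
  obtain b where b: "\<And>i u. u \<in> \<Lambda> \<Longrightarrow> norm (\<phi> i u) \<le> b i"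
    using bounded by metis
  \<comment> \<open>The prescribed points may lie outside \<Lambda>, so their values enter the bound
    in addition to the bounds on \<Lambda>.\<close>
  define c where "c = (\<Sum>i\<in>{1..N}. \<bar>b i\<bar> + (\<Sum>j\<in>{1..n}. norm (\<phi> i (z j))))"
  have c: "norm (\<phi> i u) \<le> c" if i: "i \<in> {1..N}" and u: "u \<in> \<Lambda> \<union> z ` {1..n}" for i u
  proof -
    have nn: "0 \<le> (\<Sum>j\<in>{1..n}. norm (\<phi> i (z j)))" for i by (intro sum_nonneg) simp
    have "norm (\<phi> i u) \<le> \<bar>b i\<bar> + (\<Sum>j\<in>{1..n}. norm (\<phi> i (z j)))"
    proof (cases "u \<in> \<Lambda>")
      case True
      then show ?thesis using b[of u i] nn[of i] by simp
    next
      case False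
      then obtain j where j: "j \<in> {1..n}" "u = z j" using u by auto
      have "norm (\<phi> i (z j)) \<le> (\<Sum>j\<in>{1..n}. norm (\<phi> i (z j)))"
        using j by (intro member_le_sum) auto
      then show ?thesis using j by simp
    qed
    also have "\<dots> \<le> c"
      unfolding c_def using i nn by (intro member_le_sum) auto
    finally show ?thesis .
  qed
  have Kb: "norm (K u w) \<le> of_nat N * (c * c)" if "u \<in> \<Lambda> \<union> z ` {1..n}" "w \<in> \<Lambda> \<union> z ` {1..n}" for u w
  proof -
    have "norm (K u w) \<le> (\<Sum>i\<in>{1..N}. c * c)"
      unfolding K_def
    proof (rule order_trans[OF norm_sum sum_mono])
      fix i assume i: "i \<in> {1..N}"
      show "norm (\<phi> i u * cnj (\<phi> i w)) \<le> c * c"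
        using mult_mono'[OF c[OF i that(1)] c[OF i that(2)]] by (simp add: norm_mult)
    qed
    then show ?thesis by simp
  qed
  have pin: "patch n z w j \<in> \<Lambda> \<union> z ` {1..n}" if "w \<in> PiE ?I (\<lambda>_. \<Lambda>)" "j \<in> {1..m}" for w j
  proof (cases "j \<le> n")
    case True then show ?thesis using that by (auto simp: patch_def)
  next
    case False
    then have "w j \<in> \<Lambda>" using that by (intro PiE_mem[OF that(1)]) auto
    then show ?thesis using False by (simp add: patch_def)
  qed
  have \<phi>m: "(\<lambda>w. \<phi> i (patch n z w j)) \<in> borel_measurable (PiM ?I (\<lambda>_. M))" if "j \<in> {1..m}" for i j
  proof (cases "j \<le> n")
    case False
    then have "j \<in> ?I" using that by auto
    from measurable_compose[OF measurable_component_singleton[OF this] meas]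
    show ?thesis using False by (simp add: patch_def)
  qed (simp add: patch_def)
  have cm: "(\<lambda>w. cnj (\<phi> i (patch n z w j))) \<in> borel_measurable (PiM ?I (\<lambda>_. M))" if "j \<in> {1..m}" for i j
    by (rule measurable_compose[OF \<phi>m[OF that]]) (intro borel_measurable_continuous_onI continuous_intros)
  have Km: "(\<lambda>w. K (patch n z w j) (patch n z w k)) \<in> borel_measurable (PiM ?I (\<lambda>_. M))" if "j \<in> {1..m}" "k \<in> {1..m}" for j k
    unfolding K_def using that by (intro borel_measurable_sum borel_measurable_times \<phi>m cm)
  have dm: "(\<lambda>w. detn m (\<lambda>j k. K (patch n z w j) (patch n z w k))) \<in> borel_measurable (PiM ?I (\<lambda>_. M))"
    unfolding detn_def
  proof (intro borel_measurable_sum borel_measurable_times borel_measurable_prod Km)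
    fix p i assume "p \<in> {p. p permutes {1..m}}" "i \<in> {1..m}"
    then show "p i \<in> {1..m}" using permutes_in_image[of p "{1..m}" i] by simp
  qed simp_all
  show ?thesis
  proof (rule integrableI_bounded_set_indicator[OF _ dm])
    show "PiE ?I (\<lambda>_. \<Lambda>) \<in> sets (PiM ?I (\<lambda>_. M))"
      by (rule sets_PiM_I_finite) (simp_all add: \<Lambda>)
    show "emeasure (PiM ?I (\<lambda>_. M)) (PiE ?I (\<lambda>_. \<Lambda>)) < \<infinity>"
      using \<Lambda> by (subst emeasure_PiM) (auto simp: power_less_top_ennreal)
    show "AE w in PiM ?I (\<lambda>_. M). w \<in> PiE ?I (\<lambda>_. \<Lambda>) \<longrightarrow>
        norm (detn m (\<lambda>j k. K (patch n z w j) (patch n z w k)))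
        \<le> of_nat (card {p. p permutes {1..m}}) * (of_nat N * (c * c)) ^ m"
    proof (rule AE_I2, rule impI, rule norm_detn_le)
      fix w i j assume "w \<in> PiE ?I (\<lambda>_. \<Lambda>)" "i \<in> {1..m}" "j \<in> {1..m}"
      then show "norm (K (patch n z w i) (patch n z w j)) \<le> of_nat N * (c * c)"
        by (intro Kb pin)
    qed
  qed
qed

text \<open>Induction on \<open>m\<close>: the variable with index m + 1 is integrated out by
  \<open>has_int_detn\<close> at the cost of N - m. The factorial stands as a multiplier on the left
  so that no quotient arises in the induction.\<close>

lemma integral_detn_patch:
  assumes "n \<le> m" and "m \<le> N"
  shows "(LINT w:PiE {n+1..m} (\<lambda>_. \<Lambda>)|PiM {n+1..m} (\<lambda>_. M).
            detn m (\<lambda>j k. K (patch n z w j) (patch n z w k))) * fact (N - m)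
         = fact (N - n) * detn n (\<lambda>j k. K (z j) (z k))"
  using assms
proof (induction m rule: dec_induct)
  case base
  have "detn n (\<lambda>j k. K (patch n z w j) (patch n z w k)) = detn n (\<lambda>j k. K (z j) (z k))" for w
    by (rule detn_cong) (simp add: patch_def)
  then show ?case
    by (simp add: set_lebesgue_integral_def PiM_empty lebesgue_integral_count_space_finite)
next
  case (step m)
  interpret product_sigma_finite "\<lambda>_::nat. M"
    by (simp add: product_sigma_finite_def sigma_finite)
  let ?I = "{n+1..m}" and ?a = "Suc m"
  have ins: "{n+1..?a} = insert ?a ?I" using step.hyps by auto
  let ?d = "\<lambda>m w. detn m (\<lambda>j k. K (patch n z w j) (patch n z w k))"
  let ?f = "\<lambda>w. indicator (PiE (insert ?a ?I) (\<lambda>_. \<Lambda>)) w *\<^sub>R ?d ?a w"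
  have int: "integrable (PiM (insert ?a ?I) (\<lambda>_. M)) ?f"
    using integrable_detn_patch[of n ?a z] step.hyps unfolding ins by simp
  have "(LINT w:PiE {n+1..?a} (\<lambda>_. \<Lambda>)|PiM {n+1..?a} (\<lambda>_. M). ?d ?a w)
      = (\<integral>x. (\<integral>y. ?f (x(?a := y)) \<partial>M) \<partial>PiM ?I (\<lambda>_. M))"
    unfolding ins set_lebesgue_integral_def
    by (rule product_integral_insert[OF _ _ int]) simp_all
  also have "\<dots> = (\<integral>x. (of_nat N - of_nat m) * (indicator (PiE ?I (\<lambda>_. \<Lambda>)) x *\<^sub>R ?d m x) \<partial>PiM ?I (\<lambda>_. M))"
  proof (rule Bochner_Integration.integral_cong[OF refl])
    fix x assume "x \<in> space (PiM ?I (\<lambda>_. M))"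
    then have ext: "x \<in> extensional ?I" by (simp add: space_PiM PiE_def)
    have "?f (x(?a := y)) = indicator (PiE ?I (\<lambda>_. \<Lambda>)) x *\<^sub>R
        (indicator \<Lambda> y *\<^sub>R detn ?a (\<lambda>j k. K (((patch n z x)(?a := y)) j) (((patch n z x)(?a := y)) k)))" for y
    proof -
      have "patch n z (x(?a := y)) = (patch n z x)(?a := y)"
        using step.hyps by (auto simp: patch_def fun_eq_iff)
      moreover have "x(?a := y) \<in> PiE (insert ?a ?I) (\<lambda>_. \<Lambda>) \<longleftrightarrow> x \<in> PiE ?I (\<lambda>_. \<Lambda>) \<and> y \<in> \<Lambda>"
      proof
        assume *: "x(?a := y) \<in> PiE (insert ?a ?I) (\<lambda>_. \<Lambda>)"
        have "x i \<in> \<Lambda>" if "i \<in> ?I" for i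
          using PiE_mem[OF *, of i] that by (auto split: if_splits)
        moreover have "y \<in> \<Lambda>" using PiE_mem[OF *, of ?a] by simp
        ultimately show "x \<in> PiE ?I (\<lambda>_. \<Lambda>) \<and> y \<in> \<Lambda>"
          using ext by (auto simp: PiE_def)
      next
        assume "x \<in> PiE ?I (\<lambda>_. \<Lambda>) \<and> y \<in> \<Lambda>"
        then show "x(?a := y) \<in> PiE (insert ?a ?I) (\<lambda>_. \<Lambda>)"
          by (intro PiE_fun_upd) simp_all
      qed
      ultimately show ?thesis by (simp add: indicator_def)
    qed
    then have "(\<integral>y. ?f (x(?a := y)) \<partial>M) = indicator (PiE ?I (\<lambda>_. \<Lambda>)) x *\<^sub>R
        ((of_nat N - of_nat m) * detn m (\<lambda>j k. K (patch n z x j) (patch n z x k)))"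
      by (simp only: has_bochner_integral_integral_eq[OF
            has_bochner_integral_scaleR_right[OF has_int_detn[of m "patch n z x"]]])
    then show "(\<integral>y. ?f (x(?a := y)) \<partial>M) = (of_nat N - of_nat m) * (indicator (PiE ?I (\<lambda>_. \<Lambda>)) x *\<^sub>R ?d m x)"
      by simp
  qed
  also have "\<dots> = (of_nat N - of_nat m) * (LINT w:PiE ?I (\<lambda>_. \<Lambda>)|PiM ?I (\<lambda>_. M). ?d m w)"
    by (simp only: set_lebesgue_integral_def integral_mult_right_zero)
  finally have eq: "(LINT w:PiE {n+1..?a} (\<lambda>_. \<Lambda>)|PiM {n+1..?a} (\<lambda>_. M). ?d ?a w)
    = (of_nat N - of_nat m) * (LINT w:PiE ?I (\<lambda>_. \<Lambda>)|PiM ?I (\<lambda>_. M). ?d m w)" .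
  have "N - m = Suc (N - ?a)" using step.prems by simp
  then have "(fact (N - m) :: complex) = of_nat (N - m) * fact (N - ?a)" by simp
  then have fct: "(fact (N - m) :: complex) = (of_nat N - of_nat m) * fact (N - ?a)"
    using step.prems by (simp add: of_nat_diff)
  have "(LINT w:PiE ?I (\<lambda>_. \<Lambda>)|PiM ?I (\<lambda>_. M). ?d m w) * fact (N - m) = fact (N - n) * detn n (\<lambda>j k. K (z j) (z k))"
    using step by simp
  then show ?case unfolding eq fct by (simp only: mult_ac)
qed

text \<open>The integral of |det|^2 over all variables is N!, so the determinant cannot vanish
  identically. Linear independence thus takes the form required for interpolation, a set of good
  nodes.\<close>

lemma ex_detn_nonzero:
  obtains x where "detn N (\<lambda>k i. \<phi> i (x k)) \<noteq> 0"
proof (rule ccontr)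
  assume "\<not> thesis"
  then have "detn N (\<lambda>k i. \<phi> i (x k)) = 0" for x using that by blast
  then have "detn N (\<lambda>j k. K (x j) (x k)) = 0" for x by (simp add: detn_K)
  then have "(LINT w:PiE {0+1..N} (\<lambda>_. \<Lambda>)|PiM {0+1..N} (\<lambda>_. M). detn N (\<lambda>j k. K (patch 0 z w j) (patch 0 z w k))) = 0" for z
    by (simp add: set_lebesgue_integral_def)
  with integral_detn_patch[of 0 N] have "fact N * detn 0 (\<lambda>j k. K (undefined j) (undefined k)) = (0 :: complex)"
    by simp
  then show False by (simp add: detn_def)
qed

end

section \<open>Macdonald denominators\<close>

text \<open>The holomorphic part of \<open>Qfun\<close>: the extra theta factor of type A is
  included, so that all types can be treated alike.\<close>

definition macdonald :: "rs \<Rightarrow> nat \<Rightarrow> (nat \<Rightarrow> complex) \<Rightarrow> complex \<Rightarrow> complex" where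
  "macdonald R N \<xi> t = (if R = A then theta_s N (\<Sum>k\<in>{1..N}. \<xi> k) t else 1) * Wden R N \<xi> t"

text \<open>An adjacent transposition keeps the order of every pair j < k other than (i, i + 1). The
  remaining factors are merely permuted, and exactly one factor changes sign.\<close>

lemma prod_pairs_swap_adjacent:
  fixes f :: "'a \<Rightarrow> 'a \<Rightarrow> complex"
  assumes anti: "\<And>x y. f y x = - f x y" and i: "1 \<le> i" "Suc i \<le> N"
  shows "(\<Prod>j\<in>{1..N}. \<Prod>k\<in>{j<..N}. f ((\<xi> \<circ> Transposition.transpose i (Suc i)) j) ((\<xi> \<circ> Transposition.transpose i (Suc i)) k))
       = - (\<Prod>j\<in>{1..N}. \<Prod>k\<in>{j<..N}. f (\<xi> j) (\<xi> k))"
proof -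
  let ?t = "Transposition.transpose i (Suc i)"
  let ?S = "Sigma {1..N} (\<lambda>j. {j<..N})"
  let ?S' = "?S - {(i, Suc i)}"
  have mem: "(i, Suc i) \<in> ?S" using i by auto
  have split: "(\<Prod>j\<in>{1..N}. \<Prod>k\<in>{j<..N}. g j k) = g i (Suc i) * (\<Prod>(j, k)\<in>?S'. g j k)" for g :: "nat \<Rightarrow> nat \<Rightarrow> complex"
  proof -
    have "(\<Prod>j\<in>{1..N}. \<Prod>k\<in>{j<..N}. g j k) = (\<Prod>(j, k)\<in>?S. g j k)"
      by (rule prod.Sigma) simp_all
    also have "\<dots> = (case (i, Suc i) of (j, k) \<Rightarrow> g j k) * (\<Prod>(j, k)\<in>?S'. g j k)"
      by (rule prod.remove[OF _ mem]) simp
    finally show ?thesis by simp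
  qed
  have "(\<Prod>(j, k)\<in>?S'. f ((\<xi> \<circ> ?t) j) ((\<xi> \<circ> ?t) k)) = (\<Prod>(j, k)\<in>?S'. f (\<xi> j) (\<xi> k))"
  proof (rule prod.reindex_bij_witness[of _ "\<lambda>(j, k). (?t j, ?t k)" "\<lambda>(j, k). (?t j, ?t k)"])
    have "?t permutes {1..N}" using i by (intro permutes_swap_id) auto
    note in_image = permutes_in_image[OF this]
    have lt: "?t j < ?t k" if "j < k" "(j, k) \<noteq> (i, Suc i)" for j k
      using that unfolding Transposition.transpose_def by (cases "j = i"; cases "j = Suc i"; cases "k = i"; cases "k = Suc i"; simp)
    have ne: "(?t j, ?t k) \<noteq> (i, Suc i)" if "j < k" for j k
    proof
      assume "(?t j, ?t k) = (i, Suc i)"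
      then have "?t (?t j) = Suc i" "?t (?t k) = i" by simp_all
      then show False using that by simp
    qed
    have S': "(?t j, ?t k) \<in> ?S'" if "(j, k) \<in> ?S'" for j k
    proof -
      have jk: "j \<in> {1..N}" "k \<in> {1..N}" "j < k" "(j, k) \<noteq> (i, Suc i)" using that by auto
      have "?t j \<in> {1..N}" "?t k \<in> {1..N}" using jk(1,2) by (simp_all only: in_image)
      with lt[OF jk(3,4)] ne[OF jk(3)] show ?thesis by simp
    qed
    show "(case a of (j, k) \<Rightarrow> (?t j, ?t k)) \<in> ?S'" if "a \<in> ?S'" for a
      using S'[of "fst a" "snd a"] that by (simp only: case_prod_unfold prod.collapse)
    then show "(case a of (j, k) \<Rightarrow> (?t j, ?t k)) \<in> ?S'" if "a \<in> ?S'" for a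
      using that .
  qed (simp_all add: case_prod_unfold)
  moreover have "f ((\<xi> \<circ> ?t) i) ((\<xi> \<circ> ?t) (Suc i)) = - f (\<xi> i) (\<xi> (Suc i))"
    using anti[where y = "\<xi> (Suc i)" and x = "\<xi> i"] by simp
  ultimately show ?thesis by (simp only: split) simp
qed

text \<open>Conjugating with an adjacent transposition lengthens the distance of a transposition by
  one and adds two sign changes. So all transpositions act by - 1, and every permutation is a
  product of them.\<close>

lemma alternating_if_adjacent:
  fixes F :: "(nat \<Rightarrow> 'a) \<Rightarrow> complex"
  assumes adj: "\<And>f i. 1 \<le> i \<Longrightarrow> Suc i \<le> n \<Longrightarrow> F (f \<circ> Transposition.transpose i (Suc i)) = - F f"
    and p: "p permutes {1..n}"
  shows "F (f \<circ> p) = of_int (sign p) * F f"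
proof -
  have lt: "F (f \<circ> Transposition.transpose i (i + Suc d)) = - F f" if "1 \<le> i" "i + Suc d \<le> n" for i d f
    using that
  proof (induction d arbitrary: f)
    case 0
    then show ?case using adj[of i f] by (simp only: add_Suc_right add_0_right)
  next
    case (Suc d)
    let ?b = "i + Suc d"
    have eq: "Transposition.transpose i (Suc ?b) = Transposition.transpose ?b (Suc ?b) \<circ> (Transposition.transpose i ?b \<circ> Transposition.transpose ?b (Suc ?b))"
    proof
      fix x
      show "Transposition.transpose i (Suc ?b) x = (Transposition.transpose ?b (Suc ?b) \<circ> (Transposition.transpose i ?b \<circ> Transposition.transpose ?b (Suc ?b))) x"
        unfolding Transposition.transpose_def o_def by (cases "x = i"; cases "x = ?b"; cases "x = Suc ?b"; simp)
    qed
    have "F (f \<circ> Transposition.transpose i (Suc ?b)) = F (((f \<circ> Transposition.transpose ?b (Suc ?b)) \<circ> Transposition.transpose i ?b) \<circ> Transposition.transpose ?b (Suc ?b))"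
      unfolding eq by (simp only: o_assoc)
    also have "\<dots> = - F ((f \<circ> Transposition.transpose ?b (Suc ?b)) \<circ> Transposition.transpose i ?b)"
      using Suc.prems by (intro adj) auto
    also have "\<dots> = F (f \<circ> Transposition.transpose ?b (Suc ?b))"
    proof -
      have "F ((f \<circ> Transposition.transpose ?b (Suc ?b)) \<circ> Transposition.transpose i ?b) = - F (f \<circ> Transposition.transpose ?b (Suc ?b))"
        using Suc.prems by (intro Suc.IH) auto
      then show ?thesis by (simp only: minus_minus)
    qed
    also have "\<dots> = - F f" using Suc.prems by (intro adj) auto
    finally show ?case by (simp only: add_Suc_right)
  qed
  have tr: "F (f \<circ> Transposition.transpose i j) = - F f" if ij: "i \<in> {1..n}" "j \<in> {1..n}" "i \<noteq> j" for i j f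
  proof (cases "i < j")
    case True
    then obtain d where d: "j = i + Suc d" using less_iff_Suc_add by auto
    show ?thesis unfolding d by (rule lt) (use ij d in auto)
  next
    case False
    then obtain d where d: "i = j + Suc d" using less_iff_Suc_add[of j i] ij(3) by auto
    show ?thesis unfolding d transpose_commute[of "j + Suc d" j] by (rule lt) (use ij d in auto)
  qed
  show ?thesis
    using p finite_atLeastAtMost
  proof (induction p arbitrary: f rule: permutes_induct)
    case (swap a b p)
    have "permutation p" using swap.hyps permutation_permutes by blast
    then have sgn: "sign (Transposition.transpose a b \<circ> p) = - sign p"
      using swap.hyps by (simp add: sign_compose permutation_swap_id sign_swap_id)
    have "F (f \<circ> (Transposition.transpose a b \<circ> p)) = of_int (sign p) * F (f \<circ> Transposition.transpose a b)"
      using swap.IH[of "f \<circ> Transposition.transpose a b"] by (simp only: o_assoc)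
    also have "\<dots> = - of_int (sign p) * F f" using tr[OF swap.hyps(1-3)] by simp
    finally show ?case by (simp only: sgn of_int_minus)
  qed simp
qed

lemma theta1_minus: "theta1 (- v) t = - theta1 v t"
  unfolding theta_eq_gtheta using gtheta_minus[of "- 1" 1 v t] by simp

lemma theta1_diff_commute: "theta1 (y - x) t = - theta1 (x - y) t"
  using theta1_minus[of "x - y" t] by simp

lemma Pden_swap_adjacent:
  assumes "1 \<le> i" "Suc i \<le> N"
  shows "Pden N (\<xi> \<circ> Transposition.transpose i (Suc i)) t = - Pden N \<xi> t"
proof -
  have "theta1 (x - y) t * theta1 (x + y) t = - (theta1 (y - x) t * theta1 (y + x) t)" for x y
    by (subst theta1_diff_commute[of x y]) (simp add: add.commute[of x y])
  from prod_pairs_swap_adjacent[OF this assms] show ?thesis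
    unfolding Pden_def .
qed

lemma macdonald_swap_adjacent:
  assumes i: "1 \<le> i" "Suc i \<le> N"
  shows "macdonald R N (\<xi> \<circ> Transposition.transpose i (Suc i)) t = - macdonald R N \<xi> t"
proof -
  let ?t = "Transposition.transpose i (Suc i)"
  have perm: "?t permutes {1..N}" using i by (intro permutes_swap_id) auto
  have pr: "(\<Prod>l\<in>{1..N}. f ((\<xi> \<circ> ?t) l)) = (\<Prod>l\<in>{1..N}. f (\<xi> l))" for f :: "complex \<Rightarrow> complex"
    using prod.permute[OF perm, of "\<lambda>l. f (\<xi> l)"] by (simp add: o_def)
  have sm: "(\<Sum>l\<in>{1..N}. (\<xi> \<circ> ?t) l) = (\<Sum>l\<in>{1..N}. \<xi> l)"
    using sum.permute[OF perm, of \<xi>] by (simp add: o_def)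
  have pa: "(\<Prod>j\<in>{1..N}. \<Prod>k\<in>{j<..N}. theta1 ((\<xi> \<circ> ?t) k - (\<xi> \<circ> ?t) j) t) = - (\<Prod>j\<in>{1..N}. \<Prod>k\<in>{j<..N}. theta1 (\<xi> k - \<xi> j) t)"
    by (rule prod_pairs_swap_adjacent[OF _ i, of "\<lambda>x y. theta1 (y - x) t"]) (rule theta1_diff_commute)
  note eqs = sm pa Pden_swap_adjacent[OF i, of \<xi> t] pr[of "\<lambda>v. theta1 v t"] pr[of "\<lambda>v. theta1 (2 * v) (2 * t)"]
      pr[of "\<lambda>v. theta1 (2 * v) t"] pr[of "\<lambda>v. theta1 v (t / 2)"] pr[of "\<lambda>v. theta1 v t * theta0 (2 * v) (2 * t)"]
  show ?thesis
    unfolding macdonald_def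
    by (cases R) (simp_all only: Wden.simps eqs mult_minus_right rs.distinct simp_thms if_True if_False mult_1_left)
qed

lemma macdonald_permutes:
  assumes "p permutes {1..N}"
  shows "macdonald R N (\<xi> \<circ> p) t = of_int (sign p) * macdonald R N \<xi> t"
  by (rule alternating_if_adjacent[where F = "\<lambda>\<xi>. macdonald R N \<xi> t", OF _ assms])
    (rule macdonald_swap_adjacent)

lemma macdonald_cong:
  assumes "\<And>i. i \<in> {1..N} \<Longrightarrow> \<xi> i = \<xi>' i"
  shows "macdonald R N \<xi> t = macdonald R N \<xi>' t"
proof -
  have P: "Pden N \<xi> t = Pden N \<xi>' t"
    unfolding Pden_def using assms by (intro prod.cong refl) auto
  have pr: "(\<Prod>l\<in>{1..N}. f (\<xi> l)) = (\<Prod>l\<in>{1..N}. f (\<xi>' l))" for f :: "complex \<Rightarrow> complex"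
    using assms by (intro prod.cong) auto
  have sm: "(\<Sum>l\<in>{1..N}. \<xi> l) = (\<Sum>l\<in>{1..N}. \<xi>' l)" using assms by (intro sum.cong) auto
  have pa: "(\<Prod>j\<in>{1..N}. \<Prod>k\<in>{j<..N}. theta1 (\<xi> k - \<xi> j) t) = (\<Prod>j\<in>{1..N}. \<Prod>k\<in>{j<..N}. theta1 (\<xi>' k - \<xi>' j) t)"
    using assms by (intro prod.cong refl) auto
  note eqs = sm pa P pr[of "\<lambda>v. theta1 v t"] pr[of "\<lambda>v. theta1 (2 * v) (2 * t)"]
      pr[of "\<lambda>v. theta1 (2 * v) t"] pr[of "\<lambda>v. theta1 v (t / 2)"] pr[of "\<lambda>v. theta1 v t * theta0 (2 * v) (2 * t)"]
  show ?thesis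
    unfolding macdonald_def
    by (cases R) (simp_all only: Wden.simps eqs)
qed

lemma Pden_split_first:
  assumes "N \<ge> 1"
  shows "Pden N \<xi> t = (\<Prod>k\<in>{2..N}. theta1 (\<xi> k - \<xi> 1) t * theta1 (\<xi> k + \<xi> 1) t) *
    (\<Prod>j\<in>{2..N}. \<Prod>k\<in>{j<..N}. theta1 (\<xi> k - \<xi> j) t * theta1 (\<xi> k + \<xi> j) t)"
proof -
  have "{1..N} = insert 1 {2..N}" "{1<..N} = {2..N}" using assms by auto
  then show ?thesis unfolding Pden_def by simp
qed

lemma quasi_theta1:
  assumes "Im t > 0"
  shows "quasi t (- 1) (- 1) 1 0 (\<lambda>v. theta1 v t)"
  unfolding theta_eq_gtheta using quasi_cmult[OF quasi_gtheta[OF assms, of "- 1" 1], of \<i>] by simp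

lemma quasi_theta0:
  assumes "Im t > 0"
  shows "quasi t 1 (- 1) 1 0 (\<lambda>v. theta0 v t)"
  unfolding theta_eq_gtheta using quasi_gtheta[OF assms, of "- 1" 0] by simp

lemma quasi_theta3:
  assumes "Im t > 0"
  shows "quasi t 1 1 1 0 (\<lambda>v. theta3 v t)"
  unfolding theta_eq_gtheta using quasi_gtheta[OF assms, of 1 0] by simp

lemma quasi_theta1_diff:
  assumes "Im t > 0"
  shows "quasi t (- 1) (- 1) 1 (- a) (\<lambda>v. theta1 (a - v) t)"
  using quasi_cmult[OF quasi_shift[OF quasi_theta1[OF assms], of "- a"], of "- 1"]
  by (simp add: theta1_diff_commute[of _ a])

lemma quasi_theta1_sum:
  assumes "Im t > 0"
  shows "quasi t (- 1) (- 1) 1 a (\<lambda>v. theta1 (a + v) t)"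
  using quasi_shift[OF quasi_theta1[OF assms], of a] by (simp add: add.commute)

text \<open>In each pair the translations by \<open>\<xi> k\<close> and \<open>- \<xi> k\<close>
  cancel, and so do the signs, leaving degree 2 for each of the N - 1 other points.\<close>

lemma quasi_Pden:
  assumes t: "Im t > 0" and N: "N \<ge> 1"
  shows "quasi t 1 1 (2 * (int N - 1)) 0 (\<lambda>v. Pden N (\<xi>(1 := v)) t)"
proof -
  have "quasi t (\<Prod>k\<in>{2..N}. 1) (\<Prod>k\<in>{2..N}. 1) (\<Sum>k\<in>{2..N}. 2) (\<Sum>k\<in>{2..N}. 0)
      (\<lambda>v. \<Prod>k\<in>{2..N}. theta1 (\<xi> k - v) t * theta1 (\<xi> k + v) t)"
  proof (rule quasi_prod)
    fix k
    show "quasi t 1 1 2 0 (\<lambda>v. theta1 (\<xi> k - v) t * theta1 (\<xi> k + v) t)"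
      using quasi_mult[OF quasi_theta1_diff[OF t, of "\<xi> k"] quasi_theta1_sum[OF t, of "\<xi> k"]] by simp
  qed
  then have q: "quasi t 1 1 (2 * (int N - 1)) 0 (\<lambda>v. \<Prod>k\<in>{2..N}. theta1 (\<xi> k - v) t * theta1 (\<xi> k + v) t)"
  proof -
    have "(\<Sum>k\<in>{2..N}. 2) = 2 * (int N - 1)" using N by (simp add: of_nat_diff)
    then show ?thesis using \<open>quasi t (\<Prod>k\<in>{2..N}. 1) _ _ _ _\<close> by (simp only: prod.neutral_const sum.neutral_const)
  qed
  have "Pden N (\<xi>(1 := v)) t = (\<Prod>j\<in>{2..N}. \<Prod>k\<in>{j<..N}. theta1 (\<xi> k - \<xi> j) t * theta1 (\<xi> k + \<xi> j) t) *
      (\<Prod>k\<in>{2..N}. theta1 (\<xi> k - v) t * theta1 (\<xi> k + v) t)" for v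
    by (simp add: Pden_split_first[OF N] mult.commute)
  then show ?thesis using quasi_cmult[OF q] by simp
qed

lemma Pden_minus:
  assumes N: "N \<ge> 1"
  shows "Pden N (\<xi>(1 := - v)) t = Pden N (\<xi>(1 := v)) t"
  by (simp add: Pden_split_first[OF N] mult.commute)

text \<open>The parameters s, \<zeta>, p = calN and k = 2 J of the locale theta_frame.\<close>

fun isgn :: "rs \<Rightarrow> complex" where
  "isgn B = - 1" | "isgn Bv = - 1" | "isgn _ = 1"

fun izeta :: "rs \<Rightarrow> complex" where
  "izeta A = 0" | "izeta B = 1" | "izeta Bv = 1" | "izeta D = 1" | "izeta _ = - 1"

fun inum :: "rs \<Rightarrow> nat \<Rightarrow> int" where
  "inum A N = int N" | "inum B N = 2 * int N - 1" | "inum Bv N = 2 * int N" | "inum C N = 2 * (int N + 1)"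
| "inum Cv N = 2 * int N" | "inum BC N = 2 * int N + 1" | "inum D N = 2 * (int N - 1)"

fun idx2 :: "rs \<Rightarrow> nat \<Rightarrow> int" where
  "idx2 A j = 2 * int j - 1" | "idx2 Cv j = 2 * int j - 1"
| "idx2 B j = 2 * (int j - 1)" | "idx2 Bv j = 2 * (int j - 1)" | "idx2 D j = 2 * (int j - 1)"
| "idx2 C j = 2 * int j" | "idx2 BC j = 2 * int j"

lemma calN_eq: "calN R N = of_int (inum R N)"
  by (cases R) simp_all

lemma Jidx_eq: "Jidx R j = of_int (idx2 R j) / 2"
  by (cases R) (simp_all add: field_simps)

text \<open>The degree is that of the single-variable factor plus 2 (N - 1) from the pairs, which is
  \<open>calN\<close> in every type but A.\<close>

lemma quasi_macdonald_first:
  assumes t: "Im t > 0" and N: "N \<ge> 1"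
  shows "quasi t (if even (inum R N + idx2 R 1) then 1 else - 1) (isgn R) (inum R N) 0
           (\<lambda>v. macdonald R N (\<xi>(1 := v)) t)"
proof -
  have t2: "Im (2 * t) > 0" and t3: "Im (t / 2) > 0" using t by simp_all
  have ins: "{1..N} = insert 1 {2..N}" "{1<..N} = {2..N}" using N by auto
  have single: "quasi t \<iota> \<eta> (p + 2 * (int N - 1)) 0 (\<lambda>v. (\<Prod>l\<in>{1..N}. f ((\<xi>(1 := v)) l)) * Pden N (\<xi>(1 := v)) t)"
    if f: "quasi t \<iota> \<eta> p 0 f" for f \<iota> \<eta> p
  proof -
    have "(\<Prod>l\<in>{1..N}. f ((\<xi>(1 := v)) l)) = (\<Prod>l\<in>{2..N}. f (\<xi> l)) * f v" for v
      unfolding ins by (simp add: mult.commute)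
    then show ?thesis
      using quasi_mult[OF quasi_cmult[OF f, of "\<Prod>l\<in>{2..N}. f (\<xi> l)"] quasi_Pden[OF t N, of \<xi>]] by simp
  qed
  show ?thesis
  proof (cases R)
    case A
    let ?S = "\<Sum>k\<in>{2..N}. \<xi> k"
    have S: "(\<Sum>k\<in>{1..N}. (\<xi>(1 := v)) k) = v + ?S" for v
      unfolding ins by simp
    have prodA: "quasi t (\<Prod>k\<in>{2..N}. - 1) (\<Prod>k\<in>{2..N}. - 1) (\<Sum>k\<in>{2..N}. 1) (\<Sum>k\<in>{2..N}. - \<xi> k) (\<lambda>v. \<Prod>k\<in>{2..N}. theta1 (\<xi> k - v) t)"
      by (rule quasi_prod) (rule quasi_theta1_diff[OF t])
    \<comment> \<open>The shift \<open>?S\<close> offsets the translations by - \<xi> k of the N - 1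
      differences, and the choice of theta0 for even N and theta3 for odd N offsets their sign
      (-1)^(N - 1) under the period \<open>t\<close>.\<close>
    have th: "quasi t 1 (if even N then - 1 else 1) 1 ?S (\<lambda>v. theta_s N (v + ?S) t)"
      using quasi_shift[OF quasi_theta0[OF t], of ?S] quasi_shift[OF quasi_theta3[OF t], of ?S]
      by (simp add: theta_s_def)
    have W: "Wden A N (\<xi>(1 := v)) t = (\<Prod>j\<in>{2..N}. \<Prod>k\<in>{j<..N}. theta1 (\<xi> k - \<xi> j) t) * (\<Prod>k\<in>{2..N}. theta1 (\<xi> k - v) t)" for v
      unfolding Wden.simps ins by (simp add: mult.commute ins)
    have m: "macdonald A N (\<xi>(1 := v)) t = (\<Prod>j\<in>{2..N}. \<Prod>k\<in>{j<..N}. theta1 (\<xi> k - \<xi> j) t) * (theta_s N (v + ?S) t * (\<Prod>k\<in>{2..N}. theta1 (\<xi> k - v) t))" for v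
      unfolding macdonald_def W S by simp
    obtain n where n: "N = Suc n" using N by (cases N) auto
    have card: "card {2..N} = n" using n by simp
    have "quasi t (if even (int N + (2 * int 1 - 1)) then 1 else - 1) 1 (int N) 0 (\<lambda>v. theta_s N (v + ?S) t * (\<Prod>k\<in>{2..N}. theta1 (\<xi> k - v) t))"
      using quasi_mult[OF th prodA] unfolding prod_constant sum_constant card by (simp add: n sum_negf split: if_splits)
    from quasi_cmult[OF this] show ?thesis unfolding A m by simp
  next
    case B
    show ?thesis using single[OF quasi_theta1[OF t]] unfolding B macdonald_def by simp
  next
    case Bv
    show ?thesis using single[OF quasi_dilate_both[OF quasi_theta1[OF t2]]] unfolding Bv macdonald_def by simp
  next
    case C
    show ?thesis using single[OF quasi_dilate[OF quasi_theta1[OF t]]] unfolding C macdonald_def by (simp add: algebra_simps)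
  next
    case Cv
    show ?thesis using single[OF quasi_half_period[OF quasi_theta1[OF t3]]] unfolding Cv macdonald_def by simp
  next
    case BC
    have "quasi t (- 1) 1 3 0 (\<lambda>v. theta1 v t * theta0 (2 * v) (2 * t))"
      using quasi_mult[OF quasi_theta1[OF t] quasi_dilate_both[OF quasi_theta0[OF t2]]] by simp
    from single[OF this] show ?thesis
      unfolding BC macdonald_def by (simp add: algebra_simps)
  next
    case D
    show ?thesis using quasi_Pden[OF t N, of \<xi>] unfolding D macdonald_def by simp
  qed
qed

text \<open>\<open>Pden\<close> is even in each variable; in every type except D there is one
  further factor in the first variable, and it is odd.\<close>

lemma macdonald_minus_first:
  assumes N: "N \<ge> 1" and R: "R \<noteq> A"
  shows "macdonald R N (\<xi>(1 := - v)) t = izeta R * isgn R * macdonald R N (\<xi>(1 := v)) t"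
proof -
  have ins: "{1..N} = insert 1 {2..N}" using N by auto
  have single: "(\<Prod>l\<in>{1..N}. f ((\<xi>(1 := - v)) l)) = - (\<Prod>l\<in>{1..N}. f ((\<xi>(1 := v)) l))"
    if "f (- v) = - f v" for f :: "complex \<Rightarrow> complex"
    unfolding ins using that by simp
  have th0: "theta0 (- v) t = theta0 v t" for v t
    by (simp add: theta_eq_gtheta gtheta_minus)
  have fs: "(\<Prod>l\<in>{1..N}. theta1 ((\<xi>(1 := - v)) l) t) = - (\<Prod>l\<in>{1..N}. theta1 ((\<xi>(1 := v)) l) t)"
    "(\<Prod>l\<in>{1..N}. theta1 (2 * (\<xi>(1 := - v)) l) (2 * t)) = - (\<Prod>l\<in>{1..N}. theta1 (2 * (\<xi>(1 := v)) l) (2 * t))"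
    "(\<Prod>l\<in>{1..N}. theta1 (2 * (\<xi>(1 := - v)) l) t) = - (\<Prod>l\<in>{1..N}. theta1 (2 * (\<xi>(1 := v)) l) t)"
    "(\<Prod>l\<in>{1..N}. theta1 ((\<xi>(1 := - v)) l) (t / 2)) = - (\<Prod>l\<in>{1..N}. theta1 ((\<xi>(1 := v)) l) (t / 2))"
    "(\<Prod>l\<in>{1..N}. theta1 ((\<xi>(1 := - v)) l) t * theta0 (2 * (\<xi>(1 := - v)) l) (2 * t))
       = - (\<Prod>l\<in>{1..N}. theta1 ((\<xi>(1 := v)) l) t * theta0 (2 * (\<xi>(1 := v)) l) (2 * t))"
    by (rule single; simp only: mult_minus_right theta1_minus th0 mult_minus_left)+
  show ?thesis
    using R unfolding macdonald_def
    by (cases R) (simp_all only: Wden.simps fs Pden_minus[OF N, of \<xi> v t] isgn.simps izeta.simps rs.distinct simp_thms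
        if_False mult_1_left mult_1_right mult_minus_left mult_minus_right minus_minus)
qed

lemma countable_zeros_multiples:
  fixes f :: "complex \<Rightarrow> complex"
  assumes "countable {v. f v = 0}"
  shows "countable {u. \<exists>n\<ge>1. f (of_nat n * u) = 0}"
proof -
  have "countable {u. f (of_nat n * u) = 0}" if "n \<ge> 1" for n
  proof -
    have "{u. f (of_nat n * u) = 0} \<subseteq> (\<lambda>v. v / of_nat n) ` {v. f v = 0}"
    proof
      fix u assume "u \<in> {u. f (of_nat n * u) = 0}"
      then have "of_nat n * u \<in> {v. f v = 0}" by simp
      moreover have "u = of_nat n * u / of_nat n" using that by simp
      ultimately show "u \<in> (\<lambda>v. v / of_nat n) ` {v. f v = 0}" by blast
    qed
    then show ?thesis using assms countable_subset by blast
  qed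
  then have "countable (\<Union>n\<in>{1..}. {u. f (of_nat n * u) = 0})"
    by (intro countable_UN) auto
  moreover have "(\<Union>n\<in>{1..}. {u. f (of_nat n * u) = 0}) = {u. \<exists>n\<ge>1. f (of_nat n * u) = 0}" by auto
  ultimately show ?thesis by simp
qed

text \<open>On an arithmetic progression through 0 all differences, sums, doubles and the total are
  positive integer multiples of \<open>u\<close>. Each multiple and each theta function excludes
  countably many \<open>u\<close>.\<close>

lemma macdonald_nonzero:
  assumes t: "Im t > 0" and N: "N \<ge> 1"
  obtains \<xi> where "macdonald R N \<xi> t \<noteq> 0"
proof -
  have t2: "Im (2 * t) > 0" and t3: "Im (t / 2) > 0" using t by simp_all
  have c1: "countable {v. theta1 v t = 0}" if "Im t > 0" for t
    using gtheta_countable_zeros[OF that, of "- 1" 1] by (simp add: theta_eq_gtheta)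
  have c0: "countable {v. theta0 v t = 0}" if "Im t > 0" for t
    using gtheta_countable_zeros[OF that, of "- 1" 0] by (simp add: theta_eq_gtheta)
  have c3: "countable {v. theta3 v t = 0}" if "Im t > 0" for t
    using gtheta_countable_zeros[OF that, of 1 0] by (simp add: theta_eq_gtheta)
  define Z where "Z = {u. \<exists>n\<ge>1. theta1 (of_nat n * u) t = 0} \<union> {u. \<exists>n\<ge>1. theta1 (of_nat n * u) (2 * t) = 0}
     \<union> {u. \<exists>n\<ge>1. theta1 (of_nat n * u) (t / 2) = 0} \<union> {u. \<exists>n\<ge>1. theta0 (of_nat n * u) (2 * t) = 0}
     \<union> {u. \<exists>n\<ge>1. theta0 (of_nat n * u) t = 0} \<union> {u. \<exists>n\<ge>1. theta3 (of_nat n * u) t = 0}"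
  have "countable Z"
    unfolding Z_def
    by (intro countable_Un; rule countable_zeros_multiples; intro c0 c1 c3 t t2 t3)
  then have "Z \<noteq> UNIV" using uncountable_UNIV_complex by auto
  then obtain u where u: "u \<notin> Z" by blast
  have nz: "theta1 (of_nat n * u) t \<noteq> 0" "theta1 (of_nat n * u) (2 * t) \<noteq> 0" "theta1 (of_nat n * u) (t / 2) \<noteq> 0"
    "theta0 (of_nat n * u) (2 * t) \<noteq> 0" "theta0 (of_nat n * u) t \<noteq> 0" "theta3 (of_nat n * u) t \<noteq> 0" if "n \<ge> 1" for n
    using u that unfolding Z_def by simp_all
  define \<xi> where "\<xi> l = of_nat l * u" for l
  have d: "\<xi> k - \<xi> j = of_nat (k - j) * u" if "j < k" for j k
    using that by (simp add: \<xi>_def of_nat_diff left_diff_distrib)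
  have s: "\<xi> k + \<xi> j = of_nat (k + j) * u" for j k
    by (simp add: \<xi>_def distrib_right)
  have m2: "2 * \<xi> l = of_nat (2 * l) * u" for l by (simp add: \<xi>_def)
  have dn: "theta1 (\<xi> k - \<xi> j) t \<noteq> 0" if "j < k" for j k
    unfolding d[OF that] using that by (intro nz) simp
  have sn: "theta1 (\<xi> k + \<xi> j) t \<noteq> 0" if "1 \<le> j" for j k
    unfolding s using that by (intro nz) simp
  have P: "Pden N \<xi> t \<noteq> 0"
    unfolding Pden_def by (simp add: dn sn)
  have one: "theta1 (\<xi> l) t \<noteq> 0" "theta1 (2 * \<xi> l) (2 * t) \<noteq> 0" "theta1 (2 * \<xi> l) t \<noteq> 0" "theta1 (\<xi> l) (t / 2) \<noteq> 0" "theta0 (2 * \<xi> l) (2 * t) \<noteq> 0"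
    if "1 \<le> l" for l
    unfolding m2 unfolding \<xi>_def using that by (intro nz; simp)+
  have sum: "(\<Sum>k\<in>{1..N}. \<xi> k) = of_nat (\<Sum>{1..N}) * u"
    by (simp add: \<xi>_def sum_distrib_right)
  have "(1::nat) \<le> \<Sum>{1..N}" using N member_le_sum[of 1 "{1..N}" "\<lambda>x. x"] by simp
  from nz(5)[OF this] nz(6)[OF this] have th: "theta_s N (\<Sum>k\<in>{1..N}. \<xi> k) t \<noteq> 0"
    unfolding theta_s_def sum by (cases "even N") (simp_all only: if_True if_False not_False_eq_True)
  have pa: "(\<Prod>j\<in>{1..N}. \<Prod>k\<in>{j<..N}. theta1 (\<xi> k - \<xi> j) t) \<noteq> 0"
    by (simp add: dn)
  have pr: "(\<Prod>l\<in>{1..N}. theta1 (\<xi> l) t) \<noteq> 0" "(\<Prod>l\<in>{1..N}. theta1 (2 * \<xi> l) (2 * t)) \<noteq> 0"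
    "(\<Prod>l\<in>{1..N}. theta1 (2 * \<xi> l) t) \<noteq> 0" "(\<Prod>l\<in>{1..N}. theta1 (\<xi> l) (t / 2)) \<noteq> 0"
    "(\<Prod>l\<in>{1..N}. theta1 (\<xi> l) t * theta0 (2 * \<xi> l) (2 * t)) \<noteq> 0"
    by (simp_all add: one)
  have "macdonald R N \<xi> t \<noteq> 0"
    unfolding macdonald_def
    by (cases R) (simp_all only: Wden.simps th pa pr P mult_eq_0_iff rs.distinct simp_thms if_True if_False one_neq_zero)
  then show ?thesis by (rule that)
qed

section \<open>The seven root systems\<close>

text \<open>In terms of r = m + p the recursion is translation by 2 p and the reflection is r -> 2 p
  - r, so [0, p] is a fundamental domain and completeness is checked there. The endpoints 0 and p
  are fixed modulo 2 p by the reflection, and there the symmetry may force a coefficient to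
  vanish.\<close>

lemma theta_frame_reflectionI:
  fixes p :: int and k :: "nat \<Rightarrow> int"
  assumes t: "Im t > 0" and p: "p > 0" and s: "s = 1 \<or> s = - 1" and \<zeta>: "\<zeta> = 1 \<or> \<zeta> = - 1" and N: "N \<ge> 1"
    and inj: "inj_on k {1..N}" and range: "\<And>i. i \<in> {1..N} \<Longrightarrow> 0 \<le> k i \<and> k i \<le> p"
    and parity: "\<And>i j. even (k i - k j)"
    and k0: "\<And>i. i \<in> {1..N} \<Longrightarrow> k i = 0 \<Longrightarrow> \<zeta> = 1" and kp: "\<And>i. i \<in> {1..N} \<Longrightarrow> k i = p \<Longrightarrow> \<zeta> = s"
    and complete: "\<And>r. 0 \<le> r \<Longrightarrow> r \<le> p \<Longrightarrow> even (r - k 1) \<Longrightarrow>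
      (\<exists>i\<in>{1..N}. k i = r) \<or> (r = 0 \<and> \<zeta> = - 1 \<and> s = 1) \<or> (r = p \<and> \<zeta> * s = - 1)"
  shows "theta_frame t p s \<zeta> N k"
proof
  show "\<zeta> = 0 \<or> \<zeta> = 1 \<or> \<zeta> = - 1" using \<zeta> by blast
  have small: "x = 0" if "2 * p dvd x" "\<bar>x\<bar> < 2 * p" for x
    using that dvd_imp_le_int[of x "2 * p"] by auto
  show "i = j" if "i \<in> {1..N}" "j \<in> {1..N}" "2 * p dvd k i - k j" for i j
  proof -
    have "k i - k j = 0" using small[OF that(3)] range[OF that(1)] range[OF that(2)] p by linarith
    then show ?thesis using inj that by (auto dest: inj_onD)
  qed
  show "i = j \<and> (k i = 0 \<and> \<zeta> = 1 \<or> k i = p \<and> \<zeta> = s)"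
    if "\<zeta> \<noteq> 0" "i \<in> {1..N}" "j \<in> {1..N}" "2 * p dvd k i + k j" for i j
  proof (cases "k i + k j = 2 * p")
    case True
    then have "k i = p" "k j = p" using range[OF that(2)] range[OF that(3)] by linarith+
    then show ?thesis using kp[OF that(2)] inj_onD[OF inj _ that(2,3)] by simp
  next
    case False
    then have "k i + k j = 0" using small[OF that(4)] range[OF that(2)] range[OF that(3)] by linarith
    then have "k i = 0" "k j = 0" using range[OF that(2)] range[OF that(3)] by linarith+
    then show ?thesis using k0[OF that(2)] inj_onD[OF inj _ that(2,3)] by simp
  qed
  fix m assume m: "even (m + p + k 1)"
  define r where "r = (m + p) mod (2 * p)"
  define q where "q = (m + p) div (2 * p)"
  have mr: "m + p = 2 * p * q + r" by (simp add: r_def q_def)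
  have r: "0 \<le> r" "r < 2 * p" using p by (simp_all add: r_def)
  have "even (2 * p * q + r + k 1)" using m mr by simp
  then have ev: "even (r - k 1)" "even (2 * p - r - k 1)" by auto
  have "(\<exists>i\<in>{1..N}. 2 * p dvd m - (k i - p)) \<or> (\<exists>i\<in>{1..N}. 2 * p dvd - m - (k i - p)) \<or>
     (\<zeta> * s = - 1 \<and> 2 * p dvd m) \<or> (\<zeta> = - 1 \<and> s = 1 \<and> 2 * p dvd m + p)"
  proof (cases "r \<le> p")
    case True
    from complete[OF r(1) True ev(1)] show ?thesis
    proof (elim disjE bexE conjE)
      fix i assume "i \<in> {1..N}" "k i = r"
      moreover have "m - (r - p) = 2 * p * q" using mr by simp
      ultimately show ?thesis by (metis dvd_triv_left)
    next
      assume "r = 0" "\<zeta> = - 1" "s = 1"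
      then show ?thesis using mr by simp
    next
      assume "r = p" "\<zeta> * s = - 1"
      then show ?thesis using mr by simp
    qed
  next
    case False
    then have "0 \<le> 2 * p - r" "2 * p - r \<le> p" using r by simp_all
    from complete[OF this ev(2)] obtain i where "i \<in> {1..N}" "k i = 2 * p - r"
      using False r by auto
    moreover have "- m - (2 * p - r - p) = 2 * p * (- q)" using mr by simp
    ultimately show ?thesis by (metis dvd_triv_left)
  qed
  then show "(\<exists>i\<in>{1..N}. 2 * p dvd m - (k i - p)) \<or>
       \<zeta> \<noteq> 0 \<and> ((\<exists>i\<in>{1..N}. 2 * p dvd - m - (k i - p)) \<or>
                (\<zeta> * s = - 1 \<and> 2 * p dvd m) \<or> (\<zeta> = - 1 \<and> s = 1 \<and> 2 * p dvd m + p))"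
    using \<zeta> by auto
qed (use t p s N parity in auto)

text \<open>The numbers 2 j - 1 with j = 1, ..., N represent all odd classes modulo 2 N, so the
  recursion alone reaches every frequency.\<close>

lemma theta_frame_A:
  assumes t: "Im t > 0" and N: "N \<ge> 1"
  shows "theta_frame t (int N) 1 0 N (\<lambda>j. 2 * int j - 1)"
proof
  show "i = j" if "i \<in> {1..N}" "j \<in> {1..N}" "2 * int N dvd (2 * int i - 1) - (2 * int j - 1)" for i j
  proof (rule ccontr)
    assume "i \<noteq> j"
    then have "\<bar>(2 * int i - 1) - (2 * int j - 1)\<bar> \<ge> 2 * int N"
      using dvd_imp_le_int[OF _ that(3)] by simp
    then show False using that(1,2) by auto
  qed
  fix m assume "even (m + int N + (2 * int 1 - 1))"
  then have "even (m + int N + 1)" by simp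
  then obtain q where q: "m + int N + 1 = 2 * q" by (elim evenE)
  define r where "r = (q - 1) mod int N"
  have r: "0 \<le> r" "r < int N" using N by (simp_all add: r_def)
  define i where "i = nat r + 1"
  have i: "i \<in> {1..N}" "2 * int i - 1 = 2 * r + 1" using r by (auto simp: i_def)
  have "q - 1 = int N * ((q - 1) div int N) + r" by (simp add: r_def)
  then have "m - (2 * r + 1 - int N) = 2 * int N * ((q - 1) div int N)" using q by (simp add: algebra_simps)
  then have "2 * int N dvd m - ((2 * int i - 1) - int N)" unfolding i(2) by (metis dvd_triv_left)
  then show "(\<exists>i\<in>{1..N}. 2 * int N dvd m - ((2 * int i - 1) - int N)) \<or>
       (0::complex) \<noteq> 0 \<and> ((\<exists>i\<in>{1..N}. 2 * int N dvd - m - ((2 * int i - 1) - int N)) \<or>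
                ((0::complex) * 1 = - 1 \<and> 2 * int N dvd m) \<or> ((0::complex) = - 1 \<and> (1::complex) = 1 \<and> 2 * int N dvd m + int N))"
    using i(1) by blast
qed (use t N in auto)

text \<open>Outside type A the doubled indices exhaust one parity in [0, calN], except for the
  endpoint 0 in types C and BC and the endpoint \<open>calN\<close> in types Bv and C; there oddness
  kills the coefficient. In type D the bound N >= 2 makes the degree positive.\<close>

lemma theta_frame_rs:
  assumes t: "Im t > 0" and N: "N \<ge> 1" and RD: "R = D \<Longrightarrow> 2 \<le> N"
  shows "theta_frame t (inum R N) (isgn R) (izeta R) N (idx2 R)"
proof (cases "R = A")
  case True
  have "idx2 A = (\<lambda>j. 2 * int j - 1)" by (rule ext) simp
  then show ?thesis using theta_frame_A[OF t N] True by simp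
next
  case False
  show ?thesis
  proof (rule theta_frame_reflectionI[OF t])
    show "inum R N > 0" using N RD by (cases R) auto
    show "isgn R = 1 \<or> isgn R = - 1" by (cases R) auto
    show "izeta R = 1 \<or> izeta R = - 1" using False by (cases R) auto
    show "N \<ge> 1" by (rule N)
    show "inj_on (idx2 R) {1..N}" by (cases R) (auto simp: inj_on_def)
    show "0 \<le> idx2 R i \<and> idx2 R i \<le> inum R N" if "i \<in> {1..N}" for i
      using that False by (cases R) auto
    show "even (idx2 R i - idx2 R j)" for i j by (cases R) auto
    show "izeta R = 1" if "i \<in> {1..N}" "idx2 R i = 0" for i
    proof -
      have "1 \<le> i" "i \<le> N" using that by auto
      then show ?thesis using that(2) False by (cases R; simp?; presburger?)
    qed
    show "izeta R = isgn R" if "i \<in> {1..N}" "idx2 R i = inum R N" for i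
    proof -
      have "1 \<le> i" "i \<le> N" using that by auto
      then show ?thesis using that(2) False by (cases R; simp?; presburger?)
    qed
    fix r assume r: "0 \<le> r" "r \<le> inum R N" "even (r - idx2 R 1)"
    have wit: "\<exists>i\<in>{1..N}. f i = r" if "f (nat x) = r" "1 \<le> x" "x \<le> int N" for f :: "nat \<Rightarrow> int" and x
      using that by (intro bexI[of _ "nat x"]) auto
    show "(\<exists>i\<in>{1..N}. idx2 R i = r) \<or> (r = 0 \<and> izeta R = - 1 \<and> isgn R = 1) \<or> (r = inum R N \<and> izeta R * isgn R = - 1)"
    proof (cases R)
      case A then show ?thesis using False by simp
    next
      case B
      then obtain q where "r = 2 * q" using r by (auto elim: evenE)
      then show ?thesis using B r wit[of "idx2 B" "q + 1"] by simp
    next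
      case Bv
      then obtain q where "r = 2 * q" using r by (auto elim: evenE)
      then show ?thesis using Bv r wit[of "idx2 Bv" "q + 1"] by (cases "q = int N") simp_all
    next
      case C
      then obtain q where "r = 2 * q" using r by (auto elim: evenE)
      then show ?thesis using C r wit[of "idx2 C" q] by (cases "q = 0 \<or> q = int N + 1") auto
    next
      case Cv
      then have "odd r" using r by simp
      then obtain q where "r = 2 * q + 1" by (elim oddE)
      then show ?thesis using Cv r wit[of "idx2 Cv" "q + 1"] by simp
    next
      case BC
      then obtain q where "r = 2 * q" using r by (auto elim: evenE)
      then show ?thesis using BC r wit[of "idx2 BC" q] by (cases "q = 0") auto
    next
      case D
      then obtain q where "r = 2 * q" using r by (auto elim: evenE)
      then show ?thesis using D r wit[of "idx2 D" "q + 1"] by simp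
    qed
  qed
qed

section \<open>The orthonormal basis on the fundamental domain and the determinant formula\<close>

lemma set_integrable_Lam:
  fixes f :: "complex \<Rightarrow> complex"
  assumes "continuous_on UNIV f"
  shows "set_integrable lborel (Lam L W) f"
proof (rule set_integrable_subset)
  show "set_integrable lborel (cbox 0 (Complex L W)) f"
    unfolding set_integrable_def
    by (rule borel_integrable_compact) (auto intro: continuous_on_subset[OF assms])
  show "Lam L W \<subseteq> cbox 0 (Complex L W)"
    by (auto simp: Lam_def in_cbox_complex_iff)
qed simp

lemma bounded_on_Lam:
  fixes f :: "complex \<Rightarrow> complex"
  assumes "continuous_on UNIV f"
  shows "\<exists>c. \<forall>z\<in>Lam L W. norm (f z) \<le> c"
proof -
  have "compact (f ` cbox 0 (Complex L W))"
    by (intro compact_continuous_image continuous_on_subset[OF assms]) auto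
  then have "bounded (f ` cbox 0 (Complex L W))" by (rule compact_imp_bounded)
  then obtain c where c: "\<And>z. z \<in> cbox 0 (Complex L W) \<Longrightarrow> norm (f z) \<le> c"
    by (auto simp: bounded_iff)
  have "Lam L W \<subseteq> cbox 0 (Complex L W)"
    by (auto simp: Lam_def in_cbox_complex_iff)
  then show ?thesis using c by (intro exI[of _ c]) blast
qed

locale torus_frame = theta_frame "tau L W" p s \<zeta> N k
  for L W :: real and p :: int and s \<zeta> :: complex and N :: nat and k :: "nat \<Rightarrow> int" +
  assumes L: "L > 0" and W: "W > 0"
begin

definition weight :: "complex \<Rightarrow> real" where
  "weight z = exp (- (2 * pi * of_int p * (Im z)\<^sup>2 / (L * W)))"

definition inner_Lam :: "(complex \<Rightarrow> complex) \<Rightarrow> (complex \<Rightarrow> complex) \<Rightarrow> complex" where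
  "inner_Lam f g = (LINT z:Lam L W|lborel. of_real (weight z) * (f (z / L) * cnj (g (z / L))))"

definition tnorm :: "nat \<Rightarrow> real" where
  "tnorm i = L * exp (pi * W * (of_int (k i))\<^sup>2 / (2 * of_int p * L)) * sqrt (L * W / (2 * of_int p))"

text \<open>The factor 4 occurs when the two summands of the basis function coincide.\<close>

definition bnorm :: "nat \<Rightarrow> real" where
  "bnorm i = (if \<zeta> = 0 then 1 else if 2 * p dvd k i + k i then 4 else 2) * tnorm i"

abbreviation tb :: "int \<Rightarrow> complex \<Rightarrow> complex" where
  "tb \<equiv> tbasis s p (tau L W)"

lemma continuous_tb: "continuous_on UNIV (tb j)"
  by (rule holomorphic_on_imp_continuous_on[OF has_fourier_holomorphic[OF has_fourier_tbasis[OF t p s]]])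

lemma continuous_basis: "continuous_on UNIV (basis i)"
  by (rule holomorphic_on_imp_continuous_on[OF has_fourier_holomorphic[OF has_fourier_basis]])

lemma tnorm_pos: "tnorm i > 0"
  using L W p by (simp add: tnorm_def)

lemma bnorm_pos: "bnorm i > 0"
  using tnorm_pos[of i] by (simp add: bnorm_def)

lemma inner_Lam_add:
  assumes "continuous_on UNIV f" "continuous_on UNIV f'" "continuous_on UNIV g" "continuous_on UNIV g'"
  shows "inner_Lam (\<lambda>v. f v + a * f' v) (\<lambda>v. g v + b * g' v)
    = inner_Lam f g + a * inner_Lam f' g + cnj b * inner_Lam f g' + a * cnj b * inner_Lam f' g'"
proof -
  have cw: "continuous_on UNIV (\<lambda>z. complex_of_real (weight z))"
    unfolding weight_def using L W by (intro continuous_intros) auto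
  have int: "set_integrable lborel (Lam L W) (\<lambda>z. of_real (weight z) * (f (z / L) * cnj (g (z / L))))"
    if "continuous_on UNIV f" "continuous_on UNIV g" for f g
    using L by (intro set_integrable_Lam continuous_intros cw continuous_on_compose2[OF that(1)] continuous_on_compose2[OF that(2)]) auto
  define I where "I f g z = of_real (weight z) * (f (z / L) * cnj (g (z / L)))" for f g z
  have i: "set_integrable lborel (Lam L W) (I f g)" if "continuous_on UNIV f" "continuous_on UNIV g" for f g
    unfolding I_def[abs_def] by (rule int[OF that])
  have ic: "set_integrable lborel (Lam L W) (\<lambda>z. c * I f g z)" if "continuous_on UNIV f" "continuous_on UNIV g" for f g c
    using set_integrable_mult_right[of c lborel "Lam L W" "I f g"] i[OF that] by blast
  have "of_real (weight z) * ((f (z / L) + a * f' (z / L)) * cnj (g (z / L) + b * g' (z / L)))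
     = I f g z + a * I f' g z + cnj b * I f g' z + a * cnj b * I f' g' z" for z
    by (simp add: I_def algebra_simps)
  then have "inner_Lam (\<lambda>v. f v + a * f' v) (\<lambda>v. g v + b * g' v)
     = (LINT z:Lam L W|lborel. I f g z + a * I f' g z + cnj b * I f g' z + a * cnj b * I f' g' z)"
    by (simp only: inner_Lam_def)
  also have "\<dots> = (LINT z:Lam L W|lborel. I f g z) + (LINT z:Lam L W|lborel. a * I f' g z)
       + (LINT z:Lam L W|lborel. cnj b * I f g' z) + (LINT z:Lam L W|lborel. a * cnj b * I f' g' z)"
    using assms by (simp only: set_integral_add i ic)
  finally show ?thesis by (simp only: set_integral_mult_right inner_Lam_def I_def)
qed

lemma inner_tb_zero: "even (i - j) \<Longrightarrow> \<not> 2 * p dvd i - j \<Longrightarrow> inner_Lam (tb i) (tb j) = 0"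
  unfolding inner_Lam_def weight_def by (rule integral_tbasis_orthogonal[OF L W p s])

lemma inner_tb_norm: "inner_Lam (tb (k i)) (tb (k i)) = of_real (tnorm i)" "inner_Lam (tb (- k i)) (tb (- k i)) = of_real (tnorm i)"
  unfolding inner_Lam_def weight_def tnorm_def integral_tbasis_norm[OF L W p s] by simp_all

text \<open>Of the four products of summands, the mixed ones vanish unless k_i and - k_j agree
  modulo 2 p. By \<open>reflected\<close> this forces i = j, and then the function is twice a single
  summand.\<close>

lemma inner_basis:
  assumes i: "i \<in> {1..N}" and j: "j \<in> {1..N}"
  shows "inner_Lam (basis i) (basis j) = (if i = j then of_real (bnorm i) else 0)"
proof -
  have exp: "inner_Lam (basis i) (basis j) = inner_Lam (tb (k i)) (tb (k j)) + \<zeta> * inner_Lam (tb (- k i)) (tb (k j))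
     + cnj \<zeta> * inner_Lam (tb (k i)) (tb (- k j)) + \<zeta> * cnj \<zeta> * inner_Lam (tb (- k i)) (tb (- k j))"
    unfolding basis_def[abs_def] by (intro inner_Lam_add continuous_tb)
  have ev: "even (k i - k j)" "even (- k i - k j)" "even (k i - - k j)" "even (- k i - - k j)"
    using parity[OF i j] by auto
  have z23: "\<zeta> = 0 \<or> inner_Lam (tb (- k i)) (tb (k j)) = 0 \<and> inner_Lam (tb (k i)) (tb (- k j)) = 0" if "\<zeta> = 0 \<or> \<not> 2 * p dvd k i + k j"
  proof (cases "\<zeta> = 0")
    case False
    then have nd: "\<not> 2 * p dvd k i + k j" using that by blast
    have "\<not> 2 * p dvd - k i - k j"
    proof
      assume "2 * p dvd - k i - k j"
      then have "2 * p dvd - (- k i - k j)" by (simp only: dvd_minus_iff)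
      then show False using nd by (simp add: add.commute)
    qed
    then show ?thesis using nd inner_tb_zero[OF ev(2)] inner_tb_zero[OF ev(3)] by simp
  qed simp
  show ?thesis
  proof (cases "i = j")
    case False
    then have "\<not> 2 * p dvd k i - k j" using distinct[OF i j] by blast
    moreover from this have "\<not> 2 * p dvd - k i - - k j"
    proof -
      have "- k i - - k j = - (k i - k j)" by simp
      then show ?thesis using \<open>\<not> 2 * p dvd k i - k j\<close> by (simp only: dvd_minus_iff not_False_eq_True)
    qed
    moreover have "\<zeta> = 0 \<or> \<not> 2 * p dvd k i + k j" using reflected[OF _ i j] False by blast
    ultimately show ?thesis
      using False z23 inner_tb_zero[OF ev(1)] inner_tb_zero[OF ev(4)] unfolding exp by auto
  next
    case True
    show ?thesis
    proof (cases "\<zeta> \<noteq> 0 \<and> 2 * p dvd k i + k i")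
      case sp: True
      then have "basis i = (\<lambda>v. tb (k i) v + 1 * tb (k i) v)"
        by (intro ext) (simp add: basis_special[OF i])
      then have "inner_Lam (basis i) (basis i) = inner_Lam (tb (k i)) (tb (k i)) + 1 * inner_Lam (tb (k i)) (tb (k i))
          + cnj 1 * inner_Lam (tb (k i)) (tb (k i)) + 1 * cnj 1 * inner_Lam (tb (k i)) (tb (k i))"
        by (simp only: inner_Lam_add[OF continuous_tb continuous_tb continuous_tb continuous_tb])
      then show ?thesis using True sp by (simp add: inner_tb_norm bnorm_def)
    next
      case False
      then have "\<zeta> = 0 \<or> \<not> 2 * p dvd k i + k j" using True by blast
      moreover have "\<zeta> * cnj \<zeta> = (if \<zeta> = 0 then 0 else 1)" using \<zeta> by auto
      ultimately show ?thesis
        using z23 False True unfolding exp by (auto simp: inner_tb_norm bnorm_def)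
    qed
  qed
qed

text \<open>The Gaussian weight is split evenly: its square root goes into each function, so that
  the density becomes the squared modulus of a determinant.\<close>

definition orb :: "nat \<Rightarrow> complex \<Rightarrow> complex" where
  "orb i z = of_real (exp (- (pi * of_int p * (Im z)\<^sup>2 / (L * W)))) * basis i (z / L) * of_real (1 / sqrt (bnorm i))"

lemma continuous_orb: "continuous_on UNIV (orb i)"
  unfolding orb_def[abs_def] using L W bnorm_pos[of i]
  by (intro continuous_intros continuous_on_compose2[OF continuous_basis]) auto

lemma orthonormal_orb: "orthonormal_system lborel (Lam L W) orb N"
proof
  show "Lam L W \<in> sets lborel" by simp
  show "emeasure lborel (Lam L W) < \<infinity>" by (rule emeasure_Lam)
  show "orb i \<in> borel_measurable lborel" for i
    using borel_measurable_continuous_onI[OF continuous_orb] by simp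
  show "\<exists>c. \<forall>u\<in>Lam L W. norm (orb i u) \<le> c" for i
    by (rule bounded_on_Lam[OF continuous_orb])
  fix i j assume i: "i \<in> {1..N}" and j: "j \<in> {1..N}"
  have "orb i z * cnj (orb j z) = of_real (1 / (sqrt (bnorm i) * sqrt (bnorm j))) * (of_real (weight z) * (basis i (z / L) * cnj (basis j (z / L))))" for z
  proof -
    have "exp (- (pi * of_int p * (Im z)\<^sup>2 / (L * W))) * exp (- (pi * of_int p * (Im z)\<^sup>2 / (L * W))) = weight z"
      unfolding weight_def exp_add[symmetric] by (rule arg_cong[of _ _ exp]) simp
    from arg_cong[OF this, of complex_of_real] show ?thesis by (simp add: orb_def)
  qed
  then have "(LINT z:Lam L W|lborel. orb i z * cnj (orb j z)) = of_real (1 / (sqrt (bnorm i) * sqrt (bnorm j))) * inner_Lam (basis i) (basis j)"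
    by (simp only: set_integral_mult_right inner_Lam_def)
  also have "\<dots> = (if i = j then 1 else 0)"
  proof (cases "i = j")
    case True
    have "sqrt (bnorm i) * sqrt (bnorm i) = bnorm i" using bnorm_pos[of i] by simp
    then show ?thesis
      using bnorm_pos[of i] unfolding True[symmetric] inner_basis[OF i i] by (simp only:) simp
  qed (simp add: inner_basis[OF i j])
  finally show "(LINT z:Lam L W|lborel. orb i z * cnj (orb j z)) = (if i = j then 1 else 0)" .
qed

lemma detn_orb:
  "detn N (\<lambda>l i. orb i (z l)) = of_real (\<Prod>l\<in>{1..N}. exp (- (pi * of_int p * (Im (z l))\<^sup>2 / (L * W))) * (1 / sqrt (bnorm l)))
     * detn N (\<lambda>l i. basis i (z l / L))"
  unfolding orb_def detn_scale of_real_prod of_real_mult by simp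

lemma norm_detn_orb:
  "(cmod (detn N (\<lambda>l i. orb i (z l))))\<^sup>2 = exp (- (2 * pi * of_int p / (L * W)) * (\<Sum>l\<in>{1..N}. (Im (z l))\<^sup>2))
     * (cmod (detn N (\<lambda>l i. basis i (z l / L))))\<^sup>2 / (\<Prod>l\<in>{1..N}. bnorm l)"
proof -
  have "(\<Prod>l\<in>{1..N}. exp (- (pi * of_int p * (Im (z l))\<^sup>2 / (L * W))) * (1 / sqrt (bnorm l)))\<^sup>2
      = (\<Prod>l\<in>{1..N}. exp (- (2 * pi * of_int p / (L * W)) * (Im (z l))\<^sup>2) / bnorm l)"
    unfolding prod_power_distrib
  proof (rule prod.cong[OF refl])
    fix l
    have "(exp (- (pi * of_int p * (Im (z l))\<^sup>2 / (L * W))))\<^sup>2 = exp (- (2 * pi * of_int p / (L * W)) * (Im (z l))\<^sup>2)"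
      unfolding power2_eq_square[of "exp _"] exp_add[symmetric] by (rule arg_cong[of _ _ exp]) simp
    then show "(exp (- (pi * of_int p * (Im (z l))\<^sup>2 / (L * W))) * (1 / sqrt (bnorm l)))\<^sup>2
        = exp (- (2 * pi * of_int p / (L * W)) * (Im (z l))\<^sup>2) / bnorm l"
      using bnorm_pos[of l] by (simp add: power_mult_distrib power_divide)
  qed
  also have "\<dots> = exp (- (2 * pi * of_int p / (L * W)) * (\<Sum>l\<in>{1..N}. (Im (z l))\<^sup>2)) / (\<Prod>l\<in>{1..N}. bnorm l)"
    by (simp only: prod_dividef sum_distrib_left exp_sum finite_atLeastAtMost)
  finally show ?thesis
    unfolding detn_orb norm_mult norm_of_real power_mult_distrib power2_abs by simp
qed

end

context torus_frame
begin

sublocale orb: orthonormal_system lborel "Lam L W" orb N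
  by (rule orthonormal_orb)

lemma ex_basis_nonzero:
  obtains x where "detn N (\<lambda>l i. basis i (x l)) \<noteq> 0"
proof -
  obtain z where "detn N (\<lambda>l i. orb i (z l)) \<noteq> 0" by (rule orb.ex_detn_nonzero)
  then have "detn N (\<lambda>l i. basis i (z l / L)) \<noteq> 0" unfolding detn_orb by simp
  then show ?thesis by (rule that)
qed

text \<open>Alternation transports the span property from the first variable to variable j: the
  transposition of 1 and j only changes the sign of the coefficients.\<close>

lemma macdonald_eq_detn:
  assumes R: "\<And>\<xi>. quasi (tau L W) \<iota> s p 0 (\<lambda>v. macdonald R N (\<xi>(1 := v)) (tau L W))"
    and sym: "\<And>\<xi> v. \<zeta> \<noteq> 0 \<Longrightarrow> macdonald R N (\<xi>(1 := - v)) (tau L W) = \<zeta> * s * macdonald R N (\<xi>(1 := v)) (tau L W)"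
  obtains \<kappa> where "\<kappa> \<noteq> 0" "\<And>\<xi>. macdonald R N \<xi> (tau L W) = \<kappa> * detn N (\<lambda>l i. basis i (\<xi> l))"
proof -
  let ?F = "\<lambda>\<xi>. macdonald R N \<xi> (tau L W)"
  have first: "\<exists>c. \<forall>w. ?F (\<xi>(1 := w)) = (\<Sum>i\<in>{1..N}. c i * basis i w)" for \<xi>
  proof -
    obtain c where "\<And>w. ?F (\<xi>(1 := w)) = (\<Sum>i\<in>{1..N}. c i * basis i w)"
      proof (rule quasi_span[OF R[of \<xi>] sym[of \<xi>]])
      fix c assume "\<And>w. ?F (\<xi>(1 := w)) = (\<Sum>i\<in>{1..N}. c i * basis i w)"
      then show thesis by (rule that)
    qed
    then show ?thesis by (intro exI[of _ c]) simp
  qed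
  have span: "\<exists>c. \<forall>w. ?F (\<xi>(j := w)) = (\<Sum>i\<in>{1..N}. c i * basis i w)" if j: "j \<in> {1..N}" for j \<xi>
  proof (cases "j = 1")
    case True
    then show ?thesis using first by simp
  next
    case False
    let ?t = "Transposition.transpose 1 j"
    have one: "1 \<in> {1..N}" using N by simp
    have sgn: "sign ?t = - 1" using False by (simp add: sign_swap_id)
    obtain c where c: "\<And>w. ?F ((\<xi> \<circ> ?t)(1 := w)) = (\<Sum>i\<in>{1..N}. c i * basis i w)"
      using first by blast
    have "?F (\<xi>(j := w)) = (\<Sum>i\<in>{1..N}. (- c i) * basis i w)" for w
    proof -
      have "\<xi>(j := w) \<circ> ?t = (\<xi> \<circ> ?t)(1 := w)"
        using False by (auto simp: fun_eq_iff Transposition.transpose_def)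
      then have "?F ((\<xi> \<circ> ?t)(1 := w)) = - ?F (\<xi>(j := w))"
        using macdonald_permutes[OF permutes_swap_id[OF one j], of R "\<xi>(j := w)" "tau L W"] by (simp add: sgn)
      then show ?thesis using c[of w] by (simp add: sum_negf)
    qed
    then show ?thesis by (intro exI[of _ "\<lambda>i. - c i"]) simp
  qed
  obtain x where x: "detn N (\<lambda>l i. basis i (x l)) \<noteq> 0" by (rule ex_basis_nonzero)
  obtain \<kappa> where \<kappa>: "\<And>\<xi>. ?F \<xi> = \<kappa> * detn N (\<lambda>l i. basis i (\<xi> l))"
    by (rule alternating_proportional_detn[where F = ?F and \<phi> = basis, OF macdonald_cong macdonald_permutes span x]) auto
  obtain \<xi> where "?F \<xi> \<noteq> 0" by (rule macdonald_nonzero[OF t N])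
  then have "\<kappa> \<noteq> 0" using \<kappa>[of \<xi>] by auto
  then show ?thesis using \<kappa> by (rule that)
qed

lemma integral_norm_detn_orb:
  assumes "n \<le> N"
  shows "of_real (int_Lam L W {n+1..N} (\<lambda>w. (cmod (detn N (\<lambda>l i. orb i (orb.patch n z w l))))\<^sup>2))
    = fact (N - n) * detn n (\<lambda>j k. orb.K (z j) (z k))"
  using orb.integral_detn_patch[OF assms order_refl, of z]
  unfolding int_Lam_def set_integral_complex_of_real[symmetric] orb.detn_K by simp

lemma orb_add_L: "i \<in> {1..N} \<Longrightarrow> orb i (z + of_real L) = \<iota> * orb i z"
  using quasiD1[OF quasi_basis, of i "z / L"] L by (simp add: orb_def add_divide_distrib)

text \<open>The Gaussian factor changes by exactly the inverse modulus of the quasi-period factor.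
  The remaining phase depends on \<open>z\<close> but is the same for all basis functions.\<close>

lemma orb_add_iW:
  obtains u where "cmod u = 1" "\<And>i. i \<in> {1..N} \<Longrightarrow> orb i (z + \<i> * of_real W) = u * orb i z"
proof -
  let ?g = "\<lambda>y::real. exp (- (pi * of_int p * y\<^sup>2 / (L * W)))"
  let ?e = "exp (- (pi * \<i> * (of_int p * tau L W + 2 * of_int p * (z / L) + 2 * 0)))"
  define u where "u = of_real (?g (Im z + W) / ?g (Im z)) * (s * ?e)"
  have p': "real_of_int p > 0" using p by simp
  have "cmod ?e = exp (pi * of_int p * W / L + 2 * pi * of_int p * Im z / L)"
    unfolding norm_exp_eq_Re by (rule arg_cong[of _ _ exp]) (use L in \<open>simp add: tau_def field_simps\<close>)
  moreover have "?g (Im z + W) / ?g (Im z) = exp (- (pi * of_int p * W / L + 2 * pi * of_int p * Im z / L))"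
    unfolding exp_diff[symmetric]
    by (rule arg_cong[of _ _ exp]) (use L W in \<open>simp add: power2_eq_square field_simps\<close>)
  moreover have "cmod s = 1" using s by auto
  ultimately have "cmod u = 1"
    by (simp only: u_def norm_mult norm_of_real abs_exp_cancel mult_1_left exp_add[symmetric]) simp
  moreover have "orb i (z + \<i> * of_real W) = u * orb i z" if i: "i \<in> {1..N}" for i
  proof -
    have "(z + \<i> * of_real W) / L = z / L + tau L W"
      using L by (simp add: tau_def add_divide_distrib)
    then have "basis i ((z + \<i> * of_real W) / L) = s * ?e * basis i (z / L)"
      using quasiD2[OF quasi_basis[OF i], of "z / L"] by simp
    moreover have "complex_of_real (?g (Im z + W)) = of_real (?g (Im z + W) / ?g (Im z)) * of_real (?g (Im z))"
      unfolding of_real_mult[symmetric] by simp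
    ultimately show ?thesis
      unfolding orb_def u_def by (simp del: of_real_divide)
  qed
  ultimately show ?thesis by (rule that)
qed

text \<open>A common phase at one point multiplies a row of the kernel matrix by u and the
  corresponding column by its conjugate, and the two cancel.\<close>

lemma detn_K_update:
  assumes u: "cmod u = 1" and sh: "\<And>i. i \<in> {1..N} \<Longrightarrow> orb i w = u * orb i (z j)"
  shows "detn n (\<lambda>a b. orb.K ((z(j := w)) a) ((z(j := w)) b)) = detn n (\<lambda>a b. orb.K (z a) (z b))"
proof -
  define d where "d a = (if a = j then u else 1)" for a
  have d1: "d a * cnj (d a) = 1" for a
    using u by (simp add: d_def complex_norm_square[symmetric])
  have o: "orb i ((z(j := w)) a) = d a * orb i (z a)" if "i \<in> {1..N}" for i a
    using sh[OF that] by (simp add: d_def)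
  have "orb.K ((z(j := w)) a) ((z(j := w)) b) = d a * orb.K (z a) (z b) * cnj (d b)" for a b
    unfolding orb.K_def sum_distrib_left sum_distrib_right
    by (rule sum.cong[OF refl]) (simp only: o complex_cnj_mult mult_ac)
  then show ?thesis
    by (simp only: detn_scale d1 prod.neutral_const mult_1_left)
qed

end

section \<open>Identification with the functions M_j and the constants h_j\<close>

text \<open>Outside type A the reflected summand of M_j carries the sign izeta isgn; rewriting it by
  \<open>tbasis_minus\<close> produces another isgn, and izeta is left.\<close>

lemma Mfun_eq_tbasis:
  "Mfun R N L W j z = tbasis (isgn R) (inum R N) (tau L W) (idx2 R j) (z / L)
     + izeta R * tbasis (isgn R) (inum R N) (tau L W) (- idx2 R j) (z / L)"
proof -
  let ?k = "idx2 R j" and ?p = "inum R N" and ?s = "isgn R"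
  let ?th = "if R \<in> {B, Bv} then theta1 else theta2"
  have s: "?s = 1 \<or> ?s = - 1" by (cases R) auto
  have th: "(if ?s = 1 then theta2 else theta1) = ?th" by (cases R) auto
  have c1: "2 * pi * \<i> * of_real (Jidx R j) * z / of_real L = pi * \<i> * of_int ?k * (z / L)"
    "- 2 * pi * \<i> * of_real (Jidx R j) * z / of_real L = pi * \<i> * of_int ?k * (- (z / L))"
    by (simp_all add: Jidx_eq)
  have c2: "of_real (Jidx R j) * tau L W + of_real (calN R N) * z / of_real L = of_int ?k / 2 * tau L W + of_int ?p * (z / L)"
    "of_real (Jidx R j) * tau L W - of_real (calN R N) * z / of_real L = of_int ?k / 2 * tau L W + of_int ?p * (- (z / L))"
    "of_real (calN R N) * tau L W = of_int ?p * tau L W"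
    by (simp_all add: Jidx_eq calN_eq)
  have p1: "exp (2 * pi * \<i> * of_real (Jidx R j) * z / of_real L) *
      ?th (of_real (Jidx R j) * tau L W + of_real (calN R N) * z / of_real L) (of_real (calN R N) * tau L W)
      = tbasis ?s ?p (tau L W) ?k (z / L)"
    unfolding tbasis_def th c1 c2 ..
  have p2: "exp (- 2 * pi * \<i> * of_real (Jidx R j) * z / of_real L) *
      ?th (of_real (Jidx R j) * tau L W - of_real (calN R N) * z / of_real L) (of_real (calN R N) * tau L W)
      = ?s * tbasis ?s ?p (tau L W) (- ?k) (z / L)"
    unfolding tbasis_minus[OF s, symmetric] unfolding tbasis_def th c1 c2 ..
  show ?thesis
  proof (cases R)
    case A
    then show ?thesis using p1 by (simp add: Mfun_def Let_def)
  next
    case D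
    then show ?thesis using p1 p2 by (simp add: Mfun_def Let_def)
  qed (use p1 p2 in \<open>simp_all add: Mfun_def Let_def\<close>)
qed

text \<open>At these indices the two summands of M_j coincide up to sign, which explains where h_j
  has the factor 4 instead of 2.\<close>

lemma idx2_boundary:
  assumes "1 \<le> j" "j \<le> N" "R \<noteq> A"
  shows "idx2 R j = 0 \<or> idx2 R j = inum R N \<longleftrightarrow> R \<in> {B, Bv} \<and> j = 1 \<or> R = D \<and> (j = 1 \<or> j = N)"
proof (cases R)
  case B
  have "2 * (int j - 1) \<noteq> 2 * int N - 1" by presburger
  then show ?thesis using B assms by auto
next
  case Cv
  have "2 * int j - 1 \<noteq> 0" "2 * int j - 1 \<noteq> 2 * int N" by presburger+
  then show ?thesis using Cv by simp
next
  case BC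
  have "2 * int j \<noteq> 2 * int N + 1" by presburger
  then show ?thesis using BC assms by simp
qed (use assms in auto)

lemma (in torus_frame) hconst_eq:
  assumes fr: "p = inum R N" "s = isgn R" "\<zeta> = izeta R" "k = idx2 R" and j: "j \<in> {1..N}"
  shows "hconst R N L W j = of_real (bnorm j)"
proof -
  have p': "real_of_int p > 0" using p by simp
  have e: "exp (- 2 * tau L W * pi * \<i> * of_real ((Jidx R j)\<^sup>2) / of_real (calN R N))
     = complex_of_real (exp (pi * W * (of_int (k j))\<^sup>2 / (2 * of_int p * L)))"
  proof -
    have "- 2 * tau L W * pi * \<i> * of_real ((Jidx R j)\<^sup>2) / of_real (calN R N)
      = complex_of_real (pi * W * (of_int (k j))\<^sup>2 / (2 * of_int p * L))"
      using p' L unfolding Jidx_eq calN_eq fr(1,4)[symmetric] by (simp add: tau_def power2_eq_square field_simps)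
    then show ?thesis by (simp only: exp_of_real)
  qed
  \<comment> \<open>Since Im tau = W / L, the constant of h_j equals the factor L sqrt(L W / (2
    calN)) found from the Gaussian integral.\<close>
  have c: "L * W / sqrt (2 * calN R N * Im (tau L W)) = L * sqrt (L * W / (2 * of_int p))"
  proof -
    have "sqrt (2 * calN R N * Im (tau L W)) * sqrt (L * W / (2 * of_int p)) = sqrt (W\<^sup>2)"
      unfolding real_sqrt_mult[symmetric] calN_eq fr(1)[symmetric] using p' L
      by (intro arg_cong[of _ _ sqrt]) (simp add: tau_def power2_eq_square field_simps)
    also have "\<dots> = W" using W by simp
    finally have q: "sqrt (2 * calN R N * Im (tau L W)) * sqrt (L * W / (2 * of_int p)) = W" .
    then have "sqrt (2 * calN R N * Im (tau L W)) \<noteq> 0" using W by auto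
    then have "sqrt (L * W / (2 * of_int p)) = W / sqrt (2 * calN R N * Im (tau L W))"
      using q by (simp add: field_simps)
    then show ?thesis by simp
  qed
  have m: "(if R = A then 1 else if R \<in> {B, Bv} then (if j = 1 then 4 else 2)
      else if R = D then (if j = 1 \<or> j = N then 4 else 2) else 2)
     = complex_of_real (if \<zeta> = 0 then 1 else if 2 * p dvd k j + k j then 4 else 2)"
  proof -
    have jr: "1 \<le> j" "j \<le> N" using j by auto
    have dvd: "2 * p dvd k j + k j \<longleftrightarrow> k j = 0 \<or> k j = p" if "\<zeta> \<noteq> 0"
    proof
      assume "2 * p dvd k j + k j"
      then show "k j = 0 \<or> k j = p" using reflected[OF that j j] by blast
    next
      assume "k j = 0 \<or> k j = p"
      then show "2 * p dvd k j + k j" by (elim disjE) simp_all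
    qed
    show ?thesis
    proof (cases "R = A")
      case False
      then have "\<zeta> \<noteq> 0" unfolding fr by (cases R) auto
      have iff: "2 * p dvd k j + k j \<longleftrightarrow> R \<in> {B, Bv} \<and> j = 1 \<or> R = D \<and> (j = 1 \<or> j = N)"
        unfolding dvd[OF \<open>\<zeta> \<noteq> 0\<close>] unfolding fr by (rule idx2_boundary[OF jr False])
      show ?thesis
        unfolding iff using False \<open>\<zeta> \<noteq> 0\<close> by auto
    qed (simp add: fr)
  qed
  show ?thesis
    unfolding hconst_def Let_def m e c bnorm_def tnorm_def of_real_mult by (simp only: mult_ac)
qed

theorem theorem3p2:
  fixes L W :: real and N N' :: nat and R :: rs and z :: "nat \<Rightarrow> complex"
  assumes "0 < L" and "0 < W" and "1 \<le> N" and "R = D \<Longrightarrow> 2 \<le> N"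
    and "1 \<le> N'" and "N' \<le> N"
  shows "complex_of_real (rho R N L W N' z) = detn N' (\<lambda>j k. Kker R N L W (z j) (z k))
    \<and> (\<forall>j\<in>{1..N'}. rho R N L W N' (z(j := z j + of_real L)) = rho R N L W N' z
                  \<and> rho R N L W N' (z(j := z j + \<i> * of_real W)) = rho R N L W N' z)"
proof -
  have t: "Im (tau L W) > 0" using assms(1,2) by (simp add: tau_def)
  interpret theta_frame "tau L W" "inum R N" "isgn R" "izeta R" N "idx2 R"
    by (rule theta_frame_rs[OF t assms(3,4)])
  interpret torus_frame L W "inum R N" "isgn R" "izeta R" N "idx2 R"
    by unfold_locales (rule assms(1,2))+
  have M: "Mfun R N L W i w = basis i (w / L)" for i w
    unfolding basis_def by (rule Mfun_eq_tbasis)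
  have h: "hconst R N L W i = of_real (bnorm i)" if "i \<in> {1..N}" for i
    by (rule hconst_eq[OF refl refl refl refl that])
  \<comment> \<open>Both the Gaussian prefactor and 1 / h_i split symmetrically between the two
    arguments, h_i being a positive real number.\<close>
  have K: "Kker R N L W u w = orb.K u w" for u w
  proof -
    have "exp (- pi * calN R N * ((Im u)\<^sup>2 + (Im w)\<^sup>2) / (L * W))
        = exp (- (pi * of_int (inum R N) * (Im u)\<^sup>2 / (L * W))) * exp (- (pi * of_int (inum R N) * (Im w)\<^sup>2 / (L * W)))"
      unfolding exp_add[symmetric] calN_eq by (rule arg_cong[of _ _ exp]) (simp add: add_divide_distrib diff_divide_distrib distrib_left)
    moreover have "(1 / hconst R N L W i) * Mfun R N L W i u * cnj (Mfun R N L W i w)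
        = (basis i (u / L) * of_real (1 / sqrt (bnorm i))) * cnj (basis i (w / L) * of_real (1 / sqrt (bnorm i)))"
      if "i \<in> {1..N}" for i
    proof -
      have "1 / bnorm i = 1 / sqrt (bnorm i) * (1 / sqrt (bnorm i))" using bnorm_pos[of i] by simp
      then have "complex_of_real (1 / bnorm i) = of_real (1 / sqrt (bnorm i)) * of_real (1 / sqrt (bnorm i))"
        by (simp only: of_real_mult)
      moreover have "1 / hconst R N L W i = complex_of_real (1 / bnorm i)"
        unfolding h[OF that] by simp
      ultimately have "1 / hconst R N L W i = of_real (1 / sqrt (bnorm i)) * of_real (1 / sqrt (bnorm i))"
        by simp
      then show ?thesis by (simp only: M complex_cnj_mult complex_cnj_complex_of_real mult_ac)
    qed
    ultimately show ?thesis
      unfolding Kker_def orb.K_def sum_distrib_left orb_def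
      by (intro sum.cong refl) (simp only: complex_cnj_mult complex_cnj_complex_of_real of_real_mult mult_ac)
  qed
  obtain \<kappa> where \<kappa>: "\<kappa> \<noteq> 0" "\<And>\<xi>. macdonald R N \<xi> (tau L W) = \<kappa> * detn N (\<lambda>l i. basis i (\<xi> l))"
  proof (rule macdonald_eq_detn[of R])
    show "quasi (tau L W) \<iota> (isgn R) (inum R N) 0 (\<lambda>v. macdonald R N (\<xi>(1 := v)) (tau L W))" for \<xi>
      unfolding \<iota>_def by (rule quasi_macdonald_first[OF t assms(3)])
    show "macdonald R N (\<xi>(1 := - v)) (tau L W) = izeta R * isgn R * macdonald R N (\<xi>(1 := v)) (tau L W)" if "izeta R \<noteq> 0" for \<xi> v
      using that by (intro macdonald_minus_first[OF assms(3)]) auto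
  qed blast
  define P where "P = (\<Prod>l\<in>{1..N}. bnorm l)"
  have P: "P > 0" unfolding P_def by (intro prod_pos bnorm_pos)
  define c where "c = (cmod \<kappa>)\<^sup>2 * P"
  have c: "c > 0" using \<kappa>(1) P by (simp add: c_def)
  have Q: "Qfun R N L W w = c * (cmod (detn N (\<lambda>l i. orb i (w l))))\<^sup>2" for w
  proof -
    have "(if R = A then (cmod (theta_s N ((\<Sum>k\<in>{1..N}. w k) / of_real L) (tau L W)))\<^sup>2 else 1)
       * (cmod (Wden R N (\<lambda>j. w j / of_real L) (tau L W)))\<^sup>2 = (cmod (macdonald R N (\<lambda>j. w j / of_real L) (tau L W)))\<^sup>2"
      by (simp add: macdonald_def norm_mult power_mult_distrib sum_divide_distrib)
    then show ?thesis
      unfolding Qfun_def norm_detn_orb P_def[symmetric] c_def using P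
      by (simp add: \<kappa>(2) norm_mult power_mult_distrib calN_eq mult.assoc)
  qed
  \<comment> \<open>The integral of |det|^2 is N!, which the factor 1 / N! in \<open>Zconst\<close>
    removes; the constant of proportionality then cancels in the density.\<close>
  have Z: "Zconst R N L W = c"
  proof -
    \<comment> \<open>Indices start at 1, so \<open>patch 0\<close> takes every point from
      \<open>w\<close>.\<close>
    have "detn N (\<lambda>l i. orb i (orb.patch 0 z w l)) = detn N (\<lambda>l i. orb i (w l))" for w
      by (rule detn_cong) (simp add: orb.patch_def)
    then have "complex_of_real (int_Lam L W {1..N} (\<lambda>w. (cmod (detn N (\<lambda>l i. orb i (w l))))\<^sup>2)) = of_real (fact N)"
      using integral_norm_detn_orb[of 0 z] by (simp add: detn_def)
    then have "int_Lam L W {1..N} (\<lambda>w. (cmod (detn N (\<lambda>l i. orb i (w l))))\<^sup>2) = fact N"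
      by (simp only: of_real_eq_iff)
    then have "int_Lam L W {1..N} (Qfun R N L W) = c * fact N"
      unfolding Q[abs_def] by (simp add: int_Lam_def)
    then show ?thesis by (simp add: Zconst_def)
  qed
  have rho: "complex_of_real (rho R N L W N' z) = detn N' (\<lambda>j k. orb.K (z j) (z k))" for z
  proof -
    have "pdens R N L W w = (cmod (detn N (\<lambda>l i. orb i (w l))))\<^sup>2" for w
      using c by (simp add: pdens_def Q Z)
    then have "rho R N L W N' z = (1 / fact (N - N')) * int_Lam L W {N'+1..N} (\<lambda>w. (cmod (detn N (\<lambda>l i. orb i (orb.patch N' z w l))))\<^sup>2)"
      by (simp add: rho_def orb.patch_def)
    then have "complex_of_real (rho R N L W N' z) = (1 / fact (N - N')) * of_real (int_Lam L W {N'+1..N} (\<lambda>w. (cmod (detn N (\<lambda>l i. orb i (orb.patch N' z w l))))\<^sup>2))"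
      by simp
    then show ?thesis unfolding integral_norm_detn_orb[OF assms(6)] by simp
  qed
  have shift: "rho R N L W N' (z(j := w)) = rho R N L W N' z"
    if "cmod u = 1" "\<And>i. i \<in> {1..N} \<Longrightarrow> orb i w = u * orb i (z j)" for j w u
  proof -
    have "complex_of_real (rho R N L W N' (z(j := w))) = of_real (rho R N L W N' z)"
      unfolding rho by (rule detn_K_update[where u = u and w = w and j = j and z = z, OF that])
    then show ?thesis by simp
  qed
  have sL: "rho R N L W N' (z(j := z j + of_real L)) = rho R N L W N' z" for j
    by (rule shift[of \<iota>]) (simp_all add: \<iota>_def orb_add_L)
  have sW: "rho R N L W N' (z(j := z j + \<i> * of_real W)) = rho R N L W N' z" for j
  proof -
    obtain u where "cmod u = 1" "\<And>i. i \<in> {1..N} \<Longrightarrow> orb i (z j + \<i> * of_real W) = u * orb i (z j)"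
      by (rule orb_add_iW[of "z j"]) blast
    then show ?thesis by (rule shift)
  qed
  show ?thesis using rho[of z] sL sW by (simp add: K)
qed

end
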